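(* Let $m,n$ be positive integers, let $\lambda=(\lambda_1,\ldots,\lambda_\ell)$ be a partition of $mn$ such that $0\leq\lambda_1<2m$ and, for any integer $a\geq 2$, define $\tilde\lambda:=(am,\lambda_1,\ldots,\lambda_\ell)$. If $m$ is even, then $$p^{\lambda}_{(n),(m)}\leq p^{\tilde\lambda}_{(n+a),(m)}.$$
   Context: For partitions $\nu\vdash n$ and $\mu\vdash m$, the plethysm coefficients $p^\lambda_{\nu,\mu}$ (for $\lambda\vdash mn$) are the integers defined by the expansion in Schur functions $s_\nu\circ s_\mu=\sum_{\lambda\vdash mn}p^\lambda_{\nu,\mu}s_\lambda$, where $\circ$ is plethysm of symmetric functions. Equivalently, when $\mu=(m)$, $p^\lambda_{\nu,(m)}$ is the multiplicity of the Specht module $S^\lambda$ in the $\mathbb{C}\mathfrak{S}_{mn}$-module $H^{(m^n)}_\nu=\big(\mathrm{Inf}\, S^\nu\big)\big\uparrow_{\mathfrak{S}_m\wr\mathfrak{S}_n}^{\mathfrak{S}_{mn}}$, where $\mathrm{Inf}\,S^\nu$ is the inflation of the Specht module $S^\nu$ of $\mathfrak{S}_n$ along the canonical surjection $\mathfrak{S}_m\wr\mathfrak{S}_n\to\mathfrak{S}_n$. ($S^{(n)}$ is the trivial module of $\mathfrak{S}_n$.) *)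

theory Defs
  imports Complex_Main "HOL-Library.FuncSet" "HOL-Library.Function_Algebras"
    "HOL-Combinatorics.Permutations"
begin

definition fscale :: "complex \<Rightarrow> ('a \<Rightarrow> complex) \<Rightarrow> 'a \<Rightarrow> complex" where
  "fscale c f = (\<lambda>x. c * f x)"

interpretation cfun: vector_space "fscale :: complex \<Rightarrow> ('a \<Rightarrow> complex) \<Rightarrow> 'a \<Rightarrow> complex"
  by unfold_locales (auto simp: fscale_def fun_eq_iff algebra_simps)

text \<open>
  A complex representation of a group of operators \<open>G\<close> (a set of type \<open>'g set\<close>) is given by a
  linear subspace of a space of complex-valued functions together with an action.
\<close>

record ('g, 'a) cmod =
  vecs :: "('a \<Rightarrow> complex) set"
  act :: "'g \<Rightarrow> ('a \<Rightarrow> complex) \<Rightarrow> ('a \<Rightarrow> complex)"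

definition submodule :: "'g set \<Rightarrow> ('g, 'a) cmod \<Rightarrow> ('a \<Rightarrow> complex) set \<Rightarrow> bool" where
  "submodule G M U \<longleftrightarrow>
     cfun.subspace U \<and> U \<subseteq> vecs M \<and> (\<forall>g\<in>G. \<forall>u\<in>U. act M g u \<in> U)"

definition simple_module :: "'g set \<Rightarrow> ('g, 'a) cmod \<Rightarrow> bool" where
  "simple_module G M \<longleftrightarrow>
     vecs M \<noteq> {0} \<and> (\<forall>U. submodule G M U \<longrightarrow> U = {0} \<or> U = vecs M)"

definition iso_modules :: "'g set \<Rightarrow> ('g, 'a) cmod \<Rightarrow> ('g, 'b) cmod \<Rightarrow> bool" where
  "iso_modules G M N \<longleftrightarrow> (\<exists>\<phi>. bij_betw \<phi> (vecs M) (vecs N) \<and>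
     (\<forall>u\<in>vecs M. \<forall>v\<in>vecs M. \<phi> (u + v) = \<phi> u + \<phi> v) \<and>
     (\<forall>c. \<forall>v\<in>vecs M. \<phi> (fscale c v) = fscale c (\<phi> v)) \<and>
     (\<forall>g\<in>G. \<forall>v\<in>vecs M. \<phi> (act M g v) = act N g (\<phi> v)))"

definition simple_decomposition ::
    "'g set \<Rightarrow> ('g, 'a) cmod \<Rightarrow> ('a \<Rightarrow> complex) set set \<Rightarrow> bool" where
  "simple_decomposition G M D \<longleftrightarrow> finite D \<and>
     (\<forall>U\<in>D. submodule G M U \<and> simple_module G (M\<lparr>vecs := U\<rparr>)) \<and>
     (\<forall>v\<in>vecs M. \<exists>!x. x \<in> (\<Pi>\<^sub>E U\<in>D. U) \<and> v = (\<Sum>U\<in>D. x U))"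

definition multiplicity_in :: "'g set \<Rightarrow> ('g, 'b) cmod \<Rightarrow> ('g, 'a) cmod \<Rightarrow> nat" where
  "multiplicity_in G S M = (THE k. \<exists>D. simple_decomposition G M D \<and>
     k = card {U \<in> D. iso_modules G (M\<lparr>vecs := U\<rparr>) S})"

definition is_partition :: "nat list \<Rightarrow> nat \<Rightarrow> bool" where
  "is_partition lam N \<longleftrightarrow> sorted_wrt (\<ge>) lam \<and> 0 \<notin> set lam \<and> sum_list lam = N"

text \<open>The symmetric group of degree \<open>N\<close> acts on \<open>{0, \<dots>, N - 1}\<close>; rows, columns and blocks
  are also counted from 0.\<close>

definition symgrp :: "nat \<Rightarrow> (nat \<Rightarrow> nat) set" where
  "symgrp N = {\<sigma>. \<sigma> permutes {..<N}}"

definition young :: "nat list \<Rightarrow> (nat \<times> nat) set" where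
  "young lam = {(i, j). i < length lam \<and> j < lam ! i}"

definition tableau :: "nat list \<Rightarrow> (nat \<times> nat \<Rightarrow> nat) \<Rightarrow> bool" where
  "tableau lam t \<longleftrightarrow> bij_betw t (young lam) {..<sum_list lam}"

text \<open>The row-equivalence class of a tableau is encoded by its sequence of row contents.\<close>

type_synonym tabloid = "nat \<Rightarrow> nat set"

definition tabloid_of :: "nat list \<Rightarrow> (nat \<times> nat \<Rightarrow> nat) \<Rightarrow> tabloid" where
  "tabloid_of lam t = (\<lambda>i. {t (i, j) | j. (i, j) \<in> young lam})"

definition column_stabilizer :: "nat list \<Rightarrow> (nat \<times> nat \<Rightarrow> nat) \<Rightarrow> (nat \<Rightarrow> nat) set" where
  "column_stabilizer lam t = {\<pi> \<in> symgrp (sum_list lam).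
     \<forall>(i, j)\<in>young lam. \<exists>i'. (i', j) \<in> young lam \<and> \<pi> (t (i, j)) = t (i', j)}"

text \<open>A formal combination of tabloids is the function giving its coefficients; thus the following
  is the sum of \<open>sign \<pi>\<close> times the tabloid of \<open>\<pi> \<circ> t\<close> over the column stabilizer.\<close>

definition polytabloid :: "nat list \<Rightarrow> (nat \<times> nat \<Rightarrow> nat) \<Rightarrow> tabloid \<Rightarrow> complex" where
  "polytabloid lam t = (\<lambda>T. \<Sum>\<pi>\<in>column_stabilizer lam t.
     if T = tabloid_of lam (\<pi> \<circ> t) then of_int (sign \<pi>) else 0)"

definition specht :: "nat list \<Rightarrow> (nat \<Rightarrow> nat, tabloid) cmod" where
  "specht lam = \<lparr>vecs = cfun.span {polytabloid lam t | t. tableau lam t},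
     act = (\<lambda>\<sigma> f T. f (\<lambda>i. inv \<sigma> ` T i))\<rparr>"

text \<open>The wreath product of the symmetric groups of degrees \<open>m\<close> and \<open>n\<close>, as the subgroup of
  \<open>symgrp (m * n)\<close> permuting the blocks \<open>{i * m, \<dots>, i * m + m - 1}\<close> for \<open>i < n\<close>, and its
  canonical surjection onto \<open>symgrp n\<close>.\<close>

definition wreath :: "nat \<Rightarrow> nat \<Rightarrow> (nat \<Rightarrow> nat) set" where
  "wreath m n = {\<sigma> \<in> symgrp (m * n).
     \<forall>x<m * n. \<forall>y<m * n. x div m = y div m \<longleftrightarrow> \<sigma> x div m = \<sigma> y div m}"

definition wreath_top :: "nat \<Rightarrow> nat \<Rightarrow> (nat \<Rightarrow> nat) \<Rightarrow> nat \<Rightarrow> nat" where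
  "wreath_top m n \<sigma> = (\<lambda>i. if i < n then \<sigma> (i * m) div m else i)"

definition inflation :: "('g \<Rightarrow> 'h) \<Rightarrow> ('h, 'a) cmod \<Rightarrow> ('g, 'a) cmod" where
  "inflation q M = \<lparr>vecs = vecs M, act = (\<lambda>g. act M (q g))\<rparr>"

text \<open>Induction from \<open>K\<close> to \<open>G\<close>, realised on the functions \<open>f\<close> from \<open>G\<close> to \<open>M\<close> (uncurried, and
  zero outside \<open>G\<close>) such that \<open>f (k \<circ> g) = k f(g)\<close> for all \<open>k\<close> in \<open>K\<close>; here \<open>G\<close> acts by right
  translation of the argument.\<close>

definition induced :: "('x \<Rightarrow> 'x) set \<Rightarrow> ('x \<Rightarrow> 'x) set \<Rightarrow>
    ('x \<Rightarrow> 'x, 'a) cmod \<Rightarrow> ('x \<Rightarrow> 'x, ('x \<Rightarrow> 'x) \<times> 'a) cmod" where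
  "induced G K M =
     \<lparr>vecs = {f. (\<forall>g x. g \<notin> G \<longrightarrow> f (g, x) = 0) \<and>
               (\<forall>g\<in>G. (\<lambda>x. f (g, x)) \<in> vecs M) \<and>
               (\<forall>k\<in>K. \<forall>g\<in>G. (\<lambda>x. f (k \<circ> g, x)) = act M k (\<lambda>x. f (g, x)))},
      act = (\<lambda>h f (g, x). f (g \<circ> h, x))\<rparr>"

definition foulkes :: "nat list \<Rightarrow> nat \<Rightarrow> (nat \<Rightarrow> nat, (nat \<Rightarrow> nat) \<times> tabloid) cmod" where
  "foulkes \<nu> m = (let n = sum_list \<nu> in
     induced (symgrp (m * n)) (wreath m n) (inflation (wreath_top m n) (specht \<nu>)))"

text \<open>\<open>plethysm_coeff \<nu> m lam\<close> is the coefficient of the Schur function of \<open>lam\<close> in the plethysm of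
  the Schur functions of \<open>\<nu>\<close> and \<open>(m)\<close>, in its module-theoretic form: the multiplicity of the
  Specht module of \<open>lam\<close> in the module induced from the inflated Specht module of \<open>\<nu>\<close>.\<close>

definition plethysm_coeff :: "nat list \<Rightarrow> nat \<Rightarrow> nat list \<Rightarrow> nat" where
  "plethysm_coeff \<nu> m lam = multiplicity_in (symgrp (m * sum_list \<nu>)) (specht lam) (foulkes \<nu> m)"

end

theory Submission
  imports Defs
begin

text \<open>
  Since Specht modules are absolutely simple, the multiplicity of the Specht module \<open>S\<close> of \<open>lam\<close> in the
  Foulkes module is, by Frobenius reciprocity, the dimension of the space of linear functionals on \<open>S\<close>
  invariant under the wreath product \<open>K\<close>. Let \<open>S'\<close> and \<open>K'\<close> be the analogous objects for
  \<open>lam' = a * m # lam\<close>, and let \<open>B\<close> be the union of the last \<open>a\<close> blocks. Taking the coefficients of the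
  tabloids with first row \<open>B\<close> maps \<open>S'\<close> to \<open>S\<close>; averaging over \<open>K'\<close>, applying this map and then an
  invariant functional \<open>\<theta>\<close> of \<open>S\<close> gives an invariant functional \<open>\<theta>'\<close> of \<open>S'\<close>. If \<open>t'\<close> is a tableau \<open>t\<close>
  with the first row \<open>B\<close> added on top, then \<open>\<theta>'\<close> takes on the polytabloid of \<open>t'\<close> a positive multiple of
  the value of \<open>\<theta>\<close> on the polytabloid of \<open>t\<close>: a term of the average can be nonzero only if it comes from
  a union of \<open>a\<close> blocks with one element in each column, by \<open>hd lam < 2 * m\<close> this is \<open>B\<close> up to the
  exchange of one block, and the exchange along the columns has sign \<open>(-1) ^ m = 1\<close>. Hence \<open>\<theta>\<close> is
  determined by \<open>\<theta>'\<close>.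
\<close>

section \<open>Hermitian forms and complete reducibility\<close>

text \<open>\<open>multiplicity_in\<close> is a definite description, so the number of summands must
  first be shown to be the same for all decompositions. The homomorphisms themselves are no vectors
  of the function spaces in use; they are replaced by their values at one fixed nonzero vector
  \<open>e\<close> of the simple module, which determine them. The set of these values mentions no
  decomposition, and its bases count the summands sought, provided that endomorphisms are scalar on
  \<open>e\<close>. James's argument with signed column sums gives the latter without eigenvalues.
  On the combinatorial side, taking the coefficients with first row B is compatible only with those
  elements of K' that preserve B; hence the average. An average may vanish by cancellation. None
  occurs here because every nonzero term takes the same value and the identity gives a nonzero term.
  Two blocks leaving the first row at once could be mixed by the columns, and an exchange of odd
  sign could cancel against the identity; the bound on the first part and the parity of m exclude
  just this.\<close>

lemma fscale_apply: "fscale c f x = c * f x"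
  by (simp add: fscale_def)

lemma sum_fun_apply: "(\<Sum>i\<in>I. f i) x = (\<Sum>i\<in>I. f i x)"
  for f :: "'i \<Rightarrow> 'a \<Rightarrow> 'b::comm_monoid_add"
  by (induction I rule: infinite_finite_induct) auto

text \<open>The function types may be infinite-dimensional; a finite support set supplies the bound
  on dimensions that the type does not.\<close>

definition supported :: "'a set \<Rightarrow> ('a \<Rightarrow> complex) set" where
  "supported X = {f. \<forall>x. x \<notin> X \<longrightarrow> f x = 0}"

definition herm :: "'a set \<Rightarrow> ('a \<Rightarrow> complex) \<Rightarrow> ('a \<Rightarrow> complex) \<Rightarrow> complex" where
  "herm X f g = (\<Sum>x\<in>X. f x * cnj (g x))"

lemma herm_add_left: "herm X (f + f') g = herm X f g + herm X f' g"
  by (simp add: herm_def algebra_simps sum.distrib)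

lemma herm_diff_left: "herm X (f - f') g = herm X f g - herm X f' g"
  by (simp add: herm_def algebra_simps sum_subtractf)

lemma herm_scale_left: "herm X (fscale c f) g = c * herm X f g"
  by (simp add: herm_def fscale_apply algebra_simps sum_distrib_left)

lemma herm_add_right: "herm X f (g + g') = herm X f g + herm X f g'"
  by (simp add: herm_def algebra_simps sum.distrib)

lemma herm_scale_right: "herm X f (fscale c g) = cnj c * herm X f g"
  by (simp add: herm_def fscale_apply algebra_simps sum_distrib_left)

lemma herm_zero [simp]: "herm X 0 g = 0" "herm X f 0 = 0"
  by (simp_all add: herm_def)

lemma herm_self_eq_0:
  assumes "finite X" "f \<in> supported X" "herm X f f = 0"
  shows "f = 0"
proof -
  have "complex_of_real (\<Sum>x\<in>X. (cmod (f x))\<^sup>2) = 0"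
    using assms(3) by (simp add: herm_def flip: complex_norm_square)
  then have "(\<Sum>x\<in>X. (cmod (f x))\<^sup>2) = 0"
    using of_real_eq_0_iff by blast
  then have "\<forall>x\<in>X. f x = 0"
    using assms(1) by (subst (asm) sum_nonneg_eq_0_iff) auto
  then show ?thesis using assms(2) by (auto simp: supported_def fun_eq_iff)
qed

lemma subspace_supported: "cfun.subspace (supported X)"
  by (auto simp: cfun.subspace_def supported_def fscale_apply)

lemma supported_subset_span:
  assumes "finite X"
  shows "supported X \<subseteq> cfun.span ((\<lambda>x y. if y = x then 1 else 0) ` X)"
proof
  fix f assume f: "f \<in> supported X"
  have "f = (\<Sum>x\<in>X. fscale (f x) (\<lambda>y. if y = x then 1 else 0))"
    using f assms by (auto simp: fun_eq_iff supported_def fscale_apply sum_fun_apply if_distrib cong: if_cong)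
  also have "\<dots> \<in> cfun.span ((\<lambda>x y. if y = x then 1 else 0) ` X)"
    by (intro cfun.span_sum cfun.span_scale cfun.span_base) auto
  finally show "f \<in> cfun.span ((\<lambda>x y. if y = x then 1 else 0) ` X)" .
qed

lemma independent_supported_bound:
  assumes "finite X" "cfun.independent B" "B \<subseteq> supported X"
  shows "finite B"
  using cfun.independent_span_bound[OF finite_imageI assms(2)] supported_subset_span[OF assms(1)]
    assms by (meson order_trans)

lemma dim_strict_mono_supported:
  assumes "finite X" "cfun.subspace U" "U \<subset> W" "W \<subseteq> supported X"
  shows "cfun.dim U < cfun.dim W"
proof -
  obtain B where B: "B \<subseteq> U" "cfun.independent B" "U \<subseteq> cfun.span B" "card B = cfun.dim U"
    using cfun.basis_exists[of U] by blast
  obtain B' where B': "B' \<subseteq> W" "cfun.independent B'" "W \<subseteq> cfun.span B'" "card B' = cfun.dim W"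
    using cfun.basis_exists[of W] by blast
  obtain v where v: "v \<in> W" "v \<notin> U" using assms(3) by blast
  have fin: "finite B" "finite B'"
    using B(1) B'(1) assms(3,4) by (auto intro!: independent_supported_bound[OF assms(1)] B(2) B'(2))
  have vB: "v \<notin> cfun.span B" using cfun.span_minimal[OF B(1) assms(2)] v by blast
  then have "cfun.independent (insert v B)" by (simp add: B(2) cfun.independent_insertI)
  moreover have "insert v B \<subseteq> cfun.span B'" using v B B' assms(3) by blast
  ultimately have "card (insert v B) \<le> card B'" using cfun.independent_span_bound fin by blast
  moreover have "v \<notin> B" using vB cfun.span_base by blast
  ultimately show ?thesis using B B' fin by simp
qed

text \<open>Gram-Schmidt: the new generator \<open>b\<close> is replaced by its part
  \<open>w\<close> orthogonal to the span of \<open>B\<close>, so the projection onto the larger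
  span only gains a multiple of \<open>w\<close>.\<close>

lemma orthogonal_projection_span:
  assumes "finite X" "finite B" "B \<subseteq> supported X"
  shows "\<exists>u\<in>cfun.span B. \<forall>u'\<in>cfun.span B. herm X (v - u) u' = 0"
  using assms(2,3)
proof (induction B arbitrary: v rule: finite_induct)
  case empty
  show ?case by (simp add: herm_def)
next
  case (insert b B)
  have B: "B \<subseteq> supported X" using insert.prems by simp
  obtain u where u: "u \<in> cfun.span B" "\<forall>u'\<in>cfun.span B. herm X (b - u) u' = 0"
    using insert.IH[OF B, of b] by (rule bexE)
  obtain p where p: "p \<in> cfun.span B" "\<forall>u'\<in>cfun.span B. herm X (v - p) u' = 0"
    using insert.IH[OF B, of v] by (rule bexE)
  define w where "w = b - u"
  have span_sub: "cfun.span B \<subseteq> cfun.span (insert b B)" by (intro cfun.span_mono) auto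
  have w_in: "w \<in> cfun.span (insert b B)"
    unfolding w_def using u(1) span_sub by (intro cfun.span_diff) (auto intro: cfun.span_base)
  have w_supp: "w \<in> supported X"
    using w_in cfun.span_minimal[OF insert.prems subspace_supported] by blast
  have dec: "\<exists>k s. u' = fscale k w + s \<and> s \<in> cfun.span B" if u': "u' \<in> cfun.span (insert b B)" for u'
  proof -
    obtain k where k: "u' - fscale k b \<in> cfun.span B"
      using u' unfolding cfun.span_breakdown_eq by (rule exE)
    have "u' = fscale k w + (u' - fscale k b + fscale k u)"
      by (simp add: w_def fun_eq_iff fscale_apply algebra_simps)
    then show ?thesis using k u(1) by (blast intro: cfun.span_add cfun.span_scale)
  qed
  \<comment> \<open>If \<open>w = 0\<close>, the quotient is 0 by convention, and
    \<open>c * herm X w w = herm X (v - p) w\<close> still holds because both sides vanish.\<close>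
  define c where "c = herm X (v - p) w / herm X w w"
  define q where "q = p + fscale c w"
  have "herm X (v - q) u' = 0" if u': "u' \<in> cfun.span (insert b B)" for u'
  proof -
    obtain k s where ks: "u' = fscale k w + s" "s \<in> cfun.span B" using dec[OF u'] by (elim exE conjE)
    have "herm X w w = 0 \<Longrightarrow> w = 0" using herm_self_eq_0[OF assms(1) w_supp] .
    then have c: "c * herm X w w = herm X (v - p) w" by (auto simp: c_def)
    have q: "v - q = (v - p) - fscale c w" by (simp add: q_def fun_eq_iff fscale_apply algebra_simps)
    have "herm X w s = 0" using bspec[OF u(2) ks(2)] by (simp add: w_def)
    then show ?thesis
      using bspec[OF p(2) ks(2)] c
      by (simp add: q ks(1) herm_diff_left herm_add_right herm_scale_left herm_scale_right)
  qed
  moreover have "q \<in> cfun.span (insert b B)"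
    unfolding q_def using p(1) span_sub w_in by (intro cfun.span_add cfun.span_scale) auto
  ultimately show ?case by blast
qed

lemma orthogonal_projection:
  assumes "finite X" "cfun.subspace U" "U \<subseteq> supported X"
  shows "\<exists>u\<in>U. \<forall>u'\<in>U. herm X (v - u) u' = 0"
proof -
  obtain B where B: "B \<subseteq> U" "cfun.independent B" "U \<subseteq> cfun.span B" "card B = cfun.dim U"
    using cfun.basis_exists[of U] by blast
  have span: "cfun.span B = U" using B(1,3) assms(2) by (rule cfun.span_subspace)
  have "B \<subseteq> supported X" using B(1) assms(3) by (rule order_trans)
  then show ?thesis
    using orthogonal_projection_span[OF assms(1), of B v]
      independent_supported_bound[OF assms(1) B(2)] unfolding span by blast
qed

text \<open>By \<open>adj\<close>, orthogonal complements of submodules are submodules. A nonzero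
  submodule of least dimension is simple; it is split off, and its complement in \<open>W\<close>
  has smaller dimension.\<close>

lemma simple_decomposition_exists:
  assumes X: "finite X" "vecs M \<subseteq> supported X"
    and adj: "\<And>g. g \<in> G \<Longrightarrow> \<exists>g'\<in>G. \<forall>u\<in>vecs M. \<forall>v\<in>vecs M. herm X (act M g u) v = herm X u (act M g' v)"
    and W: "submodule G M W"
  shows "\<exists>D. simple_decomposition G (M\<lparr>vecs := W\<rparr>) D"
  using W
proof (induction "cfun.dim W" arbitrary: W rule: less_induct)
  case less
  have Wsub: "cfun.subspace W" "W \<subseteq> vecs M" and Wact: "\<And>g u. g \<in> G \<Longrightarrow> u \<in> W \<Longrightarrow> act M g u \<in> W"
    using less.prems by (auto simp: submodule_def)
  show ?case
  proof (cases "W = {0}")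
    case True
    have "simple_decomposition G (M\<lparr>vecs := W\<rparr>) {}"
      by (auto simp: simple_decomposition_def True)
    then show ?thesis by blast
  next
    case False
    let ?P = "\<lambda>U. submodule G M U \<and> U \<subseteq> W \<and> U \<noteq> {0}"
    obtain U where U: "?P U" and Umin: "\<And>U'. ?P U' \<Longrightarrow> cfun.dim U \<le> cfun.dim U'"
      using ex_has_least_nat[of ?P W cfun.dim] less.prems False by blast
    have Usub: "cfun.subspace U" "U \<subseteq> vecs M" "U \<subseteq> supported X"
      and Uact: "\<And>g u. g \<in> G \<Longrightarrow> u \<in> U \<Longrightarrow> act M g u \<in> U"
      using U X by (auto simp: submodule_def)
    have Usimple: "simple_module G (M\<lparr>vecs := U\<rparr>)"
    proof -
      have "U' = U" if "submodule G (M\<lparr>vecs := U\<rparr>) U'" "U' \<noteq> {0}" for U'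
      proof (rule ccontr)
        assume "U' \<noteq> U"
        with that have "U' \<subset> U" "cfun.subspace U'" "?P U'"
          using U by (auto simp: submodule_def)
        then show False
          using dim_strict_mono_supported[OF X(1), of U' U] Umin[of U'] Usub by auto
      qed
      then show ?thesis using U by (auto simp: simple_module_def)
    qed
    define V where "V = {w \<in> W. \<forall>u\<in>U. herm X w u = 0}"
    have Vsub: "cfun.subspace V"
      using Wsub(1) by (auto simp: V_def cfun.subspace_def herm_add_left herm_scale_left)
    have UV: "u = 0" if "u \<in> U" "u \<in> V" for u
      using herm_self_eq_0[OF X(1), of u] that Usub by (auto simp: V_def)
    have "act M g w \<in> V" if "g \<in> G" "w \<in> V" for g w
    proof -
      obtain g' where "g' \<in> G" "\<forall>u\<in>vecs M. \<forall>v\<in>vecs M. herm X (act M g u) v = herm X u (act M g' v)"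
        using adj \<open>g \<in> G\<close> by blast
      moreover have "herm X w (act M g' u) = 0" if "u \<in> U" for u
        using \<open>w \<in> V\<close> Uact[OF \<open>g' \<in> G\<close> that] by (auto simp: V_def)
      moreover have "w \<in> W" using \<open>w \<in> V\<close> by (simp add: V_def)
      ultimately have "herm X (act M g w) u = 0" if "u \<in> U" for u
        using that Wsub(2) Usub(2) by (metis subsetD)
      then show ?thesis using Wact[OF \<open>g \<in> G\<close> \<open>w \<in> W\<close>] by (simp add: V_def)
    qed
    then have Vmod: "submodule G M V"
      using Vsub Wsub by (auto simp: submodule_def V_def)
    obtain u0 where "u0 \<in> U" "u0 \<noteq> 0" using U Usub(1) cfun.subspace_0 by blast
    then have "V \<subset> W" using U UV by (auto simp: V_def)
    then have "cfun.dim V < cfun.dim W"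
      using dim_strict_mono_supported[OF X(1) Vsub] Wsub X(2) by blast
    then obtain D where D: "simple_decomposition G (M\<lparr>vecs := V\<rparr>) D"
      using less.hyps Vmod by blast
    have D': "finite D" "\<And>U. U \<in> D \<Longrightarrow> submodule G (M\<lparr>vecs := V\<rparr>) U \<and> simple_module G (M\<lparr>vecs := U\<rparr>)"
      "\<And>v. v \<in> V \<Longrightarrow> \<exists>!x. x \<in> (\<Pi>\<^sub>E U\<in>D. U) \<and> v = (\<Sum>U\<in>D. x U)"
      using D unfolding simple_decomposition_def by simp_all
    have DV: "U' \<subseteq> V" if "U' \<in> D" for U'
      using D'(2)[OF that] by (simp add: submodule_def)
    \<comment> \<open>The summands serve as their own indices, so \<open>U\<close> must be new for
      its component to be independent of those in \<open>D\<close>.\<close>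
    have UD: "U \<notin> D"
      using DV[of U] UV[OF \<open>u0 \<in> U\<close>] \<open>u0 \<in> U\<close> \<open>u0 \<noteq> 0\<close> by blast
    have sumV: "(\<Sum>U\<in>D. x U) \<in> V" if "\<And>U. U \<in> D \<Longrightarrow> x U \<in> U" for x
      using that DV by (blast intro: cfun.subspace_sum[OF Vsub])
    have "\<exists>!x. x \<in> (\<Pi>\<^sub>E U\<in>insert U D. U) \<and> v = (\<Sum>U\<in>insert U D. x U)" if v: "v \<in> W" for v
    proof -
      obtain u where u: "u \<in> U" "\<forall>u'\<in>U. herm X (v - u) u' = 0"
        using orthogonal_projection[OF X(1) Usub(1) Usub(3)] by blast
      have "v - u \<in> W" using u(1) v U by (intro cfun.subspace_diff[OF Wsub(1)]) auto
      then have "v - u \<in> V" using u(2) by (simp add: V_def)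
      then obtain x where x: "x \<in> (\<Pi>\<^sub>E U\<in>D. U)" "v - u = (\<Sum>U\<in>D. x U)"
        using D'(3) by blast
      show ?thesis
      proof (rule ex1I[of _ "x(U := u)"])
        have "v = u + (\<Sum>U\<in>D. x U)" using x(2) by (simp add: algebra_simps)
        moreover have "(\<Sum>U'\<in>D. (x(U := u)) U') = (\<Sum>U\<in>D. x U)"
          using UD by (intro sum.cong) auto
        ultimately have "v = (\<Sum>U'\<in>insert U D. (x(U := u)) U')"
          using UD D'(1) by simp
        moreover have "x(U := u) \<in> (\<Pi>\<^sub>E U\<in>insert U D. U)"
          using x(1) u(1) by (intro PiE_I) (auto simp: PiE_iff extensional_def)
        ultimately show "x(U := u) \<in> (\<Pi>\<^sub>E U\<in>insert U D. U) \<and> v = (\<Sum>U'\<in>insert U D. (x(U := u)) U')"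
          by blast
      next
        fix y assume y: "y \<in> (\<Pi>\<^sub>E U\<in>insert U D. U) \<and> v = (\<Sum>U\<in>insert U D. y U)"
        have yD: "y U' \<in> U'" if "U' \<in> insert U D" for U' using y that by (auto simp: PiE_iff)
        then have yU: "y U \<in> U" by simp
        have vy: "v = y U + (\<Sum>U\<in>D. y U)" using conjunct2[OF y] UD D'(1) by simp
        have yV: "(\<Sum>U\<in>D. y U) \<in> V" using yD by (intro sumV) simp
        have "u - y U = (\<Sum>U\<in>D. y U) - (v - u)" using vy by (simp add: algebra_simps)
        moreover have "u - y U \<in> U" using yU u(1) Usub(1) cfun.subspace_diff by blast
        moreover have "(\<Sum>U\<in>D. y U) - (v - u) \<in> V"
          using yV \<open>v - u \<in> V\<close> Vsub cfun.subspace_diff by blast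
        ultimately have "u - y U = 0" using UV by metis
        then have yu: "y U = u" by simp
        then have "v - u = (\<Sum>U\<in>D. y U)" using vy by (simp add: algebra_simps)
        then have "v - u = (\<Sum>U\<in>D. restrict y D U)" by simp
        moreover have "restrict y D \<in> (\<Pi>\<^sub>E U\<in>D. U)" using yD by (simp add: PiE_iff)
        ultimately have "restrict y D = x" using D'(3)[OF \<open>v - u \<in> V\<close>] x by blast
        moreover have "y = (restrict y D)(U := y U)"
          using conjunct1[OF y] by (auto simp: fun_eq_iff PiE_iff extensional_def)
        ultimately show "y = x(U := u)" using yu by simp
      qed
    qed
    moreover have "submodule G (M\<lparr>vecs := W\<rparr>) U'" if "U' \<in> insert U D" for U'
      using that U D'(2)[of U'] \<open>V \<subset> W\<close> unfolding submodule_def by auto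
    ultimately have "simple_decomposition G (M\<lparr>vecs := W\<rparr>) (insert U D)"
      unfolding simple_decomposition_def using D'(1,2) Usimple by simp
    then show ?thesis by blast
  qed
qed

section \<open>Multiplicities as numbers of homomorphisms\<close>

text \<open>A \<open>cmod\<close> record carries no axioms and \<open>submodule\<close> only asks
  for closure; linearity of the action has to be added.\<close>

definition is_module :: "'g set \<Rightarrow> ('g, 'a) cmod \<Rightarrow> bool" where
  "is_module G M \<longleftrightarrow> submodule G M (vecs M) \<and>
     (\<forall>g\<in>G. \<forall>u\<in>vecs M. \<forall>v\<in>vecs M. act M g (u + v) = act M g u + act M g v) \<and>
     (\<forall>g\<in>G. \<forall>c. \<forall>v\<in>vecs M. act M g (fscale c v) = fscale c (act M g v))"

definition ghom :: "'g set \<Rightarrow> ('g, 'a) cmod \<Rightarrow> ('g, 'b) cmod \<Rightarrow>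
    (('a \<Rightarrow> complex) \<Rightarrow> 'b \<Rightarrow> complex) \<Rightarrow> bool" where
  "ghom G M N \<phi> \<longleftrightarrow> (\<forall>v\<in>vecs M. \<phi> v \<in> vecs N) \<and>
     (\<forall>u\<in>vecs M. \<forall>v\<in>vecs M. \<phi> (u + v) = \<phi> u + \<phi> v) \<and>
     (\<forall>c. \<forall>v\<in>vecs M. \<phi> (fscale c v) = fscale c (\<phi> v)) \<and>
     (\<forall>g\<in>G. \<forall>v\<in>vecs M. \<phi> (act M g v) = act N g (\<phi> v))"

lemma is_moduleD:
  assumes "is_module G M"
  shows "cfun.subspace (vecs M)" "0 \<in> vecs M"
    and "u \<in> vecs M \<Longrightarrow> v \<in> vecs M \<Longrightarrow> u + v \<in> vecs M"
    and "v \<in> vecs M \<Longrightarrow> fscale c v \<in> vecs M"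
    and "g \<in> G \<Longrightarrow> v \<in> vecs M \<Longrightarrow> act M g v \<in> vecs M"
    and "g \<in> G \<Longrightarrow> u \<in> vecs M \<Longrightarrow> v \<in> vecs M \<Longrightarrow> act M g (u + v) = act M g u + act M g v"
    and "g \<in> G \<Longrightarrow> v \<in> vecs M \<Longrightarrow> act M g (fscale c v) = fscale c (act M g v)"
  using assms by (auto simp: is_module_def submodule_def cfun.subspace_def)

lemma is_module_submodule:
  assumes "is_module G M" "submodule G M U"
  shows "is_module G (M\<lparr>vecs := U\<rparr>)"
  using assms by (auto simp: is_module_def submodule_def subset_iff)

lemma act_sum:
  assumes M: "is_module G M" and g: "g \<in> G" and x: "\<And>i. i \<in> I \<Longrightarrow> x i \<in> vecs M" and "finite I"
  shows "act M g (\<Sum>i\<in>I. x i) = (\<Sum>i\<in>I. act M g (x i))"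
  using \<open>finite I\<close> x
proof (induction I rule: finite_induct)
  case empty
  have "act M g (fscale 0 0) = fscale 0 (act M g 0)" by (rule is_moduleD(7)[OF M g is_moduleD(2)[OF M]])
  then show ?case by (simp only: cfun.scale_zero_left sum.empty)
next
  case (insert i I)
  have "(\<Sum>i\<in>I. x i) \<in> vecs M"
    using insert.prems by (intro cfun.subspace_sum[OF is_moduleD(1)[OF M]]) simp
  then have "act M g (x i + (\<Sum>i\<in>I. x i)) = act M g (x i) + act M g (\<Sum>i\<in>I. x i)"
    using insert.prems by (intro is_moduleD(6)[OF M g]) auto
  then show ?case
    using insert.IH insert.prems by (simp only: sum.insert[OF insert.hyps] insert_iff simp_thms)
qed

lemma ghomD:
  assumes "ghom G M N \<phi>"
  shows "v \<in> vecs M \<Longrightarrow> \<phi> v \<in> vecs N"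
    and "u \<in> vecs M \<Longrightarrow> v \<in> vecs M \<Longrightarrow> \<phi> (u + v) = \<phi> u + \<phi> v"
    and "v \<in> vecs M \<Longrightarrow> \<phi> (fscale c v) = fscale c (\<phi> v)"
    and "g \<in> G \<Longrightarrow> v \<in> vecs M \<Longrightarrow> \<phi> (act M g v) = act N g (\<phi> v)"
  using assms by (auto simp: ghom_def)

lemma ghom_zero:
  assumes "is_module G M" "ghom G M N \<phi>"
  shows "\<phi> 0 = 0"
  using ghomD(3)[OF assms(2) is_moduleD(2)[OF assms(1)], of 0] by simp

lemma ghom_compose:
  assumes "ghom G L M \<phi>" "ghom G M N \<psi>"
  shows "ghom G L N (\<psi> \<circ> \<phi>)"
  using assms by (auto simp: ghom_def)

lemma ghom_diff:
  assumes "is_module G M" "ghom G M N \<phi>" "u \<in> vecs M" "v \<in> vecs M"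
  shows "\<phi> (u - v) = \<phi> u - \<phi> v"
proof -
  have "u - v = u + fscale (-1) v" by (simp add: fun_eq_iff fscale_apply)
  then have "\<phi> (u - v) = \<phi> u + fscale (-1) (\<phi> v)"
    using assms(3,4) by (simp only: ghomD(2,3)[OF assms(2)] is_moduleD(4)[OF assms(1)])
  then show ?thesis by (simp add: fun_eq_iff fscale_apply)
qed

lemma ghom_inv_into:
  assumes M: "is_module G M" and h: "ghom G M N \<phi>" and bij: "bij_betw \<phi> (vecs M) (vecs N)"
  shows "ghom G N M (inv_into (vecs M) \<phi>)"
proof -
  let ?\<psi> = "inv_into (vecs M) \<phi>"
  have \<psi>: "?\<psi> w \<in> vecs M" "\<phi> (?\<psi> w) = w" if "w \<in> vecs N" for w
    using that bij by (auto simp: bij_betw_def inv_into_into f_inv_into_f)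
  have eq: "?\<psi> w = v" if "v \<in> vecs M" "\<phi> v = w" for v w
    using that bij by (auto simp: bij_betw_def inv_into_f_f)
  show ?thesis
    unfolding ghom_def
    by (intro conjI ballI allI eq \<psi>(1)) (simp_all add: \<psi> is_moduleD[OF M] ghomD[OF h])
qed

lemma iso_modules_iff_ghom:
  assumes "is_module G M"
  shows "iso_modules G M N \<longleftrightarrow> (\<exists>\<phi>. bij_betw \<phi> (vecs M) (vecs N) \<and> ghom G M N \<phi>)"
  unfolding iso_modules_def ghom_def by (auto simp: bij_betw_def)

text \<open>Schur's lemma: kernel and image are submodules, and \<open>v\<close> prevents the kernel
  from being everything and the image from being zero.\<close>

lemma schur_bij:
  assumes M: "is_module G M" "simple_module G M" and N: "is_module G N" "simple_module G N"
    and h: "ghom G M N \<phi>" and v: "v \<in> vecs M" "\<phi> v \<noteq> 0"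
  shows "bij_betw \<phi> (vecs M) (vecs N)"
proof -
  let ?K = "{u \<in> vecs M. \<phi> u = 0}"
  have act0: "act N g 0 = 0" if "g \<in> G" for g
    using is_moduleD(7)[OF N(1) that is_moduleD(2)[OF N(1)], of 0] by simp
  have "submodule G M ?K"
    using is_moduleD[OF M(1)] ghomD[OF h] ghom_zero[OF M(1) h] act0
    by (auto simp: submodule_def cfun.subspace_def)
  then have K: "?K = {0}" using M(2) v by (auto simp: simple_module_def)
  have inj: "inj_on \<phi> (vecs M)"
  proof (rule inj_onI)
    fix x y assume xy: "x \<in> vecs M" "y \<in> vecs M" "\<phi> x = \<phi> y"
    have "x - y \<in> ?K"
      using xy ghom_diff[OF M(1) h] cfun.subspace_diff[OF is_moduleD(1)[OF M(1)]] by simp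
    then show "x = y" using K by simp
  qed
  have "cfun.subspace (\<phi> ` vecs M)"
  proof (rule cfun.subspaceI)
    show "0 \<in> \<phi> ` vecs M"
      using ghom_zero[OF M(1) h] is_moduleD(2)[OF M(1)] by (metis imageI)
  next
    fix x y assume "x \<in> \<phi> ` vecs M" "y \<in> \<phi> ` vecs M"
    then show "x + y \<in> \<phi> ` vecs M"
      using is_moduleD(3)[OF M(1)] ghomD(2)[OF h] by (auto simp flip: ghomD(2)[OF h])
  next
    fix c x assume "x \<in> \<phi> ` vecs M"
    then show "fscale c x \<in> \<phi> ` vecs M"
      using is_moduleD(4)[OF M(1)] by (auto simp flip: ghomD(3)[OF h])
  qed
  moreover have "act N g u \<in> \<phi> ` vecs M" if "g \<in> G" "u \<in> \<phi> ` vecs M" for g u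
    using that is_moduleD(5)[OF M(1)] by (auto simp flip: ghomD(4)[OF h])
  moreover have "\<phi> ` vecs M \<subseteq> vecs N" using ghomD(1)[OF h] by auto
  ultimately have "submodule G N (\<phi> ` vecs M)" by (simp add: submodule_def)
  moreover have "\<phi> ` vecs M \<noteq> {0}" using v by auto
  ultimately have "\<phi> ` vecs M = vecs N" using N(2) by (auto simp: simple_module_def)
  with inj show ?thesis by (simp add: bij_betw_def)
qed

section \<open>Homomorphism spaces and decompositions into simple modules\<close>

lemma independent_family:
  assumes "finite I"
    and c0: "\<And>c i. (\<Sum>i\<in>I. fscale (c i) (b i)) = 0 \<Longrightarrow> i \<in> I \<Longrightarrow> c i = 0"
  shows "inj_on b I" "cfun.independent (b ` I)"
proof -
  show inj: "inj_on b I"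
  proof (rule inj_onI, rule ccontr)
    fix i j assume ij: "i \<in> I" "j \<in> I" "b i = b j" "i \<noteq> j"
    \<comment> \<open>A repeated vector gives the nontrivial relation
      \<open>b i - b j = 0\<close>.\<close>
    let ?c = "\<lambda>k. (if k = i then 1 else 0) - (if k = j then 1 else 0) :: complex"
    have "(\<Sum>k\<in>I. fscale (?c k) (b k)) = b i - b j"
      using ij(1,2) \<open>finite I\<close>
      by (simp add: fun_eq_iff fscale_apply sum_fun_apply left_diff_distrib sum_subtractf if_distrib[of "\<lambda>x. x * _"] cong: if_cong)
    then have "(\<Sum>k\<in>I. fscale (?c k) (b k)) = 0" using ij(3) by simp
    from c0[OF this ij(1)] show False using ij(4) by simp
  qed
  show "cfun.independent (b ` I)"
  proof
    assume "cfun.dependent (b ` I)"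
    then obtain u v where uv: "v \<in> b ` I" "u v \<noteq> 0" "(\<Sum>v\<in>b ` I. fscale (u v) v) = 0"
      using cfun.dependent_finite[of "b ` I"] \<open>finite I\<close> by auto
    have "(\<Sum>i\<in>I. fscale (u (b i)) (b i)) = 0"
      using uv(3) by (simp only: sum.reindex[OF inj] o_def)
    then show False using c0[of "\<lambda>i. u (b i)"] uv(1,2) by auto
  qed
qed

lemma simple_decomposition_uniqueD:
  assumes "simple_decomposition G M D" "v \<in> vecs M"
    and "\<And>U. U \<in> D \<Longrightarrow> x U \<in> U" "\<And>U. U \<in> D \<Longrightarrow> y U \<in> U"
    and "v = (\<Sum>U\<in>D. x U)" "v = (\<Sum>U\<in>D. y U)" "U \<in> D"
  shows "x U = y U"
proof -
  have ex1: "\<exists>!x. x \<in> (\<Pi>\<^sub>E U\<in>D. U) \<and> v = (\<Sum>U\<in>D. x U)"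
    using assms(1,2) by (simp add: simple_decomposition_def)
  have 1: "restrict x D \<in> (\<Pi>\<^sub>E U\<in>D. U) \<and> v = (\<Sum>U\<in>D. restrict x D U)"
    using assms(3,5) by (auto simp: PiE_iff)
  have 2: "restrict y D \<in> (\<Pi>\<^sub>E U\<in>D. U) \<and> v = (\<Sum>U\<in>D. restrict y D U)"
    using assms(4,6) by (auto simp: PiE_iff)
  have "restrict x D = restrict y D" using ex1 1 2 by blast
  then show ?thesis using \<open>U \<in> D\<close> by (metis restrict_apply')
qed

text \<open>The components are linear and equivariant because sums, multiples and translates of
  component families are again component families, and these are unique.\<close>

lemma simple_decomposition_projections:
  assumes M: "is_module G M" and D: "simple_decomposition G M D"
  obtains p where "\<And>U. U \<in> D \<Longrightarrow> ghom G M (M\<lparr>vecs := U\<rparr>) (p U)"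
    and "\<And>v. v \<in> vecs M \<Longrightarrow> v = (\<Sum>U\<in>D. p U v)"
proof -
  have fin: "finite D" and sub: "\<And>U. U \<in> D \<Longrightarrow> submodule G M U"
    using D by (auto simp: simple_decomposition_def)
  have ex: "\<exists>x. x \<in> (\<Pi>\<^sub>E U\<in>D. U) \<and> v = (\<Sum>U\<in>D. x U)" if "v \<in> vecs M" for v
    using D that unfolding simple_decomposition_def by (meson ex1_implies_ex)
  have modU: "is_module G (M\<lparr>vecs := U\<rparr>)" if "U \<in> D" for U
    using is_module_submodule[OF M sub[OF that]] .
  have "\<forall>v. \<exists>x. v \<in> vecs M \<longrightarrow> x \<in> (\<Pi>\<^sub>E U\<in>D. U) \<and> v = (\<Sum>U\<in>D. x U)"
    using ex by blast
  then obtain q where q: "\<And>v. v \<in> vecs M \<Longrightarrow> q v \<in> (\<Pi>\<^sub>E U\<in>D. U) \<and> v = (\<Sum>U\<in>D. q v U)"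
    by metis
  have qU: "q v U \<in> U" if "v \<in> vecs M" "U \<in> D" for v U using q[OF that(1)] that(2) by (auto simp: PiE_iff)
  have qM: "q v U \<in> vecs M" if "v \<in> vecs M" "U \<in> D" for v U
    using qU[OF that] sub[OF that(2)] by (auto simp: submodule_def)
  have sum: "v = (\<Sum>U\<in>D. q v U)" if "v \<in> vecs M" for v using q[OF that] by simp
  have eq: "q v U = y U"
    if "v \<in> vecs M" "\<And>U. U \<in> D \<Longrightarrow> y U \<in> U" "v = (\<Sum>U\<in>D. y U)" "U \<in> D" for v y U
    using simple_decomposition_uniqueD[OF D that(1) _ that(2) sum[OF that(1)] that(3,4)] qU[OF that(1)] .
  have "ghom G M (M\<lparr>vecs := U\<rparr>) (\<lambda>v. q v U)" if U: "U \<in> D" for U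
    unfolding ghom_def
  proof (intro conjI ballI allI)
    fix v assume v: "v \<in> vecs M"
    show "q v U \<in> vecs (M\<lparr>vecs := U\<rparr>)" using qU[OF v U] by simp
    show "q (fscale c v) U = fscale c (q v U)" for c
    proof (rule eq[OF is_moduleD(4)[OF M v] _ _ U])
      show "fscale c (q v U) \<in> U" if "U \<in> D" for U
        using is_moduleD(4)[OF modU[OF that]] qU[OF v that] by simp
      show "fscale c v = (\<Sum>U\<in>D. fscale c (q v U))"
        by (subst sum[OF v]) (simp add: cfun.scale_sum_right)
    qed
    show "q (act M g v) U = act (M\<lparr>vecs := U\<rparr>) g (q v U)" if g: "g \<in> G" for g
    proof -
      have "q (act M g v) U = act M g (q v U)"
      proof (rule eq[OF is_moduleD(5)[OF M g v] _ _ U])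
        show "act M g (q v U) \<in> U" if "U \<in> D" for U
          using is_moduleD(5)[OF modU[OF that] g] qU[OF v that] by simp
        show "act M g v = (\<Sum>U\<in>D. act M g (q v U))"
          by (subst sum[OF v]) (simp add: act_sum[OF M g qM[OF v] fin])
      qed
      then show ?thesis by simp
    qed
    fix u assume u: "u \<in> vecs M"
    show "q (v + u) U = q v U + q u U"
    proof (rule eq[OF is_moduleD(3)[OF M v u] _ _ U])
      show "q v U + q u U \<in> U" if "U \<in> D" for U
        using is_moduleD(3)[OF modU[OF that]] qU[OF v that] qU[OF u that] by simp
      show "v + u = (\<Sum>U\<in>D. q v U + q u U)"
        using sum[OF v] sum[OF u] by (simp only: sum.distrib)
    qed
  qed
  then show ?thesis using that[of "\<lambda>U v. q v U"] sum by blast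
qed

text \<open>The values at \<open>e\<close> stand for the homomorphisms. Each summand isomorphic to
  \<open>S\<close> contributes the image of \<open>e\<close> under one isomorphism onto it. By
  Schur's lemma the other summands contribute nothing, and by \<open>End\<close> an isomorphic one
  contributes only multiples of that image.\<close>

lemma simple_decomposition_basis:
  assumes S: "is_module G S" "simple_module G S" and M: "is_module G M"
    and D: "simple_decomposition G M D"
    and e: "e \<in> vecs S" "e \<noteq> 0"
    and End: "\<And>\<phi>. ghom G S S \<phi> \<Longrightarrow> \<exists>c. \<phi> e = fscale c e"
  shows "\<exists>B. finite B \<and> cfun.independent B \<and> B \<subseteq> {\<phi> e |\<phi>. ghom G S M \<phi>} \<and>
      {\<phi> e |\<phi>. ghom G S M \<phi>} \<subseteq> cfun.span B \<and>
      card B = card {U \<in> D. iso_modules G (M\<lparr>vecs := U\<rparr>) S}"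
proof -
  have fin: "finite D" and sub: "\<And>U. U \<in> D \<Longrightarrow> submodule G M U"
    and sim: "\<And>U. U \<in> D \<Longrightarrow> simple_module G (M\<lparr>vecs := U\<rparr>)"
    using D by (auto simp: simple_decomposition_def)
  have modU: "is_module G (M\<lparr>vecs := U\<rparr>)" if "U \<in> D" for U
    using is_module_submodule[OF M sub[OF that]] .
  define I where "I = {U \<in> D. iso_modules G (M\<lparr>vecs := U\<rparr>) S}"
  have "finite I" "I \<subseteq> D" using fin by (auto simp: I_def)
  have "\<exists>\<phi>. bij_betw \<phi> U (vecs S) \<and> ghom G (M\<lparr>vecs := U\<rparr>) S \<phi>" if "U \<in> I" for U
    using that iso_modules_iff_ghom[OF modU, of U S] by (auto simp: I_def)
  then obtain f where f: "\<And>U. U \<in> I \<Longrightarrow> bij_betw (f U) U (vecs S)"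
    "\<And>U. U \<in> I \<Longrightarrow> ghom G (M\<lparr>vecs := U\<rparr>) S (f U)"
    by metis
  have h: "ghom G S (M\<lparr>vecs := U\<rparr>) (inv_into U (f U))" if "U \<in> I" for U
    using ghom_inv_into[OF modU f(2)[OF that]] f(1)[OF that] that \<open>I \<subseteq> D\<close> by auto
  have hM: "ghom G S M (inv_into U (f U))" if "U \<in> I" for U
  proof -
    have "U \<subseteq> vecs M" using sub[of U] that \<open>I \<subseteq> D\<close> by (auto simp: submodule_def)
    then show ?thesis using h[OF that] by (auto simp: ghom_def)
  qed
  define b where "b U = inv_into U (f U) e" for U
  have bU: "b U \<in> U" "f U (b U) = e" if "U \<in> I" for U
    using f(1)[OF that] e(1) by (auto simp: b_def bij_betw_def inv_into_into f_inv_into_f)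
  have b0: "b U \<noteq> 0" if "U \<in> I" for U
    using bU[OF that] ghom_zero[OF modU f(2)[OF that]] that \<open>I \<subseteq> D\<close> e(2) by auto
  have c0: "c U = 0" if c: "(\<Sum>U\<in>I. fscale (c U) (b U)) = 0" and U: "U \<in> I" for c U
  proof -
    \<comment> \<open>Two component families of the zero vector are compared: the given relation,
      extended by zero to all of \<open>D\<close>, and the zero family.\<close>
    let ?x = "\<lambda>U. if U \<in> I then fscale (c U) (b U) else 0"
    have U0: "0 \<in> U" if "U \<in> D" for U using is_moduleD(2)[OF modU[OF that]] by simp
    have "?x U = (\<lambda>U. 0) U"
    proof (rule simple_decomposition_uniqueD[OF D is_moduleD(2)[OF M]])
      show "?x U \<in> U" if "U \<in> D" for U
        using is_moduleD(4)[OF modU[OF that]] bU U0[OF that] by simp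
      show "0 = (\<Sum>U\<in>D. ?x U)"
        using c \<open>I \<subseteq> D\<close> fin by (simp add: sum.inter_restrict[symmetric] Int_absorb1)
      show "U \<in> D" using U \<open>I \<subseteq> D\<close> by blast
    qed (assumption | rule U0 sum.neutral_const[symmetric])+
    then show ?thesis using U b0[OF U] by simp
  qed
  have ind1: "inj_on b I" by (rule independent_family(1)[OF \<open>finite I\<close>]) (rule c0)
  have ind2: "cfun.independent (b ` I)" by (rule independent_family(2)[OF \<open>finite I\<close>]) (rule c0)
  obtain p where p: "\<And>U. U \<in> D \<Longrightarrow> ghom G M (M\<lparr>vecs := U\<rparr>) (p U)"
    and psum: "\<And>v. v \<in> vecs M \<Longrightarrow> v = (\<Sum>U\<in>D. p U v)"
    using simple_decomposition_projections[OF M D] by blast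
  have "\<phi> e \<in> cfun.span (b ` I)" if \<phi>: "ghom G S M \<phi>" for \<phi>
  proof -
    have "p U (\<phi> e) \<in> cfun.span (b ` I)" if U: "U \<in> D" for U
    proof (cases "p U (\<phi> e) = 0")
      case True
      then show ?thesis by (simp only: cfun.span_zero)
    next
      case False
      have hp: "ghom G S (M\<lparr>vecs := U\<rparr>) (p U \<circ> \<phi>)" using ghom_compose[OF \<phi> p[OF U]] .
      have bij: "bij_betw (p U \<circ> \<phi>) (vecs S) (vecs (M\<lparr>vecs := U\<rparr>))"
        using schur_bij[OF S modU[OF U] sim[OF U] hp e(1)] False by simp
      have "iso_modules G (M\<lparr>vecs := U\<rparr>) S"
        using iso_modules_iff_ghom[OF modU[OF U]] ghom_inv_into[OF S(1) hp bij]
          bij_betw_inv_into[OF bij] by blast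
      then have UI: "U \<in> I" using U by (simp add: I_def)
      \<comment> \<open>Passing to the summand by \<open>p U \<circ> \<phi>\<close> and back by
        \<open>f U\<close> is an endomorphism of \<open>S\<close>, so \<open>End\<close>
        applies.\<close>
      obtain c where c: "(f U \<circ> (p U \<circ> \<phi>)) e = fscale c e"
        using End[OF ghom_compose[OF hp f(2)[OF UI]]] by blast
      have pU: "p U (\<phi> e) \<in> U" using ghomD(1)[OF hp e(1)] by simp
      have bc: "fscale c (b U) \<in> U" using is_moduleD(4)[OF modU[OF U], of "b U"] bU[OF UI] by simp
      have "f U (p U (\<phi> e)) = f U (fscale c (b U))"
        using c bU[OF UI] ghomD(3)[OF f(2)[OF UI]] by simp
      then have "p U (\<phi> e) = fscale c (b U)"
        using f(1)[OF UI] pU bc by (auto simp: bij_betw_def inj_on_def)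
      moreover have "fscale c (b U) \<in> cfun.span (b ` I)"
        using UI by (intro cfun.span_scale cfun.span_base) simp
      ultimately show ?thesis by simp
    qed
    then have "(\<Sum>U\<in>D. p U (\<phi> e)) \<in> cfun.span (b ` I)" by (rule cfun.span_sum)
    then show ?thesis using psum[OF ghomD(1)[OF \<phi> e(1)]] by simp
  qed
  moreover have "b ` I \<subseteq> {\<phi> e |\<phi>. ghom G S M \<phi>}" using hM by (auto simp: b_def)
  moreover have "card (b ` I) = card I" using ind1 by (rule card_image)
  ultimately show ?thesis using ind2 \<open>finite I\<close> unfolding I_def[symmetric]
    by (intro exI[of _ "b ` I"]) blast
qed

text \<open>The set of values at \<open>e\<close> does not depend on a decomposition and its bases
  all have one size; so the count in \<open>multiplicity_in\<close> is well defined.\<close>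

lemma multiplicity_in_basis:
  assumes S: "is_module G S" "simple_module G S" and M: "is_module G M"
    and D: "\<exists>D. simple_decomposition G M D"
    and e: "e \<in> vecs S" "e \<noteq> 0"
    and End: "\<And>\<phi>. ghom G S S \<phi> \<Longrightarrow> \<exists>c. \<phi> e = fscale c e"
  obtains B where "finite B" "cfun.independent B" "B \<subseteq> {\<phi> e |\<phi>. ghom G S M \<phi>}"
    "{\<phi> e |\<phi>. ghom G S M \<phi>} \<subseteq> cfun.span B" "card B = multiplicity_in G S M"
proof -
  have basis: "\<exists>B. finite B \<and> cfun.independent B \<and> B \<subseteq> {\<phi> e |\<phi>. ghom G S M \<phi>} \<and>
      {\<phi> e |\<phi>. ghom G S M \<phi>} \<subseteq> cfun.span B \<and>
      card B = card {U \<in> D'. iso_modules G (M\<lparr>vecs := U\<rparr>) S}"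
    if "simple_decomposition G M D'" for D'
    by (rule simple_decomposition_basis[OF S M that e]) (rule End)
  obtain D0 where D0: "simple_decomposition G M D0" using D by blast
  obtain B where B: "finite B" "cfun.independent B" "B \<subseteq> {\<phi> e |\<phi>. ghom G S M \<phi>}"
    "{\<phi> e |\<phi>. ghom G S M \<phi>} \<subseteq> cfun.span B"
    "card B = card {U \<in> D0. iso_modules G (M\<lparr>vecs := U\<rparr>) S}"
    using basis[OF D0] by blast
  have uniq: "card {U \<in> D'. iso_modules G (M\<lparr>vecs := U\<rparr>) S} = card B" if D': "simple_decomposition G M D'" for D'
  proof -
    obtain B' where B': "finite B'" "cfun.independent B'" "B' \<subseteq> {\<phi> e |\<phi>. ghom G S M \<phi>}"
      "{\<phi> e |\<phi>. ghom G S M \<phi>} \<subseteq> cfun.span B'"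
      "card B' = card {U \<in> D'. iso_modules G (M\<lparr>vecs := U\<rparr>) S}"
      using basis[OF D'] by blast
    have "card B \<le> card B'" "card B' \<le> card B"
      using cfun.independent_span_bound[OF B'(1) B(2) order_trans[OF B(3) B'(4)]]
        cfun.independent_span_bound[OF B(1) B'(2) order_trans[OF B'(3) B(4)]] by auto
    then show ?thesis using B'(5) by simp
  qed
  have "multiplicity_in G S M = card B"
    unfolding multiplicity_in_def
  proof (rule the_equality)
    show "\<exists>D. simple_decomposition G M D \<and> card B = card {U \<in> D. iso_modules G (M\<lparr>vecs := U\<rparr>) S}"
      using D0 B(5) by blast
  next
    fix k
    assume "\<exists>D. simple_decomposition G M D \<and> k = card {U \<in> D. iso_modules G (M\<lparr>vecs := U\<rparr>) S}"
    then show "k = card B" by (elim exE conjE) (simp only: uniq)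
  qed
  from that[OF B(1-4) this[symmetric]] show ?thesis .
qed

section \<open>Tableaux and polytabloids\<close>

lemma finite_young [simp]: "finite (young lam)"
proof -
  have "young lam = (SIGMA i:{..<length lam}. {..<lam ! i})" by (auto simp: young_def)
  then show ?thesis by simp
qed

lemma card_young: "card (young lam) = sum_list lam"
proof -
  have "young lam = (SIGMA i:{..<length lam}. {..<lam ! i})" by (auto simp: young_def)
  then show ?thesis by (simp add: sum_list_sum_nth atLeast0LessThan)
qed

lemma tableau_exists: "\<exists>t. tableau lam t"
  unfolding tableau_def by (rule finite_same_card_bij) (simp_all add: card_young)

lemma tableau_apply_less: "tableau lam t \<Longrightarrow> c \<in> young lam \<Longrightarrow> t c < sum_list lam"
  by (auto simp: tableau_def bij_betw_def)

text \<open>The cell of an entry: conditions on rows and columns become equations between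
  coordinates of cells.\<close>

definition tpos :: "nat list \<Rightarrow> (nat \<times> nat \<Rightarrow> nat) \<Rightarrow> nat \<Rightarrow> nat \<times> nat" where
  "tpos lam t = inv_into (young lam) t"

lemma tpos_apply: "tableau lam t \<Longrightarrow> c \<in> young lam \<Longrightarrow> tpos lam t (t c) = c"
  by (simp add: tableau_def tpos_def bij_betw_def)

lemma tpos_in_young: "tableau lam t \<Longrightarrow> x < sum_list lam \<Longrightarrow> tpos lam t x \<in> young lam"
  unfolding tableau_def tpos_def bij_betw_def by (metis inv_into_into lessThan_iff)

lemma apply_tpos: "tableau lam t \<Longrightarrow> x < sum_list lam \<Longrightarrow> t (tpos lam t x) = x"
  unfolding tableau_def tpos_def bij_betw_def by (metis f_inv_into_f lessThan_iff)

lemma tpos_eqI: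
  assumes "tableau lam t" "x < sum_list lam" "y < sum_list lam" "tpos lam t x = tpos lam t y"
  shows "x = y"
  using assms by (metis apply_tpos)

lemma tableau_comp:
  assumes "tableau lam t" "\<sigma> permutes {..<sum_list lam}"
  shows "tableau lam (\<sigma> \<circ> t)"
  using assms unfolding tableau_def by (metis bij_betw_trans permutes_imp_bij)

lemma tpos_comp:
  assumes "tableau lam t" "\<sigma> permutes {..<sum_list lam}" "x < sum_list lam"
  shows "tpos lam (\<sigma> \<circ> t) (\<sigma> x) = tpos lam t x"
  using tpos_apply[OF tableau_comp[OF assms(1,2)] tpos_in_young[OF assms(1,3)]]
  by (simp add: apply_tpos[OF assms(1,3)])

text \<open>A tableau is a total function with arbitrary values off the diagram, so agreement on the
  diagram has to take the place of equality.\<close>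

lemma tableau_cong:
  assumes "\<And>c. c \<in> young lam \<Longrightarrow> t c = s c"
  shows "tableau lam t \<longleftrightarrow> tableau lam s" "tabloid_of lam t = tabloid_of lam s"
    "polytabloid lam t = polytabloid lam s"
proof -
  show tab: "tableau lam t \<longleftrightarrow> tableau lam s"
    unfolding tableau_def by (rule bij_betw_cong) (rule assms)
  have *: "tabloid_of lam (\<pi> \<circ> t) = tabloid_of lam (\<pi> \<circ> s)" for \<pi>
    unfolding tabloid_of_def o_def using assms by (intro ext Collect_cong) metis
  from *[of id] show "tabloid_of lam t = tabloid_of lam s" by simp
  have "column_stabilizer lam t = column_stabilizer lam s"
    unfolding column_stabilizer_def using assms by (intro Collect_cong conj_cong ball_cong) auto
  then show "polytabloid lam t = polytabloid lam s"
    using * by (simp add: polytabloid_def)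
qed

lemma tableau_transfer:
  assumes "tableau lam t" "tableau lam s"
  obtains \<sigma> where "\<sigma> permutes {..<sum_list lam}" "\<And>c. c \<in> young lam \<Longrightarrow> \<sigma> (t c) = s c"
proof
  let ?\<sigma> = "\<lambda>x. if x < sum_list lam then s (tpos lam t x) else x"
  have "bij_betw (tpos lam t) {..<sum_list lam} (young lam)"
    using assms(1) by (simp add: tableau_def tpos_def bij_betw_inv_into)
  then have "bij_betw (s \<circ> tpos lam t) {..<sum_list lam} {..<sum_list lam}"
    using assms(2) by (auto simp: tableau_def intro: bij_betw_trans)
  then have "bij_betw ?\<sigma> {..<sum_list lam} {..<sum_list lam}"
    by (rule bij_betw_cong[THEN iffD1, rotated]) simp
  then show "?\<sigma> permutes {..<sum_list lam}"
    by (rule bij_imp_permutes) simp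
  show "?\<sigma> (t c) = s c" if "c \<in> young lam" for c
    using that by (simp add: tableau_apply_less[OF assms(1)] tpos_apply[OF assms(1)])
qed

lemma mem_tabloid_of:
  assumes "tableau lam t"
  shows "x \<in> tabloid_of lam t i \<longleftrightarrow> x < sum_list lam \<and> fst (tpos lam t x) = i"
proof
  assume "x \<in> tabloid_of lam t i"
  then obtain j where "x = t (i, j)" "(i, j) \<in> young lam" by (auto simp: tabloid_of_def)
  then show "x < sum_list lam \<and> fst (tpos lam t x) = i"
    using assms by (simp add: tableau_apply_less tpos_apply)
next
  assume x: "x < sum_list lam \<and> fst (tpos lam t x) = i"
  then have "(i, snd (tpos lam t x)) \<in> young lam" "x = t (i, snd (tpos lam t x))"
    using tpos_in_young[OF assms] apply_tpos[OF assms] by auto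
  then show "x \<in> tabloid_of lam t i" by (auto simp: tabloid_of_def)
qed

lemma tabloid_of_comp: "tabloid_of lam (\<sigma> \<circ> t) = (\<lambda>i. \<sigma> ` tabloid_of lam t i)"
  by (auto simp: tabloid_of_def fun_eq_iff)

section \<open>Tabloids and column stabilizers\<close>

definition tabloids :: "nat list \<Rightarrow> tabloid set" where
  "tabloids lam = {tabloid_of lam t | t. tableau lam t}"

lemma finite_tabloids [simp]: "finite (tabloids lam)"
proof (rule finite_subset)
  show "tabloids lam \<subseteq> {T. \<forall>i. (i \<in> {..<length lam} \<longrightarrow> T i \<in> Pow {..<sum_list lam}) \<and>
      (i \<notin> {..<length lam} \<longrightarrow> T i = {})}"
    by (auto simp: tabloids_def tabloid_of_def tableau_apply_less) (auto simp: young_def)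
qed (rule finite_set_of_finite_funs; simp)

lemma mem_column_stabilizer:
  assumes "tableau lam t"
  shows "\<pi> \<in> column_stabilizer lam t \<longleftrightarrow> \<pi> permutes {..<sum_list lam} \<and>
    (\<forall>x<sum_list lam. snd (tpos lam t (\<pi> x)) = snd (tpos lam t x))"
proof
  assume \<pi>: "\<pi> \<in> column_stabilizer lam t"
  have "snd (tpos lam t (\<pi> x)) = snd (tpos lam t x)" if x: "x < sum_list lam" for x
  proof -
    obtain i j where ij: "tpos lam t x = (i, j)" by fastforce
    then have "(i, j) \<in> young lam" "x = t (i, j)"
      using tpos_in_young[OF assms x] apply_tpos[OF assms x] by simp_all
    then obtain i' where "(i', j) \<in> young lam" "\<pi> x = t (i', j)"
      using \<pi> by (auto simp: column_stabilizer_def)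
    then show ?thesis using ij tpos_apply[OF assms] by simp
  qed
  then show "\<pi> permutes {..<sum_list lam} \<and>
    (\<forall>x<sum_list lam. snd (tpos lam t (\<pi> x)) = snd (tpos lam t x))"
    using \<pi> by (simp add: column_stabilizer_def symgrp_def)
next
  assume \<pi>: "\<pi> permutes {..<sum_list lam} \<and>
    (\<forall>x<sum_list lam. snd (tpos lam t (\<pi> x)) = snd (tpos lam t x))"
  have "\<exists>i'. (i', j) \<in> young lam \<and> \<pi> (t (i, j)) = t (i', j)" if ij: "(i, j) \<in> young lam" for i j
  proof -
    have x: "t (i, j) < sum_list lam" using tableau_apply_less[OF assms ij] .
    then have \<pi>x: "\<pi> (t (i, j)) < sum_list lam" using \<pi> permutes_in_image by fastforce
    have "snd (tpos lam t (\<pi> (t (i, j)))) = j" using \<pi> x tpos_apply[OF assms ij] by simp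
    then show ?thesis
      using tpos_in_young[OF assms \<pi>x] apply_tpos[OF assms \<pi>x] by (metis prod.collapse)
  qed
  then show "\<pi> \<in> column_stabilizer lam t"
    using \<pi> by (auto simp: column_stabilizer_def symgrp_def)
qed

lemma column_stabilizer_permutes:
  "\<pi> \<in> column_stabilizer lam t \<Longrightarrow> \<pi> permutes {..<sum_list lam}"
  by (simp add: column_stabilizer_def symgrp_def)

lemma finite_symgrp [simp]: "finite (symgrp N)"
  by (simp add: symgrp_def finite_permutations)

lemma finite_column_stabilizer [simp]: "finite (column_stabilizer lam t)"
  by (rule finite_subset[of _ "symgrp (sum_list lam)"]) (auto simp: column_stabilizer_def)

lemma permutes_less_iff: "\<sigma> permutes {..<N} \<Longrightarrow> \<sigma> x < N \<longleftrightarrow> x < (N::nat)"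
  using permutes_in_image[of \<sigma> "{..<N}" x] by simp

lemma id_column_stabilizer: "tableau lam t \<Longrightarrow> id \<in> column_stabilizer lam t"
  by (simp add: mem_column_stabilizer permutes_id)

lemma comp_column_stabilizer:
  assumes "tableau lam t" "\<pi> \<in> column_stabilizer lam t" "\<rho> \<in> column_stabilizer lam t"
  shows "\<pi> \<circ> \<rho> \<in> column_stabilizer lam t"
  using assms(2,3) by (auto simp: mem_column_stabilizer[OF assms(1)] permutes_compose permutes_less_iff)

lemma inv_column_stabilizer:
  assumes "tableau lam t" "\<pi> \<in> column_stabilizer lam t"
  shows "inv \<pi> \<in> column_stabilizer lam t"
proof -
  have \<pi>: "\<pi> permutes {..<sum_list lam}" using assms(2) by (rule column_stabilizer_permutes)
  have "snd (tpos lam t (inv \<pi> x)) = snd (tpos lam t x)" if "x < sum_list lam" for x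
  proof -
    have "inv \<pi> x < sum_list lam" using that permutes_less_iff[OF permutes_inv[OF \<pi>]] by simp
    then have "snd (tpos lam t (\<pi> (inv \<pi> x))) = snd (tpos lam t (inv \<pi> x))"
      using assms(2) by (simp add: mem_column_stabilizer[OF assms(1)])
    then show ?thesis by (simp add: permutes_inverses[OF \<pi>])
  qed
  then show ?thesis using permutes_inv[OF \<pi>] by (simp add: mem_column_stabilizer[OF assms(1)])
qed

lemma conj_column_stabilizer:
  assumes "tableau lam t" "\<sigma> permutes {..<sum_list lam}" "\<pi> \<in> column_stabilizer lam t"
  shows "\<sigma> \<circ> \<pi> \<circ> inv \<sigma> \<in> column_stabilizer lam (\<sigma> \<circ> t)"
proof -
  have \<pi>: "\<pi> permutes {..<sum_list lam}" using assms(3) by (rule column_stabilizer_permutes)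
  have "snd (tpos lam (\<sigma> \<circ> t) ((\<sigma> \<circ> \<pi> \<circ> inv \<sigma>) x)) = snd (tpos lam (\<sigma> \<circ> t) x)"
    if x: "x < sum_list lam" for x
  proof -
    define y where "y = inv \<sigma> x"
    have y: "y < sum_list lam" "x = \<sigma> y"
      using x permutes_less_iff[OF permutes_inv[OF assms(2)]]
      by (simp_all add: y_def permutes_inverses[OF assms(2)])
    have "\<pi> y < sum_list lam" using y permutes_less_iff[OF \<pi>] by simp
    then show ?thesis
      using assms(3) y tpos_comp[OF assms(1,2)]
      by (simp add: permutes_inverses[OF assms(2)] mem_column_stabilizer[OF assms(1)])
  qed
  moreover have "\<sigma> \<circ> \<pi> \<circ> inv \<sigma> permutes {..<sum_list lam}"
    by (intro permutes_compose permutes_inv assms(2) \<pi>)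
  ultimately show ?thesis
    by (simp add: mem_column_stabilizer[OF tableau_comp[OF assms(1,2)]])
qed

text \<open>The action in \<open>specht lam\<close> is given by one formula for all shapes; a name
  without \<open>lam\<close> lets the same permutation act on polytabloids of both shapes.\<close>

definition pact :: "(nat \<Rightarrow> nat) \<Rightarrow> (tabloid \<Rightarrow> complex) \<Rightarrow> tabloid \<Rightarrow> complex" where
  "pact \<sigma> f = (\<lambda>T. f (\<lambda>i. inv \<sigma> ` T i))"

lemma pact_add: "pact \<sigma> (f + g) = pact \<sigma> f + pact \<sigma> g"
  and pact_scale: "pact \<sigma> (fscale c f) = fscale c (pact \<sigma> f)"
  and pact_zero: "pact \<sigma> 0 = 0"
  by (simp_all add: pact_def fun_eq_iff fscale_apply)

lemma pact_sum: "pact \<sigma> (\<Sum>i\<in>I. f i) = (\<Sum>i\<in>I. pact \<sigma> (f i))"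
  by (simp add: pact_def fun_eq_iff sum_fun_apply)

lemma pact_comp:
  assumes "\<sigma> permutes A" "\<tau> permutes B"
  shows "pact (\<sigma> \<circ> \<tau>) f = pact \<sigma> (pact \<tau> f)"
  using o_inv_distrib[OF permutes_bij[OF assms(1)] permutes_bij[OF assms(2)]]
  by (simp add: pact_def image_comp)

lemma pact_inv_apply:
  assumes "\<sigma> permutes A"
  shows "pact (inv \<sigma>) f T = f (\<lambda>i. \<sigma> ` T i)"
  using permutes_inv_inv[OF assms] by (simp add: pact_def)

lemma permute_tabloid_eq_iff:
  assumes "\<sigma> permutes A"
  shows "(\<lambda>i. inv \<sigma> ` T i) = T' \<longleftrightarrow> T = (\<lambda>i. \<sigma> ` T' i)"
proof
  assume *: "(\<lambda>i. inv \<sigma> ` T i) = T'"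
  show "T = (\<lambda>i. \<sigma> ` T' i)"
    unfolding *[symmetric] by (simp add: image_comp permutes_inv_o[OF assms])
next
  assume *: "T = (\<lambda>i. \<sigma> ` T' i)"
  show "(\<lambda>i. inv \<sigma> ` T i) = T'"
    unfolding * by (simp add: image_comp permutes_inv_o[OF assms])
qed

lemma sign_comp_permutes:
  assumes "\<sigma> permutes {..<N::nat}" "\<tau> permutes {..<N}"
  shows "sign (\<sigma> \<circ> \<tau>) = sign \<sigma> * sign \<tau>"
  by (intro sign_compose permutes_imp_permutation[of "{..<N}"]) (simp_all add: assms)

lemma sign_inv_permutes:
  assumes "\<sigma> permutes {..<N::nat}"
  shows "sign (inv \<sigma>) = sign \<sigma>"
  by (intro sign_inverse permutes_imp_permutation[of "{..<N}"]) (simp_all add: assms)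

text \<open>Conjugation by \<open>\<sigma>\<close> carries the column stabilizer of \<open>t\<close>
  onto that of \<open>\<sigma> \<circ> t\<close> and preserves signs.\<close>

lemma pact_polytabloid:
  assumes t: "tableau lam t" and \<sigma>: "\<sigma> permutes {..<sum_list lam}"
  shows "pact \<sigma> (polytabloid lam t) = polytabloid lam (\<sigma> \<circ> t)"
proof
  fix T
  note \<sigma>i = permutes_inv[OF \<sigma>]
  have conj: "inv \<sigma> \<circ> \<pi> \<circ> \<sigma> \<in> column_stabilizer lam t" if "\<pi> \<in> column_stabilizer lam (\<sigma> \<circ> t)" for \<pi>
    using conj_column_stabilizer[OF tableau_comp[OF t \<sigma>] \<sigma>i that]
    by (simp add: permutes_inv_inv[OF \<sigma>] o_assoc permutes_inv_o[OF \<sigma>])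
  have "(\<Sum>\<pi>\<in>column_stabilizer lam t.
          if (\<lambda>i. inv \<sigma> ` T i) = tabloid_of lam (\<pi> \<circ> t) then of_int (sign \<pi>) else 0) =
        (\<Sum>\<pi>\<in>column_stabilizer lam (\<sigma> \<circ> t).
          if T = tabloid_of lam (\<pi> \<circ> (\<sigma> \<circ> t)) then of_int (sign \<pi>) else (0::complex))"
  proof (rule sum.reindex_bij_witness[where j = "\<lambda>\<pi>. \<sigma> \<circ> \<pi> \<circ> inv \<sigma>" and i = "\<lambda>\<pi>. inv \<sigma> \<circ> \<pi> \<circ> \<sigma>"])
    fix \<pi> assume \<pi>: "\<pi> \<in> column_stabilizer lam t"
    note p = column_stabilizer_permutes[OF \<pi>]
    show "inv \<sigma> \<circ> (\<sigma> \<circ> \<pi> \<circ> inv \<sigma>) \<circ> \<sigma> = \<pi>"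
      by (simp add: fun_eq_iff permutes_inverses[OF \<sigma>])
    show "\<sigma> \<circ> \<pi> \<circ> inv \<sigma> \<in> column_stabilizer lam (\<sigma> \<circ> t)" using conj_column_stabilizer[OF t \<sigma> \<pi>] .
    have "sign (\<sigma> \<circ> \<pi> \<circ> inv \<sigma>) = sign \<sigma> * sign \<pi> * sign \<sigma>"
      by (simp add: sign_comp_permutes[OF permutes_compose[OF p \<sigma>] \<sigma>i] sign_comp_permutes[OF \<sigma> p]
        sign_inv_permutes[OF \<sigma>])
    then have s: "sign (\<sigma> \<circ> \<pi> \<circ> inv \<sigma>) = sign \<pi>" by (simp add: mult.commute mult.left_commute)
    have "(\<sigma> \<circ> \<pi> \<circ> inv \<sigma>) \<circ> (\<sigma> \<circ> t) = \<sigma> \<circ> (\<pi> \<circ> t)"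
      by (simp add: fun_eq_iff permutes_inverses[OF \<sigma>])
    then show "(if T = tabloid_of lam (\<sigma> \<circ> \<pi> \<circ> inv \<sigma> \<circ> (\<sigma> \<circ> t)) then of_int (sign (\<sigma> \<circ> \<pi> \<circ> inv \<sigma>)) else 0) =
      (if (\<lambda>i. inv \<sigma> ` T i) = tabloid_of lam (\<pi> \<circ> t) then of_int (sign \<pi>) else (0::complex))"
      by (simp only: s permute_tabloid_eq_iff[OF \<sigma>] tabloid_of_comp[of lam \<sigma> "\<pi> \<circ> t"])
  next
    fix \<pi> assume "\<pi> \<in> column_stabilizer lam (\<sigma> \<circ> t)"
    then show "inv \<sigma> \<circ> \<pi> \<circ> \<sigma> \<in> column_stabilizer lam t" by (rule conj)
    show "\<sigma> \<circ> (inv \<sigma> \<circ> \<pi> \<circ> \<sigma>) \<circ> inv \<sigma> = \<pi>"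
      by (simp add: fun_eq_iff permutes_inverses[OF \<sigma>])
  qed
  then show "pact \<sigma> (polytabloid lam t) T = polytabloid lam (\<sigma> \<circ> t) T"
    by (simp add: pact_def polytabloid_def)
qed

lemma column_stabilizer_comp:
  assumes t: "tableau lam t" and \<pi>: "\<pi> \<in> column_stabilizer lam t"
  shows "column_stabilizer lam (\<pi> \<circ> t) = column_stabilizer lam t"
proof -
  note p = column_stabilizer_permutes[OF \<pi>]
  have col: "snd (tpos lam (\<pi> \<circ> t) x) = snd (tpos lam t x)" if "x < sum_list lam" for x
  proof -
    have "inv \<pi> x < sum_list lam" using that permutes_less_iff[OF permutes_inv[OF p]] by simp
    from tpos_comp[OF t p this]
    have "tpos lam (\<pi> \<circ> t) x = tpos lam t (inv \<pi> x)" by (simp add: permutes_inverses[OF p])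
    then show ?thesis
      using inv_column_stabilizer[OF t \<pi>] that by (simp add: mem_column_stabilizer[OF t])
  qed
  show ?thesis
    by (auto simp: mem_column_stabilizer[OF t] mem_column_stabilizer[OF tableau_comp[OF t p]]
        col permutes_less_iff)
qed

text \<open>The tableaux \<open>t\<close> and \<open>\<pi> \<circ> t\<close> have the same column
  stabilizer; composing with \<open>\<pi>\<close> on the right permutes it and multiplies all signs
  by \<open>sign \<pi>\<close>.\<close>

lemma polytabloid_column_stabilizer:
  assumes t: "tableau lam t" and \<pi>: "\<pi> \<in> column_stabilizer lam t"
  shows "polytabloid lam (\<pi> \<circ> t) = fscale (of_int (sign \<pi>)) (polytabloid lam t)"
proof
  fix T
  note p = column_stabilizer_permutes[OF \<pi>]
  have "(\<Sum>\<rho>\<in>column_stabilizer lam t.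
          if T = tabloid_of lam (\<rho> \<circ> (\<pi> \<circ> t)) then of_int (sign \<rho>) else 0) =
        (\<Sum>\<rho>\<in>column_stabilizer lam t.
          of_int (sign \<pi>) * (if T = tabloid_of lam (\<rho> \<circ> t) then of_int (sign \<rho>) else (0::complex)))"
  proof (rule sum.reindex_bij_witness[where j = "\<lambda>\<rho>. \<rho> \<circ> \<pi>" and i = "\<lambda>\<rho>. \<rho> \<circ> inv \<pi>"])
    fix \<rho> assume \<rho>: "\<rho> \<in> column_stabilizer lam t"
    show "\<rho> \<circ> \<pi> \<circ> inv \<pi> = \<rho>" "\<rho> \<circ> inv \<pi> \<circ> \<pi> = \<rho>"
      by (simp_all add: fun_eq_iff permutes_inverses[OF p])
    show "\<rho> \<circ> \<pi> \<in> column_stabilizer lam t" "\<rho> \<circ> inv \<pi> \<in> column_stabilizer lam t"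
      by (intro comp_column_stabilizer inv_column_stabilizer t \<pi> \<rho>)+
    have s: "sign (\<rho> \<circ> \<pi>) = sign \<rho> * sign \<pi>"
      by (rule sign_comp_permutes[OF column_stabilizer_permutes[OF \<rho>] p])
    have "sign \<pi> * (sign \<rho> * sign \<pi>) = sign \<rho>" by (simp add: mult.commute mult.left_commute)
    then have "of_int (sign \<pi>) * of_int (sign (\<rho> \<circ> \<pi>)) = (of_int (sign \<rho>) :: complex)"
      by (simp only: s of_int_mult[symmetric])
    then show "of_int (sign \<pi>) * (if T = tabloid_of lam (\<rho> \<circ> \<pi> \<circ> t) then of_int (sign (\<rho> \<circ> \<pi>)) else 0) =
      (if T = tabloid_of lam (\<rho> \<circ> (\<pi> \<circ> t)) then of_int (sign \<rho>) else (0::complex))"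
      by (simp add: o_assoc)
  qed
  then show "polytabloid lam (\<pi> \<circ> t) T = fscale (of_int (sign \<pi>)) (polytabloid lam t) T"
    by (simp add: polytabloid_def column_stabilizer_comp[OF t \<pi>] fscale_apply sum_distrib_left)
qed

lemma polytabloid_supported:
  assumes "tableau lam t"
  shows "polytabloid lam t \<in> supported (tabloids lam)"
proof -
  have "polytabloid lam t T = 0" if "T \<notin> tabloids lam" for T
  proof -
    have "T \<noteq> tabloid_of lam (\<pi> \<circ> t)" if "\<pi> \<in> column_stabilizer lam t" for \<pi>
      using \<open>T \<notin> tabloids lam\<close> tableau_comp[OF assms column_stabilizer_permutes[OF that]]
      by (auto simp: tabloids_def)
    then show ?thesis unfolding polytabloid_def by (intro sum.neutral) simp
  qed
  then show ?thesis by (simp add: supported_def)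
qed

text \<open>A column permutation that preserves the row contents as well fixes every entry, so only
  the identity contributes. In particular polytabloids are nonzero.\<close>

lemma polytabloid_tabloid_of:
  assumes t: "tableau lam t"
  shows "polytabloid lam t (tabloid_of lam t) = 1"
proof -
  have iff: "tabloid_of lam t = tabloid_of lam (\<pi> \<circ> t) \<longleftrightarrow> \<pi> = id"
    if \<pi>: "\<pi> \<in> column_stabilizer lam t" for \<pi>
  proof
    assume eq: "tabloid_of lam t = tabloid_of lam (\<pi> \<circ> t)"
    note p = column_stabilizer_permutes[OF \<pi>]
    have "\<pi> x = x" if x: "x < sum_list lam" for x
    proof -
      have "x \<in> tabloid_of lam t (fst (tpos lam t x))" using x by (simp add: mem_tabloid_of[OF t])
      then have "\<pi> x \<in> tabloid_of lam t (fst (tpos lam t x))"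
        by (subst eq) (simp add: tabloid_of_comp)
      then have "fst (tpos lam t (\<pi> x)) = fst (tpos lam t x)" "\<pi> x < sum_list lam"
        by (simp_all add: mem_tabloid_of[OF t])
      moreover have "snd (tpos lam t (\<pi> x)) = snd (tpos lam t x)"
        using \<pi> x by (simp add: mem_column_stabilizer[OF t])
      ultimately show ?thesis using tpos_eqI[OF t _ x] by (simp add: prod_eq_iff)
    qed
    moreover have "\<pi> x = x" if "\<not> x < sum_list lam" for x
      using permutes_not_in[OF p] that by simp
    ultimately show "\<pi> = id" by (auto simp: fun_eq_iff)
  qed simp
  have "polytabloid lam t (tabloid_of lam t) =
      (\<Sum>\<pi>\<in>column_stabilizer lam t. if \<pi> = id then of_int (sign \<pi>) else 0)"
    unfolding polytabloid_def by (intro sum.cong) (simp_all only: iff)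
  also have "\<dots> = 1" using id_column_stabilizer[OF t] by (simp add: sum.delta)
  finally show ?thesis .
qed

section \<open>Specht modules are absolutely simple\<close>

lemma card_tabloid_row:
  assumes "tableau lam s" "i < length lam"
  shows "card (tabloid_of lam s i) = lam ! i"
proof -
  have "tabloid_of lam s i = (\<lambda>j. s (i, j)) ` {..<lam ! i}"
    using assms(2) by (auto simp: tabloid_of_def young_def)
  moreover have "inj_on (\<lambda>j. s (i, j)) {..<lam ! i}"
    using assms by (auto simp: inj_on_def tableau_def bij_betw_def young_def)
  ultimately show ?thesis by (simp add: card_image)
qed

text \<open>By counting, row \<open>i\<close> of the tabloid meets column \<open>j\<close> of the tableau exactly if
  \<open>j < lam ! i\<close>: the shorter columns are already used up by the rows above.\<close>

lemma tabloid_rows_meet_columns: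
  assumes lam: "sorted_wrt (\<ge>) lam" and t: "tableau lam t" and s: "tableau lam s"
    and inj: "\<And>i. inj_on (\<lambda>x. snd (tpos lam t x)) (tabloid_of lam s i)"
  shows "i < length lam \<Longrightarrow> (\<lambda>x. snd (tpos lam t x)) ` tabloid_of lam s i = {..<lam ! i}"
proof (induction i rule: less_induct)
  case (less i)
  define col where "col = (\<lambda>x. snd (tpos lam t x))"
  have "col x < lam ! i" if x: "x \<in> tabloid_of lam s i" for x
  proof (rule ccontr)
    assume "\<not> col x < lam ! i"
    then have ji: "lam ! i \<le> col x" by simp
    \<comment> \<open>\<open>R\<close> consists of the rows of the diagram that reach the column of
      \<open>x\<close>, all of them above row \<open>i\<close>, and \<open>A\<close> of the entries
      of \<open>t\<close> in that column. By induction each row of \<open>s\<close> in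
      \<open>R\<close> has an element in \<open>A\<close>, and \<open>x\<close> is one more in row
      \<open>i\<close>: more than the column can hold.\<close>
    define R where "R = {i'. (i', col x) \<in> young lam}"
    define A where "A = {y. y < sum_list lam \<and> col y = col x}"
    have R_less: "i' < i" if "i' \<in> R" for i'
    proof (rule ccontr)
      assume "\<not> i' < i"
      then have "lam ! i' \<le> lam ! i"
        using that lam unfolding R_def young_def sorted_wrt_iff_nth_less
        by (cases "i = i'") auto
      then show False using that ji by (simp add: R_def young_def)
    qed
    have "finite R" using R_less by (auto intro: finite_subset[of _ "{..<i}"])
    have "A \<subseteq> (\<lambda>i'. t (i', col x)) ` R"
    proof
      fix y assume "y \<in> A"
      then have y: "y < sum_list lam" "snd (tpos lam t y) = col x" by (auto simp: A_def col_def)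
      then have "(fst (tpos lam t y), col x) \<in> young lam" "y = t (fst (tpos lam t y), col x)"
        using tpos_in_young[OF t y(1)] apply_tpos[OF t y(1)] by (metis prod.collapse)+
      then show "y \<in> (\<lambda>i'. t (i', col x)) ` R" by (auto simp: R_def)
    qed
    then have A: "finite A" "card A \<le> card R"
      using \<open>finite R\<close> by (meson finite_surj, meson surj_card_le)
    have "insert i R \<subseteq> (\<lambda>y. fst (tpos lam s y)) ` A"
    proof
      fix i' assume "i' \<in> insert i R"
      then consider "i' = i" | "i' \<in> R" by blast
      then show "i' \<in> (\<lambda>y. fst (tpos lam s y)) ` A"
      proof cases
        case 1
        then show ?thesis using x by (auto simp: A_def mem_tabloid_of[OF s])
      next
        case 2
        then have "col x \<in> {..<lam ! i'}" "i' < length lam" by (auto simp: R_def young_def)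
        then have "col x \<in> col ` tabloid_of lam s i'"
          unfolding col_def using less.IH[OF R_less[OF 2]] by simp
        then obtain y where "y \<in> tabloid_of lam s i'" "col y = col x" by (metis imageE)
        then show ?thesis by (auto simp: A_def mem_tabloid_of[OF s])
      qed
    qed
    then have "card (insert i R) \<le> card A" using A(1) by (meson surj_card_le)
    moreover have "i \<notin> R" using R_less by blast
    ultimately show False using A(2) \<open>finite R\<close> by simp
  qed
  then have "col ` tabloid_of lam s i \<subseteq> {..<lam ! i}" by auto
  moreover have "card (col ` tabloid_of lam s i) = lam ! i"
    using card_image[OF inj[of i]] card_tabloid_row[OF s less.prems] by (simp add: col_def)
  ultimately show ?case by (simp add: col_def card_subset_eq)
qed

text \<open>Cell \<open>(i, j)\<close> is filled with the element of row \<open>i\<close> of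
  \<open>s\<close> that lies in column \<open>j\<close> of \<open>t\<close>. The resulting tableau
  \<open>z\<close> has the rows of \<open>s\<close> and the columns of \<open>t\<close>.\<close>

lemma tabloid_column_transversal:
  assumes lam: "sorted_wrt (\<ge>) lam" and t: "tableau lam t" and s: "tableau lam s"
    and inj: "\<And>i. inj_on (\<lambda>x. snd (tpos lam t x)) (tabloid_of lam s i)"
  obtains \<pi> where "\<pi> \<in> column_stabilizer lam t" "tabloid_of lam (\<pi> \<circ> t) = tabloid_of lam s"
proof -
  define col where "col = (\<lambda>x. snd (tpos lam t x))"
  define z where "z = (\<lambda>(i, j). inv_into (tabloid_of lam s i) col j)"
  have img: "col ` tabloid_of lam s i = {..<lam ! i}" if "i < length lam" for i
    using tabloid_rows_meet_columns[OF lam t s inj that] by (simp add: col_def)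
  have z: "z (i, j) \<in> tabloid_of lam s i" "col (z (i, j)) = j" if "(i, j) \<in> young lam" for i j
    using that img[of i] inv_into_into[of j col "tabloid_of lam s i"]
      f_inv_into_f[of j col "tabloid_of lam s i"]
    by (auto simp: z_def young_def)
  have zN: "z c < sum_list lam" if "c \<in> young lam" for c
    using that z(1)[of "fst c" "snd c"] by (simp add: mem_tabloid_of[OF s])
  have zinj: "inj_on z (young lam)"
  proof (rule inj_onI)
    fix c d assume cd: "c \<in> young lam" "d \<in> young lam" "z c = z d"
    have "fst (tpos lam s (z c)) = fst c" "fst (tpos lam s (z d)) = fst d"
      using z(1)[of "fst c" "snd c"] z(1)[of "fst d" "snd d"] cd by (simp_all add: mem_tabloid_of[OF s])
    moreover have "col (z c) = snd c" "col (z d) = snd d"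
      using z(2)[of "fst c" "snd c"] z(2)[of "fst d" "snd d"] cd by simp_all
    ultimately show "c = d" using cd(3) by (simp add: prod_eq_iff)
  qed
  have "z ` young lam = {..<sum_list lam}"
    using zN by (intro card_subset_eq) (auto simp: card_image[OF zinj] card_young)
  then have ztab: "tableau lam z" using zinj by (simp add: tableau_def bij_betw_def)
  obtain \<pi> where \<pi>: "\<pi> permutes {..<sum_list lam}" "\<And>c. c \<in> young lam \<Longrightarrow> \<pi> (t c) = z c"
    using tableau_transfer[OF t ztab] by blast
  have "snd (tpos lam t (\<pi> x)) = snd (tpos lam t x)" if x: "x < sum_list lam" for x
  proof -
    have c: "tpos lam t x \<in> young lam" using tpos_in_young[OF t x] .
    have "\<pi> x = z (tpos lam t x)" using \<pi>(2)[OF c] apply_tpos[OF t x] by simp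
    then show ?thesis using z(2)[of "fst (tpos lam t x)" "snd (tpos lam t x)"] c by (simp add: col_def)
  qed
  then have "\<pi> \<in> column_stabilizer lam t" using \<pi>(1) by (simp add: mem_column_stabilizer[OF t])
  moreover have "tabloid_of lam (\<pi> \<circ> t) = tabloid_of lam s"
  proof -
    have "tabloid_of lam (\<pi> \<circ> t) = tabloid_of lam z"
      by (rule tableau_cong) (simp add: \<pi>(2))
    also have "\<dots> = tabloid_of lam s"
    proof
      fix i
      have "tabloid_of lam z i \<subseteq> tabloid_of lam s i" using z(1) by (auto simp: tabloid_of_def)
      moreover have "finite (tabloid_of lam s i)"
        by (rule finite_subset[of _ "{..<sum_list lam}"]) (auto simp: mem_tabloid_of[OF s])
      moreover have "card (tabloid_of lam z i) = card (tabloid_of lam s i)"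
      proof (cases "i < length lam")
        case True
        then show ?thesis by (simp add: card_tabloid_row ztab s)
      next
        case False
        then show ?thesis by (simp add: tabloid_of_def young_def)
      qed
      ultimately show "tabloid_of lam z i = tabloid_of lam s i" by (simp add: card_subset_eq)
    qed
    finally show ?thesis .
  qed
  ultimately show ?thesis using that by blast
qed

text \<open>If the rows of a tabloid meet every column of \<open>t\<close> at most once, a column
  permutation leads to it from the tabloid of \<open>t\<close>, so its coefficient is
  \<open>w0\<close> up to sign. Otherwise two elements share a row of the tabloid and a column of
  \<open>t\<close>; their transposition fixes the tabloid but changes the sign of
  \<open>w\<close>.\<close>

lemma column_antisymmetric_eq_0:
  assumes lam: "sorted_wrt (\<ge>) lam" and t: "tableau lam t"
    and w: "w \<in> supported (tabloids lam)"
    and anti: "\<And>\<pi>. \<pi> \<in> column_stabilizer lam t \<Longrightarrow> pact \<pi> w = fscale (of_int (sign \<pi>)) w"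
    and w0: "w (tabloid_of lam t) = 0"
  shows "w = 0"
proof
  fix T
  show "w T = 0 T"
  proof (cases "T \<in> tabloids lam")
    case False
    then show ?thesis using w by (simp add: supported_def)
  next
    case True
    then obtain s where s: "tableau lam s" and T: "T = tabloid_of lam s" by (auto simp: tabloids_def)
    show ?thesis
    proof (cases "\<forall>i. inj_on (\<lambda>x. snd (tpos lam t x)) (tabloid_of lam s i)")
      case True
      then obtain \<pi> where \<pi>: "\<pi> \<in> column_stabilizer lam t" "tabloid_of lam (\<pi> \<circ> t) = T"
        using tabloid_column_transversal[OF lam t s] T by blast
      have "w T = pact (inv \<pi>) w (tabloid_of lam t)"
        by (simp add: pact_inv_apply[OF column_stabilizer_permutes[OF \<pi>(1)]] \<pi>(2)[symmetric] tabloid_of_comp)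
      also have "\<dots> = 0"
        by (simp add: anti[OF inv_column_stabilizer[OF t \<pi>(1)]] fscale_apply w0)
      finally show ?thesis by simp
    next
      case False
      then obtain i x y where xy: "x \<in> tabloid_of lam s i" "y \<in> tabloid_of lam s i" "x \<noteq> y"
        "snd (tpos lam t x) = snd (tpos lam t y)"
        by (auto simp: inj_on_def)
      then have lt: "x < sum_list lam" "y < sum_list lam" by (simp_all add: mem_tabloid_of[OF s])
      let ?\<tau> = "transpose x y"
      have p: "?\<tau> permutes {..<sum_list lam}" using lt by (intro permutes_swap_id) auto
      have \<tau>: "?\<tau> \<in> column_stabilizer lam t"
        using p xy(4) by (auto simp: mem_column_stabilizer[OF t] transpose_def)
      have "?\<tau> ` tabloid_of lam s k = tabloid_of lam s k" for k
      proof (cases "k = i")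
        case True
        have "x \<in> tabloid_of lam s k" "y \<in> tabloid_of lam s k" using xy True by auto
        then show ?thesis by (simp add: transpose_image_eq)
      next
        case False
        then have "x \<notin> tabloid_of lam s k" "y \<notin> tabloid_of lam s k"
          using xy(1,2) by (auto simp: mem_tabloid_of[OF s])
        then show ?thesis by (simp add: transpose_image_eq)
      qed
      then have "pact ?\<tau> w T = w T" by (simp add: pact_def T)
      moreover have "pact ?\<tau> w T = - w T"
        using xy(3) by (simp add: anti[OF \<tau>] fscale_apply sign_swap_id)
      ultimately show ?thesis by simp
    qed
  qed
qed

text \<open>The vectors with this symmetry form a line: subtracting the multiple of the polytabloid
  with the same coefficient at \<open>tabloid_of lam t\<close> leaves zero. Both simplicity and
  scalar endomorphisms rest on this.\<close>

lemma column_antisymmetric_eq_scale: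
  assumes lam: "sorted_wrt (\<ge>) lam" and t: "tableau lam t"
    and w: "w \<in> supported (tabloids lam)"
    and anti: "\<And>\<pi>. \<pi> \<in> column_stabilizer lam t \<Longrightarrow> pact \<pi> w = fscale (of_int (sign \<pi>)) w"
  shows "w = fscale (w (tabloid_of lam t)) (polytabloid lam t)"
proof -
  let ?c = "w (tabloid_of lam t)"
  let ?v = "w + fscale (- ?c) (polytabloid lam t)"
  have v0: "?v = 0"
  proof (rule column_antisymmetric_eq_0[OF lam t])
    show "?v \<in> supported (tabloids lam)"
      by (intro cfun.subspace_add cfun.subspace_scale subspace_supported w polytabloid_supported t)
    fix \<pi> assume \<pi>: "\<pi> \<in> column_stabilizer lam t"
    have "pact \<pi> (polytabloid lam t) = fscale (of_int (sign \<pi>)) (polytabloid lam t)"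
      by (simp only: pact_polytabloid[OF t column_stabilizer_permutes[OF \<pi>]]
          polytabloid_column_stabilizer[OF t \<pi>])
    then show "pact \<pi> ?v = fscale (of_int (sign \<pi>)) ?v"
      by (simp only: pact_add pact_scale anti[OF \<pi>] cfun.scale_right_distrib cfun.scale_left_commute)
  next
    show "?v (tabloid_of lam t) = 0"
      by (simp add: polytabloid_tabloid_of[OF t] fscale_apply)
  qed
  have "w = ?v + fscale ?c (polytabloid lam t)" by (simp add: fun_eq_iff fscale_apply)
  also have "\<dots> = fscale ?c (polytabloid lam t)" by (simp only: v0 add_0_left)
  finally show ?thesis .
qed

section \<open>Submodules and endomorphisms of Specht modules\<close>

lemma act_specht: "act (specht lam) = pact"
  by (simp add: specht_def pact_def fun_eq_iff)

lemma vecs_specht: "vecs (specht lam) = cfun.span {polytabloid lam t | t. tableau lam t}"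
  by (simp add: specht_def)

lemma polytabloid_in_specht: "tableau lam t \<Longrightarrow> polytabloid lam t \<in> vecs (specht lam)"
  unfolding vecs_specht by (intro cfun.span_base) auto

lemma specht_minimal:
  assumes "cfun.subspace U" "\<And>t. tableau lam t \<Longrightarrow> polytabloid lam t \<in> U"
  shows "vecs (specht lam) \<subseteq> U"
  unfolding vecs_specht by (intro cfun.span_minimal) (use assms in auto)

lemma subspace_specht: "cfun.subspace (vecs (specht lam))"
  by (simp add: vecs_specht)

lemma specht_supported: "vecs (specht lam) \<subseteq> supported (tabloids lam)"
  by (intro specht_minimal subspace_supported polytabloid_supported)

lemma pact_in_specht:
  assumes \<sigma>: "\<sigma> \<in> symgrp (sum_list lam)" and v: "v \<in> vecs (specht lam)"
  shows "pact \<sigma> v \<in> vecs (specht lam)"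
proof -
  have p: "\<sigma> permutes {..<sum_list lam}" using \<sigma> by (simp add: symgrp_def)
  have "vecs (specht lam) \<subseteq> {v. pact \<sigma> v \<in> vecs (specht lam)}"
  proof (rule specht_minimal)
    show "cfun.subspace {v. pact \<sigma> v \<in> vecs (specht lam)}"
      using subspace_specht[of lam]
      by (simp add: cfun.subspace_def pact_add pact_scale pact_zero)
    show "polytabloid lam t \<in> {v. pact \<sigma> v \<in> vecs (specht lam)}" if "tableau lam t" for t
      by (simp add: pact_polytabloid[OF that p] polytabloid_in_specht[OF tableau_comp[OF that p]])
  qed
  then show ?thesis using v by blast
qed

lemma is_module_specht: "is_module (symgrp (sum_list lam)) (specht lam)"
  by (simp add: is_module_def submodule_def act_specht subspace_specht pact_in_specht pact_add pact_scale)

lemma submodule_eq_specht: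
  assumes U: "submodule (symgrp (sum_list lam)) (specht lam) U"
    and t: "tableau lam t" "polytabloid lam t \<in> U"
  shows "U = vecs (specht lam)"
proof
  show "U \<subseteq> vecs (specht lam)" using U by (simp add: submodule_def)
  show "vecs (specht lam) \<subseteq> U"
  proof (rule specht_minimal)
    show "cfun.subspace U" using U by (simp add: submodule_def)
    fix s assume s: "tableau lam s"
    obtain \<sigma> where \<sigma>: "\<sigma> permutes {..<sum_list lam}" "\<And>c. c \<in> young lam \<Longrightarrow> \<sigma> (t c) = s c"
      using tableau_transfer[OF t(1) s] by blast
    have "polytabloid lam s = polytabloid lam (\<sigma> \<circ> t)" by (rule tableau_cong) (simp add: \<sigma>(2))
    also have "\<dots> = pact \<sigma> (polytabloid lam t)" using pact_polytabloid[OF t(1) \<sigma>(1)] by simp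
    also have "\<dots> \<in> U" using U \<sigma>(1) t(2) by (simp add: submodule_def act_specht symgrp_def)
    finally show "polytabloid lam s \<in> U" .
  qed
qed

text \<open>Together with the fact that a signed column sum lies on the line of the polytabloid,
  this identifies the factor as an inner product, the key to James's submodule theorem.\<close>

lemma column_antisymmetrizer_apply:
  assumes t: "tableau lam t"
  shows "(\<Sum>\<pi>\<in>column_stabilizer lam t. fscale (of_int (sign \<pi>)) (pact \<pi> u)) (tabloid_of lam t)
    = herm (tabloids lam) u (polytabloid lam t)"
proof -
  let ?C = "column_stabilizer lam t"
  have "(\<Sum>\<pi>\<in>?C. fscale (of_int (sign \<pi>)) (pact \<pi> u)) (tabloid_of lam t) =
      (\<Sum>\<pi>\<in>?C. of_int (sign \<pi>) * pact \<pi> u (tabloid_of lam t))"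
    by (simp add: sum_fun_apply fscale_apply)
  also have "\<dots> = (\<Sum>\<pi>\<in>?C. of_int (sign \<pi>) * u (tabloid_of lam (\<pi> \<circ> t)))"
  proof (rule sum.reindex_bij_witness[where i = inv and j = inv])
    fix \<pi> assume \<pi>: "\<pi> \<in> ?C"
    note p = column_stabilizer_permutes[OF \<pi>]
    show "inv (inv \<pi>) = \<pi>" "inv (inv \<pi>) = \<pi>" by (simp_all add: permutes_inv_inv[OF p])
    show "inv \<pi> \<in> ?C" "inv \<pi> \<in> ?C" using inv_column_stabilizer[OF t \<pi>] by simp_all
    show "of_int (sign (inv \<pi>)) * u (tabloid_of lam (inv \<pi> \<circ> t)) =
        of_int (sign \<pi>) * pact \<pi> u (tabloid_of lam t)"
      by (simp add: sign_inv_permutes[OF p] pact_def tabloid_of_comp)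
  qed
  also have "\<dots> = (\<Sum>\<pi>\<in>?C. \<Sum>T\<in>tabloids lam.
      if T = tabloid_of lam (\<pi> \<circ> t) then u T * of_int (sign \<pi>) else 0)"
  proof (rule sum.cong[OF refl])
    fix \<pi> assume \<pi>: "\<pi> \<in> ?C"
    have "tabloid_of lam (\<pi> \<circ> t) \<in> tabloids lam"
      using tableau_comp[OF t column_stabilizer_permutes[OF \<pi>]] by (auto simp: tabloids_def)
    then show "of_int (sign \<pi>) * u (tabloid_of lam (\<pi> \<circ> t)) =
      (\<Sum>T\<in>tabloids lam. if T = tabloid_of lam (\<pi> \<circ> t) then u T * of_int (sign \<pi>) else 0)"
      by simp
  qed
  also have "\<dots> = (\<Sum>T\<in>tabloids lam. \<Sum>\<pi>\<in>?C.
      if T = tabloid_of lam (\<pi> \<circ> t) then u T * of_int (sign \<pi>) else 0)"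
    by (rule sum.swap)
  also have "\<dots> = herm (tabloids lam) u (polytabloid lam t)"
    unfolding herm_def polytabloid_def cnj_sum sum_distrib_left
    by (intro sum.cong refl) simp
  finally show ?thesis .
qed

lemma pact_column_antisymmetrizer:
  fixes u :: "tabloid \<Rightarrow> complex"
  assumes t: "tableau lam t" and \<rho>: "\<rho> \<in> column_stabilizer lam t"
  defines "k \<equiv> \<Sum>\<pi>\<in>column_stabilizer lam t. fscale (of_int (sign \<pi>)) (pact \<pi> u)"
  shows "pact \<rho> k = fscale (of_int (sign \<rho>)) k"
proof -
  let ?C = "column_stabilizer lam t"
  note r = column_stabilizer_permutes[OF \<rho>]
  have "pact \<rho> k = (\<Sum>\<pi>\<in>?C. fscale (of_int (sign \<pi>)) (pact \<rho> (pact \<pi> u)))"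
    by (simp only: k_def pact_sum pact_scale)
  also have "\<dots> = (\<Sum>\<pi>\<in>?C. fscale (of_int (sign \<rho>)) (fscale (of_int (sign \<pi>)) (pact \<pi> u)))"
  proof (rule sum.reindex_bij_witness[where i = "\<lambda>\<pi>. inv \<rho> \<circ> \<pi>" and j = "\<lambda>\<pi>. \<rho> \<circ> \<pi>"])
    fix \<pi> assume \<pi>: "\<pi> \<in> ?C"
    note p = column_stabilizer_permutes[OF \<pi>]
    show "inv \<rho> \<circ> (\<rho> \<circ> \<pi>) = \<pi>" "\<rho> \<circ> (inv \<rho> \<circ> \<pi>) = \<pi>"
      by (simp_all add: fun_eq_iff permutes_inverses[OF r])
    show "\<rho> \<circ> \<pi> \<in> ?C" "inv \<rho> \<circ> \<pi> \<in> ?C"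
      by (intro comp_column_stabilizer inv_column_stabilizer t \<pi> \<rho>)+
    have "sign \<rho> * sign (\<rho> \<circ> \<pi>) = sign \<pi>" by (simp add: sign_comp_permutes[OF r p])
    then have "of_int (sign \<rho>) * of_int (sign (\<rho> \<circ> \<pi>)) = (of_int (sign \<pi>) :: complex)"
      by (simp only: of_int_mult[symmetric])
    then show "fscale (of_int (sign \<rho>)) (fscale (of_int (sign (\<rho> \<circ> \<pi>))) (pact (\<rho> \<circ> \<pi>) u)) =
        fscale (of_int (sign \<pi>)) (pact \<rho> (pact \<pi> u))"
      by (simp only: cfun.scale_scale pact_comp[OF r p])
  qed
  also have "\<dots> = fscale (of_int (sign \<rho>)) k"
    by (simp only: k_def cfun.scale_sum_right)
  finally show ?thesis .
qed

text \<open>James's argument: if some \<open>u\<close> in \<open>U\<close> is not orthogonal to some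
  polytabloid, the signed column sum of \<open>u\<close> is a nonzero multiple of that polytabloid,
  which generates everything. Otherwise \<open>U\<close> is orthogonal to the Specht module that
  contains it, hence zero.\<close>

lemma simple_module_specht:
  assumes lam: "sorted_wrt (\<ge>) lam"
  shows "simple_module (symgrp (sum_list lam)) (specht lam)"
  unfolding simple_module_def
proof (intro conjI allI impI)
  obtain t where t: "tableau lam t" using tableau_exists by blast
  have "polytabloid lam t \<noteq> 0" using polytabloid_tabloid_of[OF t] by auto
  then show "vecs (specht lam) \<noteq> {0}" using polytabloid_in_specht[OF t] by auto
next
  fix U assume U: "submodule (symgrp (sum_list lam)) (specht lam) U"
  have Us: "cfun.subspace U" "U \<subseteq> vecs (specht lam)" using U by (auto simp: submodule_def)
  show "U = {0} \<or> U = vecs (specht lam)"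
  proof (rule disjCI)
    assume "U \<noteq> vecs (specht lam)"
    have orth: "herm (tabloids lam) u (polytabloid lam t) = 0" if u: "u \<in> U" and t: "tableau lam t" for u t
    proof (rule ccontr)
      let ?k = "\<Sum>\<pi>\<in>column_stabilizer lam t. fscale (of_int (sign \<pi>)) (pact \<pi> u)"
      let ?c = "herm (tabloids lam) u (polytabloid lam t)"
      assume c: "?c \<noteq> 0"
      have kU: "?k \<in> U"
        using U u by (intro cfun.subspace_sum cfun.subspace_scale Us(1))
          (auto simp: submodule_def act_specht column_stabilizer_def)
      have "?k = fscale ?c (polytabloid lam t)"
        unfolding column_antisymmetrizer_apply[OF t, symmetric]
        using kU Us(2) specht_supported
        by (intro column_antisymmetric_eq_scale[OF lam t] pact_column_antisymmetrizer[OF t]) auto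
      then have "fscale (1 / ?c) ?k = polytabloid lam t" using c by simp
      then have "polytabloid lam t \<in> U" using cfun.subspace_scale[OF Us(1) kU, of "1 / ?c"] by simp
      then show False using submodule_eq_specht[OF U t] \<open>U \<noteq> vecs (specht lam)\<close> by blast
    qed
    have "u = 0" if u: "u \<in> U" for u
    proof -
      have "vecs (specht lam) \<subseteq> {v. herm (tabloids lam) u v = 0}"
      proof (rule specht_minimal)
        show "cfun.subspace {v. herm (tabloids lam) u v = 0}"
          by (simp add: cfun.subspace_def herm_add_right herm_scale_right)
      qed (simp add: orth[OF u])
      then have "herm (tabloids lam) u u = 0" using u Us(2) by blast
      then show ?thesis using herm_self_eq_0 u Us(2) specht_supported by (meson finite_tabloids subsetD)
    qed
    then show "U = {0}" using cfun.subspace_0[OF Us(1)] by blast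
  qed
qed

text \<open>The image of a polytabloid inherits its sign behaviour under the column stabilizer and
  therefore lies on the same line.\<close>

lemma specht_endomorphism_scalar:
  assumes lam: "sorted_wrt (\<ge>) lam" and t: "tableau lam t"
    and \<phi>: "ghom (symgrp (sum_list lam)) (specht lam) (specht lam) \<phi>"
  shows "\<exists>c. \<phi> (polytabloid lam t) = fscale c (polytabloid lam t)"
proof -
  let ?e = "polytabloid lam t"
  have e: "?e \<in> vecs (specht lam)" using polytabloid_in_specht[OF t] .
  have "pact \<pi> (\<phi> ?e) = fscale (of_int (sign \<pi>)) (\<phi> ?e)" if \<pi>: "\<pi> \<in> column_stabilizer lam t" for \<pi>
  proof -
    have g: "\<pi> \<in> symgrp (sum_list lam)" using \<pi> by (simp add: column_stabilizer_def)
    have "pact \<pi> (\<phi> ?e) = \<phi> (pact \<pi> ?e)" using ghomD(4)[OF \<phi> g e] by (simp add: act_specht)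
    also have "pact \<pi> ?e = fscale (of_int (sign \<pi>)) ?e"
      by (simp only: pact_polytabloid[OF t column_stabilizer_permutes[OF \<pi>]]
          polytabloid_column_stabilizer[OF t \<pi>])
    also have "\<phi> (fscale (of_int (sign \<pi>)) ?e) = fscale (of_int (sign \<pi>)) (\<phi> ?e)"
      by (rule ghomD(3)[OF \<phi> e])
    finally show ?thesis .
  qed
  moreover have "\<phi> ?e \<in> supported (tabloids lam)" using ghomD(1)[OF \<phi> e] specht_supported by blast
  ultimately show ?thesis using column_antisymmetric_eq_scale[OF lam t] by blast
qed

section \<open>Frobenius reciprocity for the Foulkes module\<close>

text \<open>The only tabloid of shape \<open>[n]\<close>; the Specht module of \<open>[n]\<close> is
  the space of functions supported at this point.\<close>

definition row_tabloid :: "nat \<Rightarrow> tabloid" where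
  "row_tabloid n = (\<lambda>i. if i = 0 then {..<n} else {})"

lemma tabloid_of_one_row:
  assumes "tableau [n] t"
  shows "tabloid_of [n] t = row_tabloid n"
proof -
  have "fst (tpos [n] t x) = 0" if "x < n" for x
    using tpos_in_young[OF assms, of x] that by (auto simp: young_def)
  then show ?thesis
    by (auto simp: fun_eq_iff row_tabloid_def mem_tabloid_of[OF assms] set_eq_iff)
qed

lemma vecs_specht_one_row: "vecs (specht [n]) = supported {row_tabloid n}"
proof
  have tabs: "tabloids [n] \<subseteq> {row_tabloid n}" using tabloid_of_one_row by (auto simp: tabloids_def)
  then show "vecs (specht [n]) \<subseteq> supported {row_tabloid n}"
    using specht_supported[of "[n]"] by (auto simp: supported_def)
  obtain t where t: "tableau [n] t" using tableau_exists by blast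
  show "supported {row_tabloid n} \<subseteq> vecs (specht [n])"
  proof
    fix f assume f: "f \<in> supported {row_tabloid n}"
    have "f = fscale (f (row_tabloid n)) (polytabloid [n] t)"
    proof
      fix T
      show "f T = fscale (f (row_tabloid n)) (polytabloid [n] t) T"
      proof (cases "T = row_tabloid n")
        case True
        then show ?thesis using polytabloid_tabloid_of[OF t] tabloid_of_one_row[OF t] by (simp add: fscale_apply)
      next
        case False
        then have "f T = 0" "polytabloid [n] t T = 0"
          using f polytabloid_supported[OF t] tabs by (auto simp: supported_def)
        then show ?thesis by (simp add: fscale_apply)
      qed
    qed
    then show "f \<in> vecs (specht [n])"
      using polytabloid_in_specht[OF t] cfun.subspace_scale[OF subspace_specht] by metis
  qed
qed

section \<open>Elements of the wreath product and the Foulkes module\<close>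

lemma wreath_permutes: "k \<in> wreath m n \<Longrightarrow> k permutes {..<m * n}"
  by (simp add: wreath_def symgrp_def)

lemma wreath_same_block:
  assumes "k \<in> wreath m n" "x < m * n" "y < m * n"
  shows "k x div m = k y div m \<longleftrightarrow> x div m = y div m"
  using assms by (simp add: wreath_def)

lemma wreath_top_permutes:
  assumes "m > 0" "k \<in> wreath m n"
  shows "wreath_top m n k permutes {..<n}"
proof (rule bij_imp_permutes)
  note k = wreath_permutes[OF assms(2)]
  have less: "i * m < m * n" if "i < n" for i using that assms(1) by (simp add: mult.commute)
  have maps: "wreath_top m n k ` {..<n} \<subseteq> {..<n}"
  proof
    fix y assume "y \<in> wreath_top m n k ` {..<n}"
    then obtain i where "i < n" "y = k (i * m) div m" by (auto simp: wreath_top_def)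
    moreover from this have "k (i * m) < m * n" using less permutes_less_iff[OF k] by simp
    ultimately show "y \<in> {..<n}" by (simp add: less_mult_imp_div_less mult.commute)
  qed
  have "inj_on (wreath_top m n k) {..<n}"
  proof (rule inj_onI)
    fix i j assume ij: "i \<in> {..<n}" "j \<in> {..<n}" "wreath_top m n k i = wreath_top m n k j"
    then have "k (i * m) div m = k (j * m) div m" by (simp add: wreath_top_def)
    then have "i * m div m = j * m div m" using wreath_same_block[OF assms(2)] less ij by simp
    then show "i = j" using assms(1) by simp
  qed
  then show "bij_betw (wreath_top m n k) {..<n} {..<n}"
    using maps by (simp add: bij_betw_def endo_inj_surj)
  show "wreath_top m n k x = x" if "x \<notin> {..<n}" for x using that by (simp add: wreath_top_def)
qed

lemma symgrp_comp: "\<sigma> \<in> symgrp N \<Longrightarrow> \<tau> \<in> symgrp N \<Longrightarrow> \<sigma> \<circ> \<tau> \<in> symgrp N"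
  by (simp add: symgrp_def permutes_compose)

lemma symgrp_inv: "\<sigma> \<in> symgrp N \<Longrightarrow> inv \<sigma> \<in> symgrp N"
  by (simp add: symgrp_def permutes_inv)

lemma symgrp_inv_comp: "\<sigma> \<in> symgrp N \<Longrightarrow> inv \<sigma> \<circ> \<sigma> = id" "\<sigma> \<in> symgrp N \<Longrightarrow> \<sigma> \<circ> inv \<sigma> = id"
  by (simp_all add: symgrp_def permutes_inv_o)

lemma symgrp_comp_right_iff:
  assumes "h \<in> symgrp N"
  shows "g \<circ> h \<in> symgrp N \<longleftrightarrow> g \<in> symgrp N"
proof
  assume "g \<circ> h \<in> symgrp N"
  then have "(g \<circ> h) \<circ> inv h \<in> symgrp N" by (rule symgrp_comp[OF _ symgrp_inv[OF assms]])
  moreover have "(g \<circ> h) \<circ> inv h = g" using symgrp_inv_comp(2)[OF assms] by (simp only: comp_assoc comp_id)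
  ultimately show "g \<in> symgrp N" by simp
qed (rule symgrp_comp[OF _ assms])

lemma act_foulkes: "act (foulkes [n] m) h f (g, x) = f (g \<circ> h, x)"
  by (simp add: foulkes_def induced_def)

text \<open>Every permutation of the blocks fixes \<open>row_tabloid n\<close>, so the inflated
  module is trivial and the induced one consists of the functions on the group that are constant on
  the cosets of the wreath product.\<close>

lemma mem_foulkes:
  assumes "m > 0"
  shows "f \<in> vecs (foulkes [n] m) \<longleftrightarrow>
    (\<forall>g T. (g, T) \<notin> symgrp (m * n) \<times> {row_tabloid n} \<longrightarrow> f (g, T) = 0) \<and>
    (\<forall>k\<in>wreath m n. \<forall>g\<in>symgrp (m * n). f (k \<circ> g, row_tabloid n) = f (g, row_tabloid n))"
    (is "_ \<longleftrightarrow> ?supp \<and> ?inv")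
proof -
  let ?G = "symgrp (m * n)"
  let ?r = "row_tabloid n"
  have fix_row: "(\<lambda>i. inv (wreath_top m n k) ` T i) = ?r \<longleftrightarrow> T = ?r" if "k \<in> wreath m n" for k T
  proof -
    note p = wreath_top_permutes[OF assms that]
    have "(\<lambda>i. wreath_top m n k ` ?r i) = ?r"
      by (auto simp: fun_eq_iff row_tabloid_def permutes_image[OF p])
    then show ?thesis by (simp add: permute_tabloid_eq_iff[OF p])
  qed
  have "f \<in> vecs (foulkes [n] m) \<longleftrightarrow> (\<forall>g x. g \<notin> ?G \<longrightarrow> f (g, x) = 0) \<and>
      (\<forall>g\<in>?G. (\<lambda>x. f (g, x)) \<in> supported {?r}) \<and>
      (\<forall>k\<in>wreath m n. \<forall>g\<in>?G. \<forall>T. f (k \<circ> g, T) = f (g, \<lambda>i. inv (wreath_top m n k) ` T i))"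
    by (simp add: foulkes_def induced_def inflation_def vecs_specht_one_row act_specht pact_def fun_eq_iff)
  also have "\<dots> \<longleftrightarrow> ?supp \<and> (\<forall>k\<in>wreath m n. \<forall>g\<in>?G. \<forall>T.
      f (k \<circ> g, T) = f (g, \<lambda>i. inv (wreath_top m n k) ` T i))"
    by (auto simp: supported_def)
  also have "\<dots> \<longleftrightarrow> ?supp \<and> ?inv"
  proof (rule conj_cong[OF refl], rule ball_cong[OF refl], rule ball_cong[OF refl])
    fix k g assume supp: ?supp and k: "k \<in> wreath m n" and g: "g \<in> ?G"
    show "(\<forall>T. f (k \<circ> g, T) = f (g, \<lambda>i. inv (wreath_top m n k) ` T i)) \<longleftrightarrow>
        f (k \<circ> g, ?r) = f (g, ?r)"
    proof
      assume "\<forall>T. f (k \<circ> g, T) = f (g, \<lambda>i. inv (wreath_top m n k) ` T i)"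
      then have "f (k \<circ> g, ?r) = f (g, \<lambda>i. inv (wreath_top m n k) ` ?r i)" by blast
      then show "f (k \<circ> g, ?r) = f (g, ?r)" using fix_row[OF k, of ?r] by simp
    next
      assume eq: "f (k \<circ> g, ?r) = f (g, ?r)"
      show "\<forall>T. f (k \<circ> g, T) = f (g, \<lambda>i. inv (wreath_top m n k) ` T i)"
      proof
        fix T
        show "f (k \<circ> g, T) = f (g, \<lambda>i. inv (wreath_top m n k) ` T i)"
        proof (cases "T = ?r")
          case True
          then show ?thesis using eq fix_row[OF k, of ?r] by simp
        next
          case False
          then have "(\<lambda>i. inv (wreath_top m n k) ` T i) \<noteq> ?r" using fix_row[OF k] by simp
          then show ?thesis using False supp by simp
        qed
      qed
    qed
  qed
  finally show ?thesis .
qed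

lemma is_module_foulkes:
  assumes "m > 0"
  shows "is_module (symgrp (m * n)) (foulkes [n] m)"
proof -
  let ?M = "foulkes [n] m"
  have "cfun.subspace (vecs ?M)"
    by (rule cfun.subspaceI) (simp_all add: mem_foulkes[OF assms] fscale_apply)
  moreover have "act ?M h f \<in> vecs ?M" if h: "h \<in> symgrp (m * n)" and f: "f \<in> vecs ?M" for h f
  proof -
    have "f ((k \<circ> g) \<circ> h, row_tabloid n) = f (g \<circ> h, row_tabloid n)"
      if "k \<in> wreath m n" "g \<in> symgrp (m * n)" for k g
      using f that symgrp_comp[OF that(2) h] unfolding mem_foulkes[OF assms] o_assoc[symmetric] by blast
    then show ?thesis
      using f by (auto simp: mem_foulkes[OF assms] act_foulkes symgrp_comp_right_iff[OF h])
  qed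
  ultimately show ?thesis
    by (auto simp: is_module_def submodule_def fun_eq_iff act_foulkes fscale_apply)
qed

text \<open>Right translation by \<open>h\<close> permutes the finite support set, so its adjoint
  for the Hermitian form is translation by \<open>inv h\<close>.\<close>

lemma foulkes_decomposition_exists:
  assumes "m > 0"
  shows "\<exists>D. simple_decomposition (symgrp (m * n)) (foulkes [n] m) D"
proof -
  let ?M = "foulkes [n] m" and ?G = "symgrp (m * n)"
  let ?X = "?G \<times> {row_tabloid n}"
  have "\<exists>D. simple_decomposition ?G (?M\<lparr>vecs := vecs ?M\<rparr>) D"
  proof (rule simple_decomposition_exists)
    show "finite ?X" by simp
    show "vecs ?M \<subseteq> supported ?X"
      using mem_foulkes[OF assms, of _ n] by (auto simp: supported_def)
    show "submodule ?G ?M (vecs ?M)" using is_module_foulkes[OF assms] by (simp add: is_module_def)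
    fix h assume h: "h \<in> ?G"
    have "herm ?X (act ?M h u) v = herm ?X u (act ?M (inv h) v)" for u v
      unfolding herm_def
    proof (rule sum.reindex_bij_witness[where j = "\<lambda>(g, x). (g \<circ> h, x)" and i = "\<lambda>(g, x). (g \<circ> inv h, x)"])
      fix c assume "c \<in> ?X"
      then obtain g where g: "g \<in> ?G" "c = (g, row_tabloid n)" by auto
      show "(case (case c of (g, x) \<Rightarrow> (g \<circ> h, x)) of (g, x) \<Rightarrow> (g \<circ> inv h, x)) = c"
        "(case (case c of (g, x) \<Rightarrow> (g \<circ> inv h, x)) of (g, x) \<Rightarrow> (g \<circ> h, x)) = c"
        by (simp_all add: g o_assoc[symmetric] symgrp_inv_comp[OF h])
      show "(case c of (g, x) \<Rightarrow> (g \<circ> h, x)) \<in> ?X" "(case c of (g, x) \<Rightarrow> (g \<circ> inv h, x)) \<in> ?X"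
        using g symgrp_comp symgrp_inv h by auto
      show "u (case c of (g, x) \<Rightarrow> (g \<circ> h, x)) * cnj (act ?M (inv h) v (case c of (g, x) \<Rightarrow> (g \<circ> h, x))) =
          act ?M h u c * cnj (v c)"
        by (simp add: g act_foulkes o_assoc[symmetric] symgrp_inv_comp[OF h])
    qed
    then show "\<exists>g'\<in>?G. \<forall>u\<in>vecs ?M. \<forall>v\<in>vecs ?M. herm ?X (act ?M h u) v = herm ?X u (act ?M g' v)"
      using symgrp_inv[OF h] by blast
  qed
  then show ?thesis by simp
qed

text \<open>Only the values on the Specht module are constrained. Functionals that agree there are
  not identified, so the functionals themselves cannot be counted; \<open>orbit_function\<close>
  removes the ambiguity.\<close>

definition invariant_functional ::
    "nat list \<Rightarrow> (nat \<Rightarrow> nat) set \<Rightarrow> ((tabloid \<Rightarrow> complex) \<Rightarrow> complex) \<Rightarrow> bool" where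
  "invariant_functional lam K \<theta> \<longleftrightarrow>
     (\<forall>u\<in>vecs (specht lam). \<forall>v\<in>vecs (specht lam). \<theta> (u + v) = \<theta> u + \<theta> v) \<and>
     (\<forall>c. \<forall>v\<in>vecs (specht lam). \<theta> (fscale c v) = c * \<theta> v) \<and>
     (\<forall>k\<in>K. \<forall>v\<in>vecs (specht lam). \<theta> (pact k v) = \<theta> v)"

lemma invariant_functionalD:
  assumes "invariant_functional lam K \<theta>"
  shows "u \<in> vecs (specht lam) \<Longrightarrow> v \<in> vecs (specht lam) \<Longrightarrow> \<theta> (u + v) = \<theta> u + \<theta> v"
    and "v \<in> vecs (specht lam) \<Longrightarrow> \<theta> (fscale c v) = c * \<theta> v"
    and "k \<in> K \<Longrightarrow> v \<in> vecs (specht lam) \<Longrightarrow> \<theta> (pact k v) = \<theta> v"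
  using assms by (simp_all add: invariant_functional_def)

lemma invariant_functional_zero:
  assumes "invariant_functional lam K \<theta>"
  shows "\<theta> 0 = 0"
  using invariant_functionalD(2)[OF assms cfun.subspace_0[OF subspace_specht], of 0] by simp

lemma invariant_functional_sum:
  assumes \<theta>: "invariant_functional lam K \<theta>" and "finite I"
    and v: "\<And>i. i \<in> I \<Longrightarrow> v i \<in> vecs (specht lam)"
  shows "\<theta> (\<Sum>i\<in>I. v i) = (\<Sum>i\<in>I. \<theta> (v i))"
  using \<open>finite I\<close> v
proof (induction I rule: finite_induct)
  case empty
  show ?case by (simp only: sum.empty invariant_functional_zero[OF \<theta>])
next
  case (insert i I)
  have "(\<Sum>i\<in>I. v i) \<in> vecs (specht lam)"
    using insert.prems by (intro cfun.subspace_sum subspace_specht) simp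
  then have "\<theta> (v i + (\<Sum>i\<in>I. v i)) = \<theta> (v i) + \<theta> (\<Sum>i\<in>I. v i)"
    using insert.prems by (intro invariant_functionalD(1)[OF \<theta>]) auto
  then show ?case
    using insert.IH insert.prems by (simp only: sum.insert[OF insert.hyps] insert_iff simp_thms)
qed

text \<open>The matrix coefficient that sends \<open>g\<close> to the value of
  \<open>\<theta>\<close> at the translate of \<open>v\<close> by \<open>g\<close>, and thus the
  image of \<open>v\<close> under the homomorphism that Frobenius reciprocity attaches to
  \<open>\<theta>\<close>.\<close>

definition orbit_function :: "nat \<Rightarrow> nat \<Rightarrow> (tabloid \<Rightarrow> complex) \<Rightarrow>
    ((tabloid \<Rightarrow> complex) \<Rightarrow> complex) \<Rightarrow> (nat \<Rightarrow> nat) \<times> tabloid \<Rightarrow> complex" where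
  "orbit_function m n v \<theta> =
     (\<lambda>(g, T). if g \<in> symgrp (m * n) \<and> T = row_tabloid n then \<theta> (pact g v) else 0)"

text \<open>Frobenius reciprocity: evaluation at the identity turns a homomorphism into a
  functional, whose invariance is constancy on cosets; equivariance recovers the values at all other
  \<open>g\<close>.\<close>

lemma foulkes_hom_values:
  assumes m: "m > 0" and lam: "sum_list lam = m * n" and e: "e \<in> vecs (specht lam)"
  shows "{\<phi> e |\<phi>. ghom (symgrp (m * n)) (specht lam) (foulkes [n] m) \<phi>} =
    {orbit_function m n e \<theta> |\<theta>. invariant_functional lam (wreath m n) \<theta>}"
proof -
  let ?M = "foulkes [n] m" and ?G = "symgrp (m * n)" and ?S = "specht lam" and ?r = "row_tabloid n"
  have id: "id \<in> ?G" by (simp add: symgrp_def)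
  have KG: "k \<in> ?G" if "k \<in> wreath m n" for k using that by (simp add: wreath_def)
  have pS: "pact g v \<in> vecs ?S" if "g \<in> ?G" "v \<in> vecs ?S" for g v
    using pact_in_specht[of g lam v] that by (simp add: lam)
  have pc: "pact (g \<circ> h) v = pact g (pact h v)" if "g \<in> ?G" "h \<in> ?G" for g h v
    using that pact_comp by (simp add: symgrp_def)
  have 1: "\<exists>\<theta>. \<phi> e = orbit_function m n e \<theta> \<and> invariant_functional lam (wreath m n) \<theta>"
    if \<phi>: "ghom ?G ?S ?M \<phi>" for \<phi>
  proof -
    let ?\<theta> = "\<lambda>v. \<phi> v (id, ?r)"
    have val: "\<phi> v (g, ?r) = ?\<theta> (pact g v)" if "g \<in> ?G" "v \<in> vecs ?S" for g v
      using ghomD(4)[OF \<phi> that] act_foulkes[of n m g "\<phi> v" id ?r] by (simp add: act_specht)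
    have "\<phi> e (g, T) = orbit_function m n e ?\<theta> (g, T)" for g T
      using ghomD(1)[OF \<phi> e] val[OF _ e] by (auto simp: mem_foulkes[OF m] orbit_function_def)
    then have "\<phi> e = orbit_function m n e ?\<theta>" by auto
    moreover have "?\<theta> (pact k v) = ?\<theta> v" if k: "k \<in> wreath m n" and v: "v \<in> vecs ?S" for k v
    proof -
      have "\<phi> v (k \<circ> id, ?r) = \<phi> v (id, ?r)"
        using ghomD(1)[OF \<phi> v] k id unfolding mem_foulkes[OF m] by blast
      then show ?thesis using val[OF KG[OF k] v] by simp
    qed
    then have "invariant_functional lam (wreath m n) ?\<theta>"
      by (simp add: invariant_functional_def ghomD(2,3)[OF \<phi>] fscale_apply)
    ultimately show ?thesis by blast
  qed
  have 2: "\<exists>\<phi>. orbit_function m n e \<theta> = \<phi> e \<and> ghom ?G ?S ?M \<phi>"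
    if \<theta>: "invariant_functional lam (wreath m n) \<theta>" for \<theta>
  proof -
    have "ghom ?G ?S ?M (\<lambda>v. orbit_function m n v \<theta>)"
      unfolding ghom_def
    proof (intro conjI ballI allI)
      fix v assume v: "v \<in> vecs ?S"
      show "orbit_function m n v \<theta> \<in> vecs ?M"
        using invariant_functionalD(3)[OF \<theta>] KG pS[OF _ v]
        by (auto simp: mem_foulkes[OF m] orbit_function_def symgrp_comp pc)
      show "orbit_function m n (fscale c v) \<theta> = fscale c (orbit_function m n v \<theta>)" for c
        using invariant_functionalD(2)[OF \<theta> pS[OF _ v]]
        by (auto simp: fun_eq_iff orbit_function_def fscale_apply pact_scale)
      show "orbit_function m n (act ?S h v) \<theta> = act ?M h (orbit_function m n v \<theta>)" if h: "h \<in> ?G" for h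
        by (auto simp: fun_eq_iff orbit_function_def act_foulkes act_specht symgrp_comp_right_iff[OF h] pc[OF _ h])
      fix u assume u: "u \<in> vecs ?S"
      show "orbit_function m n (v + u) \<theta> = orbit_function m n v \<theta> + orbit_function m n u \<theta>"
        using invariant_functionalD(1)[OF \<theta> pS[OF _ v] pS[OF _ u]]
        by (auto simp: fun_eq_iff orbit_function_def pact_add)
    qed
    then show ?thesis by (intro exI[of _ "\<lambda>v. orbit_function m n v \<theta>"]) simp
  qed
  show ?thesis
  proof
    show "{\<phi> e |\<phi>. ghom ?G ?S ?M \<phi>} \<subseteq>
        {orbit_function m n e \<theta> |\<theta>. invariant_functional lam (wreath m n) \<theta>}"
      using 1 by blast
    show "{orbit_function m n e \<theta> |\<theta>. invariant_functional lam (wreath m n) \<theta>} \<subseteq>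
        {\<phi> e |\<phi>. ghom ?G ?S ?M \<phi>}"
      using 2 by blast
  qed
qed

text \<open>The translates of a polytabloid span the Specht module, so its orbit functions are a
  faithful copy of the invariant functionals, now inside a function space where bases are
  available.\<close>

lemma plethysm_coeff_basis:
  assumes m: "m > 0" and lam: "sorted_wrt (\<ge>) lam" "sum_list lam = m * n" and t: "tableau lam t"
  defines "E \<equiv> {orbit_function m n (polytabloid lam t) \<theta> |\<theta>. invariant_functional lam (wreath m n) \<theta>}"
  obtains B where "finite B" "cfun.independent B" "B \<subseteq> E" "E \<subseteq> cfun.span B"
    "card B = plethysm_coeff [n] m lam"
proof -
  have e: "polytabloid lam t \<in> vecs (specht lam)" using polytabloid_in_specht[OF t] .
  have e0: "polytabloid lam t \<noteq> 0" using polytabloid_tabloid_of[OF t] by auto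
  have S: "is_module (symgrp (m * n)) (specht lam)" "simple_module (symgrp (m * n)) (specht lam)"
    using is_module_specht[of lam] simple_module_specht[OF lam(1)] by (simp_all add: lam(2))
  have coeff: "plethysm_coeff [n] m lam = multiplicity_in (symgrp (m * n)) (specht lam) (foulkes [n] m)"
    by (simp add: plethysm_coeff_def)
  show ?thesis
  proof (rule multiplicity_in_basis[OF S is_module_foulkes[OF m] foulkes_decomposition_exists[OF m] e e0])
    show "\<exists>c. \<phi> (polytabloid lam t) = fscale c (polytabloid lam t)"
      if "ghom (symgrp (m * n)) (specht lam) (specht lam) \<phi>" for \<phi>
      using specht_endomorphism_scalar[OF lam(1) t] that by (simp add: lam(2))
  qed (unfold foulkes_hom_values[OF m lam(2) e] E_def[symmetric] coeff[symmetric], rule that)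
qed

section \<open>Adding a first row\<close>

definition cons_tabloid :: "nat set \<Rightarrow> tabloid \<Rightarrow> tabloid" where
  "cons_tabloid A T = (\<lambda>i. case i of 0 \<Rightarrow> A | Suc i' \<Rightarrow> T i')"

definition tail_tableau :: "(nat \<times> nat \<Rightarrow> nat) \<Rightarrow> nat \<times> nat \<Rightarrow> nat" where
  "tail_tableau s = (\<lambda>(i, j). s (Suc i, j))"

text \<open>The new row receives the entries from \<open>N\<close> on in their order. For
  \<open>N = m * n\<close> and a row of length \<open>a * m\<close> it is the union of the last
  \<open>a\<close> blocks, and entry \<open>N + j\<close> stands in column \<open>j\<close>.\<close>

definition cons_tableau :: "nat \<Rightarrow> (nat \<times> nat \<Rightarrow> nat) \<Rightarrow> nat \<times> nat \<Rightarrow> nat" where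
  "cons_tableau N t = (\<lambda>(i, j). case i of 0 \<Rightarrow> N + j | Suc i' \<Rightarrow> t (i', j))"

text \<open>In the language of highest weight vectors, this is the leading coefficient with respect to the
  new variable.\<close>

definition top_coeff :: "nat set \<Rightarrow> (tabloid \<Rightarrow> complex) \<Rightarrow> tabloid \<Rightarrow> complex" where
  "top_coeff A v = (\<lambda>T. v (cons_tabloid A T))"

lemma cons_tabloid_eq_iff: "cons_tabloid A T = cons_tabloid A' T' \<longleftrightarrow> A = A' \<and> T = T'"
proof
  assume eq: "cons_tabloid A T = cons_tabloid A' T'"
  have "A = A'" using fun_cong[OF eq, of 0] by (simp add: cons_tabloid_def)
  moreover have "T i = T' i" for i using fun_cong[OF eq, of "Suc i"] by (simp add: cons_tabloid_def)
  ultimately show "A = A' \<and> T = T'" by auto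
qed simp

lemma top_coeff_add: "top_coeff A (u + v) = top_coeff A u + top_coeff A v"
  and top_coeff_scale: "top_coeff A (fscale c v) = fscale c (top_coeff A v)"
  and top_coeff_zero: "top_coeff A 0 = 0"
  by (simp_all add: top_coeff_def fun_eq_iff fscale_apply)

lemma top_coeff_sum: "top_coeff A (\<Sum>i\<in>I. v i) = (\<Sum>i\<in>I. top_coeff A (v i))"
  by (simp add: top_coeff_def fun_eq_iff sum_fun_apply)

lemma zero_in_young_Cons: "(0, j) \<in> young (r # lam) \<longleftrightarrow> j < r"
  and Suc_in_young_Cons: "(Suc i, j) \<in> young (r # lam) \<longleftrightarrow> (i, j) \<in> young lam"
  by (simp_all add: young_def)

lemma tabloid_of_Cons:
  "tabloid_of (r # lam) s = cons_tabloid (tabloid_of (r # lam) s 0) (tabloid_of lam (tail_tableau s))"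
  by (auto simp: fun_eq_iff cons_tabloid_def tabloid_of_def tail_tableau_def Suc_in_young_Cons split: nat.split)

lemma tail_tableau_comp: "tail_tableau (\<sigma> \<circ> s) = \<sigma> \<circ> tail_tableau s"
  by (auto simp: tail_tableau_def)

context

  \<comment> \<open>Tableaux whose first row holds the largest entries\<close>
  fixes r :: nat and lam :: "nat list" and N :: nat and s :: "nat \<times> nat \<Rightarrow> nat"
  assumes N: "N = sum_list lam" and s: "tableau (r # lam) s"
    and top: "tabloid_of (r # lam) s 0 = {N..<r + N}"
begin

lemma tpos_top:
  assumes "N \<le> x" "x < r + N"
  shows "fst (tpos (r # lam) s x) = 0"
proof -
  have "x \<in> tabloid_of (r # lam) s 0" using assms by (simp add: top)
  then show ?thesis by (simp add: mem_tabloid_of[OF s])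
qed

lemma tableau_tail: "tableau lam (tail_tableau s)"
proof -
  have inj: "inj_on s (young (r # lam))" and img: "s ` young (r # lam) = {..<r + N}"
    using s by (auto simp: tableau_def bij_betw_def N)
  have "inj_on (tail_tableau s) (young lam)"
  proof (rule inj_onI)
    fix c d assume cd: "c \<in> young lam" "d \<in> young lam" "tail_tableau s c = tail_tableau s d"
    then have "(Suc (fst c), snd c) = (Suc (fst d), snd d)"
      by (intro inj_onD[OF inj]) (auto simp: tail_tableau_def Suc_in_young_Cons split: prod.splits)
    then show "c = d" by (simp add: prod_eq_iff)
  qed
  moreover have "tail_tableau s ` young lam \<subseteq> {..<N}"
  proof
    fix x assume "x \<in> tail_tableau s ` young lam"
    then obtain i j where ij: "(i, j) \<in> young lam" "x = s (Suc i, j)" by (auto simp: tail_tableau_def)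
    then have "(Suc i, j) \<in> young (r # lam)" by (simp add: Suc_in_young_Cons)
    then have "x < r + N" "fst (tpos (r # lam) s x) = Suc i"
      using tableau_apply_less[OF s] tpos_apply[OF s] ij(2) by (auto simp: N)
    then show "x \<in> {..<N}" using tpos_top[of x] by (cases "N \<le> x") auto
  qed
  ultimately have "tail_tableau s ` young lam = {..<N}"
    by (intro card_subset_eq) (auto simp: card_image card_young N)
  then show ?thesis using \<open>inj_on (tail_tableau s) (young lam)\<close> by (simp add: tableau_def bij_betw_def N)
qed

lemma tpos_tail:
  assumes "x < N"
  shows "tpos (r # lam) s x = (Suc (fst (tpos lam (tail_tableau s) x)), snd (tpos lam (tail_tableau s) x))"
proof -
  let ?c = "tpos lam (tail_tableau s) x"
  have c: "?c \<in> young lam" "tail_tableau s ?c = x"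
    using tpos_in_young[OF tableau_tail] apply_tpos[OF tableau_tail] assms by (simp_all add: N)
  then have "(Suc (fst ?c), snd ?c) \<in> young (r # lam)" "s (Suc (fst ?c), snd ?c) = x"
    by (auto simp: Suc_in_young_Cons tail_tableau_def split: prod.splits)
  then show ?thesis using tpos_apply[OF s] by metis
qed

text \<open>The first row has one entry in each of its columns, so a column permutation that
  preserves it as a set fixes it pointwise and only moves the entries of the remaining rows.\<close>

lemma column_stabilizer_tail:
  "{\<pi> \<in> column_stabilizer (r # lam) s. \<pi> ` {N..<r + N} = {N..<r + N}} =
    column_stabilizer lam (tail_tableau s)"
proof (intro set_eqI iffI)
  fix \<pi> assume "\<pi> \<in> {\<pi> \<in> column_stabilizer (r # lam) s. \<pi> ` {N..<r + N} = {N..<r + N}}"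
  then have p: "\<pi> permutes {..<r + N}" and col: "\<And>x. x < r + N \<Longrightarrow> snd (tpos (r # lam) s (\<pi> x)) = snd (tpos (r # lam) s x)"
    and B: "\<pi> ` {N..<r + N} = {N..<r + N}"
    by (auto simp: mem_column_stabilizer[OF s] N)
  have "\<pi> x = x" if "x \<in> {N..<r + N}" for x
  proof -
    have "\<pi> x \<in> {N..<r + N}" using B that by blast
    then have "tpos (r # lam) s (\<pi> x) = tpos (r # lam) s x"
      using tpos_top[of x] tpos_top[of "\<pi> x"] col[of x] that by (simp add: prod_eq_iff)
    then show ?thesis using tpos_eqI[OF s] that \<open>\<pi> x \<in> {N..<r + N}\<close> by (simp add: N)
  qed
  then have p': "\<pi> permutes {..<N}" by (intro permutes_superset[OF p]) auto
  have "snd (tpos lam (tail_tableau s) (\<pi> x)) = snd (tpos lam (tail_tableau s) x)" if "x < N" for x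
    using col[of x] that permutes_less_iff[OF p', of x] by (simp add: tpos_tail)
  then show "\<pi> \<in> column_stabilizer lam (tail_tableau s)"
    using p' by (simp add: mem_column_stabilizer[OF tableau_tail] N)
next
  fix \<pi> assume "\<pi> \<in> column_stabilizer lam (tail_tableau s)"
  then have p: "\<pi> permutes {..<N}"
    and col: "\<And>x. x < N \<Longrightarrow> snd (tpos lam (tail_tableau s) (\<pi> x)) = snd (tpos lam (tail_tableau s) x)"
    by (auto simp: mem_column_stabilizer[OF tableau_tail] N)
  have fixN: "\<pi> x = x" if "N \<le> x" for x using permutes_not_in[OF p, of x] that by simp
  have "\<pi> permutes {..<r + N}" by (rule permutes_subset[OF p]) auto
  moreover have "snd (tpos (r # lam) s (\<pi> x)) = snd (tpos (r # lam) s x)" for x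
    using col[of x] permutes_less_iff[OF p, of x] fixN[of x] by (cases "x < N") (simp_all add: tpos_tail)
  moreover have "\<pi> ` {N..<r + N} = {N..<r + N}" using fixN by (auto simp: image_iff)
  ultimately show "\<pi> \<in> {\<pi> \<in> column_stabilizer (r # lam) s. \<pi> ` {N..<r + N} = {N..<r + N}}"
    by (simp add: mem_column_stabilizer[OF s] N)
qed

text \<open>The terms with the prescribed first row come from the column permutations preserving it,
  that is, from the column stabilizer of the remaining tableau.\<close>

lemma top_coeff_polytabloid_top:
  "top_coeff {N..<r + N} (polytabloid (r # lam) s) = polytabloid lam (tail_tableau s)"
proof
  fix T
  let ?B = "{N..<r + N}"
  have eq: "cons_tabloid ?B T = tabloid_of (r # lam) (\<pi> \<circ> s) \<longleftrightarrow>
      \<pi> ` ?B = ?B \<and> T = tabloid_of lam (\<pi> \<circ> tail_tableau s)" for \<pi>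
    by (subst tabloid_of_Cons)
      (auto simp: cons_tabloid_eq_iff tail_tableau_comp tabloid_of_comp[of "r # lam"] top)
  have "top_coeff ?B (polytabloid (r # lam) s) T = (\<Sum>\<pi>\<in>column_stabilizer (r # lam) s.
      if \<pi> ` ?B = ?B then if T = tabloid_of lam (\<pi> \<circ> tail_tableau s) then of_int (sign \<pi>) else 0 else 0)"
    unfolding top_coeff_def polytabloid_def eq by (intro sum.cong) auto
  also have "\<dots> = (\<Sum>\<pi>\<in>{\<pi> \<in> column_stabilizer (r # lam) s. \<pi> ` ?B = ?B}.
      if T = tabloid_of lam (\<pi> \<circ> tail_tableau s) then of_int (sign \<pi>) else 0)"
    by (rule sum.inter_filter[symmetric]) simp
  also have "\<dots> = polytabloid lam (tail_tableau s) T"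
    unfolding column_stabilizer_tail polytabloid_def ..
  finally show "top_coeff ?B (polytabloid (r # lam) s) T = polytabloid lam (tail_tableau s) T" .
qed

end

lemma top_coeff_nonzeroD:
  assumes "top_coeff A (polytabloid (r # lam) s) \<noteq> 0"
  obtains \<pi> where "\<pi> \<in> column_stabilizer (r # lam) s" "\<pi> ` tabloid_of (r # lam) s 0 = A"
proof -
  obtain T where T: "polytabloid (r # lam) s (cons_tabloid A T) \<noteq> 0"
    using assms by (auto simp: top_coeff_def fun_eq_iff)
  have "\<exists>\<pi>\<in>column_stabilizer (r # lam) s. cons_tabloid A T = tabloid_of (r # lam) (\<pi> \<circ> s)"
  proof (rule ccontr)
    assume "\<not> ?thesis"
    then have "polytabloid (r # lam) s (cons_tabloid A T) = 0"
      unfolding polytabloid_def by (intro sum.neutral) simp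
    then show False using T by simp
  qed
  then obtain \<pi> where \<pi>: "\<pi> \<in> column_stabilizer (r # lam) s"
    "cons_tabloid A T = tabloid_of (r # lam) (\<pi> \<circ> s)"
    by (rule bexE)
  have "\<pi> ` tabloid_of (r # lam) s 0 = tabloid_of (r # lam) (\<pi> \<circ> s) 0" by (simp add: tabloid_of_comp)
  also have "\<dots> = A" by (simp add: \<pi>(2)[symmetric] cons_tabloid_def)
  finally show ?thesis using that \<pi>(1) by blast
qed

text \<open>A polytabloid not sent to zero has a column permutation moving its first row onto the
  largest entries; up to a sign, its tableau may be taken to have that first row already.\<close>

lemma top_coeff_in_specht:
  assumes v: "v \<in> vecs (specht (r # lam))"
  shows "top_coeff {sum_list lam..<r + sum_list lam} v \<in> vecs (specht lam)"
proof -
  let ?L = "top_coeff {sum_list lam..<r + sum_list lam}"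
  have "vecs (specht (r # lam)) \<subseteq> {v. ?L v \<in> vecs (specht lam)}"
  proof (rule specht_minimal)
    show "cfun.subspace {v. ?L v \<in> vecs (specht lam)}"
      using subspace_specht[of lam]
      by (simp add: cfun.subspace_def top_coeff_add top_coeff_scale top_coeff_zero)
    fix s assume s: "tableau (r # lam) s"
    have "?L (polytabloid (r # lam) s) \<in> vecs (specht lam)"
    proof (cases "?L (polytabloid (r # lam) s) = 0")
      case True
      then show ?thesis using cfun.subspace_0[OF subspace_specht[of lam]] by (simp only:)
    next
      case False
      then obtain \<pi> where \<pi>: "\<pi> \<in> column_stabilizer (r # lam) s"
        "\<pi> ` tabloid_of (r # lam) s 0 = {sum_list lam..<r + sum_list lam}"
        by (rule top_coeff_nonzeroD)
      let ?c = "of_int (sign \<pi>) :: complex"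
      \<comment> \<open>A sign is its own inverse, which allows the relation between the two
        polytabloids to be solved for the one of \<open>s\<close>.\<close>
      have "sign \<pi> * sign \<pi> = 1" by simp
      then have c: "?c * ?c = 1" by (simp only: of_int_mult[symmetric] of_int_1)
      have s': "tableau (r # lam) (\<pi> \<circ> s)"
        by (rule tableau_comp[OF s column_stabilizer_permutes[OF \<pi>(1)]])
      have top: "tabloid_of (r # lam) (\<pi> \<circ> s) 0 = {sum_list lam..<r + sum_list lam}"
        using \<pi>(2) by (simp add: tabloid_of_comp)
      have "polytabloid (r # lam) s = fscale ?c (polytabloid (r # lam) (\<pi> \<circ> s))"
        by (simp only: polytabloid_column_stabilizer[OF s \<pi>(1)] cfun.scale_scale c cfun.scale_one)
      then have "?L (polytabloid (r # lam) s) = fscale ?c (polytabloid lam (tail_tableau (\<pi> \<circ> s)))"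
        by (simp only: top_coeff_scale top_coeff_polytabloid_top[OF refl s' top])
      then show ?thesis
        using cfun.subspace_scale[OF subspace_specht polytabloid_in_specht[OF tableau_tail[OF refl s' top]]]
        by (simp only:)
    qed
    then show "polytabloid (r # lam) s \<in> {v. ?L v \<in> vecs (specht lam)}" by simp
  qed
  then show ?thesis using v by blast
qed

lemma tail_cons_tableau: "tail_tableau (cons_tableau N t) = t"
  by (auto simp: tail_tableau_def cons_tableau_def)

lemma tabloid_of_cons_tableau: "tabloid_of (r # lam) (cons_tableau N t) 0 = {N..<r + N}"
proof -
  have "x \<in> tabloid_of (r # lam) (cons_tableau N t) 0 \<longleftrightarrow> x \<in> {N..<r + N}" for x
    by (auto simp: tabloid_of_def cons_tableau_def zero_in_young_Cons intro!: exI[of _ "x - N"])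
  then show ?thesis by blast
qed

lemma tableau_cons:
  assumes t: "tableau lam t" and N: "N = sum_list lam"
  shows "tableau (r # lam) (cons_tableau N t)"
proof -
  let ?s = "cons_tableau N t"
  have tN: "t (i, j) < N" if "(i, j) \<in> young lam" for i j using tableau_apply_less[OF t that] N by simp
  have "inj_on ?s (young (r # lam))"
  proof (rule inj_onI)
    fix c d assume cd: "c \<in> young (r # lam)" "d \<in> young (r # lam)" "?s c = ?s d"
    obtain i j i' j' where c: "c = (i, j)" and d: "d = (i', j')" by fastforce
    have inj: "inj_on t (young lam)" using t by (simp add: tableau_def bij_betw_def)
    show "c = d"
    proof (cases i)
      case 0
      then show ?thesis using cd tN[of "i' - 1" j'] by (cases i') (auto simp: c d cons_tableau_def Suc_in_young_Cons)
    next
      case (Suc k)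
      then have k: "(k, j) \<in> young lam" using cd(1) by (simp add: c Suc_in_young_Cons)
      show ?thesis
      proof (cases i')
        case 0
        then show ?thesis using cd(3) tN[OF k] Suc by (simp add: c d cons_tableau_def)
      next
        case (Suc k')
        then have "(k', j') \<in> young lam" using cd(2) by (simp add: d Suc_in_young_Cons)
        then have "(k, j) = (k', j')"
          using inj_onD[OF inj _ k] cd(3) \<open>i = Suc k\<close> Suc by (simp add: c d cons_tableau_def)
        then show ?thesis using \<open>i = Suc k\<close> Suc by (simp add: c d)
      qed
    qed
  qed
  moreover have "?s ` young (r # lam) \<subseteq> {..<r + N}"
  proof
    fix x assume "x \<in> ?s ` young (r # lam)"
    then obtain i j where ij: "(i, j) \<in> young (r # lam)" "x = ?s (i, j)" by auto
    then show "x \<in> {..<r + N}"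
      using tN[of "i - 1" j] by (cases i) (auto simp: cons_tableau_def zero_in_young_Cons Suc_in_young_Cons)
  qed
  ultimately have "?s ` young (r # lam) = {..<r + N}"
    by (intro card_subset_eq) (auto simp: card_image card_young N)
  then show ?thesis using \<open>inj_on ?s (young (r # lam))\<close> by (simp add: tableau_def bij_betw_def N)
qed

section \<open>Exchange of blocks\<close>

lemma matching_involution:
  assumes "finite A" "inj_on f A" "f ` A \<inter> A = {}"
  shows "\<exists>\<tau>. \<tau> permutes (A \<union> f ` A) \<and> (\<forall>x\<in>A. \<tau> x = f x \<and> \<tau> (f x) = x) \<and> sign \<tau> = (-1) ^ card A"
  using assms
proof (induction A rule: finite_induct)
  case empty
  show ?case by (intro exI[of _ id]) (simp add: id_def)
next
  case (insert x A)
  have "inj_on f A" "f ` A \<inter> A = {}" using insert.prems by auto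
  from insert.IH[OF this] obtain \<tau> where \<tau>: "\<tau> permutes (A \<union> f ` A)"
    "\<forall>x\<in>A. \<tau> x = f x \<and> \<tau> (f x) = x" "sign \<tau> = (-1) ^ card A"
    by (elim exE conjE)
  \<comment> \<open>The involution is a product of swaps of \<open>x\<close> and \<open>f x\<close>.
    They are disjoint because \<open>f\<close> is injective and its image misses the domain, so each
    element contributes one factor -1.\<close>
  let ?\<rho> = "transpose x (f x)"
  have out: "x \<notin> A \<union> f ` A" "f x \<notin> A \<union> f ` A" "f x \<noteq> x"
    using insert.prems insert.hyps by auto
  have fixed: "\<tau> x = x" "\<tau> (f x) = f x" using permutes_not_in[OF \<tau>(1)] out by auto
  have "?\<rho> \<circ> \<tau> permutes (insert x A \<union> f ` insert x A)"
    by (intro permutes_compose permutes_subset[OF \<tau>(1)] permutes_swap_id) auto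
  moreover have "(?\<rho> \<circ> \<tau>) y = f y \<and> (?\<rho> \<circ> \<tau>) (f y) = y" if "y \<in> insert x A" for y
  proof (cases "y = x")
    case True
    then show ?thesis by (simp add: fixed)
  next
    case False
    then have "y \<in> A" using that by simp
    then have fy: "f y \<in> f ` A" by (rule imageI)
    have "y \<noteq> x" "y \<noteq> f x" using \<open>y \<in> A\<close> out by auto
    moreover have "f y \<noteq> x" "f y \<noteq> f x" using fy out by (metis UnI2)+
    ultimately show ?thesis using \<tau>(2) \<open>y \<in> A\<close> by (simp add: transpose_apply_other)
  qed
  moreover have "sign (?\<rho> \<circ> \<tau>) = (-1) ^ card (insert x A)"
  proof -
    have "finite (A \<union> f ` A)" using insert.hyps by simp
    then have "permutation \<tau>" using \<tau>(1) by (metis permutes_imp_permutation)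
    then show ?thesis
      using insert.hyps out(3) \<tau>(3) by (simp add: sign_compose permutation_swap_id sign_swap_id)
  qed
  ultimately show ?case by blast
qed

lemma wreath_comp:
  assumes "k \<in> wreath m n" "l \<in> wreath m n"
  shows "k \<circ> l \<in> wreath m n"
proof -
  note p = wreath_permutes[OF assms(1)] wreath_permutes[OF assms(2)]
  have "x div m = y div m \<longleftrightarrow> (k \<circ> l) x div m = (k \<circ> l) y div m" if "x < m * n" "y < m * n" for x y
    using that wreath_same_block[OF assms(1), of "l x" "l y"] wreath_same_block[OF assms(2)]
      permutes_less_iff[OF p(2)] by simp
  then show ?thesis using permutes_compose[OF p(2) p(1)] by (simp add: wreath_def symgrp_def)
qed

lemma wreath_inv:
  assumes "k \<in> wreath m n"
  shows "inv k \<in> wreath m n"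
proof -
  note p = wreath_permutes[OF assms]
  have "x div m = y div m \<longleftrightarrow> inv k x div m = inv k y div m" if "x < m * n" "y < m * n" for x y
    using that wreath_same_block[OF assms, of "inv k x" "inv k y"] permutes_less_iff[OF permutes_inv[OF p]]
    by (simp add: permutes_inverses[OF p])
  then show ?thesis using permutes_inv[OF p] by (simp add: wreath_def symgrp_def)
qed

lemma id_in_wreath: "id \<in> wreath m n"
  by (simp add: wreath_def symgrp_def permutes_id)

lemma finite_wreath [simp]: "finite (wreath m n)"
  by (rule finite_subset[of _ "symgrp (m * n)"]) (auto simp: wreath_def)

lemma block_eq:
  fixes m u :: nat
  assumes "m > 0"
  shows "{x. x div m = u} = {u * m..<u * m + m}"
proof -
  have "x div m = u \<longleftrightarrow> u * m \<le> x \<and> x < Suc u * m" for x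
    unfolding less_eq_div_iff_mult_less_eq[OF assms, symmetric] div_less_iff_less_mult[OF assms, symmetric]
    by auto
  moreover have "Suc u * m = u * m + m" by simp
  ultimately show ?thesis by (simp only: set_eq_iff mem_Collect_eq atLeastLessThan_iff simp_thms)
qed

text \<open>The union of blocks \<open>C\<close> meets every column at most once, so at most \<open>hd lam < 2 * m\<close> of its
  elements lie below the first row. Hence \<open>C\<close> is the first row with at most one block exchanged, and
  interchanging the two blocks along the columns has sign \<open>(-1) ^ m = 1\<close>.\<close>

lemma exchange_block_with_top:
  fixes m n a :: nat and lam :: "nat list"
  assumes m: "m > 0" "even m" and a: "a \<ge> 2" and lam: "sorted_wrt (\<ge>) lam" "sum_list lam = m * n"
    and hd: "hd lam < 2 * m" and t: "tableau lam t"
  defines "tt \<equiv> cons_tableau (m * n) t" and "B \<equiv> {m * n..<a * m + m * n}"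
  assumes C: "C \<subseteq> {..<m * (n + a)}" "card C = card B"
    and col: "inj_on (\<lambda>x. snd (tpos (a * m # lam) tt x)) C"
    and blocks: "\<And>x y. x \<in> C \<Longrightarrow> y < m * (n + a) \<Longrightarrow> x div m = y div m \<Longrightarrow> y \<in> C"
  shows "\<exists>\<tau>\<in>wreath m (n + a). \<tau> \<in> column_stabilizer (a * m # lam) tt \<and> sign \<tau> = 1 \<and>
    \<tau> ` B = C \<and> \<tau> \<circ> \<tau> = id"
proof -
  let ?N = "m * n" and ?N' = "m * (n + a)" and ?lam' = "a * m # lam"
  define col where "col x = snd (tpos ?lam' tt x)" for x
  have N': "?N' = a * m + ?N" "sum_list ?lam' = ?N'" by (simp_all add: lam(2) algebra_simps)
  have tt: "tableau ?lam' tt" unfolding tt_def by (rule tableau_cons[OF t]) (simp add: lam(2))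
  have top: "tabloid_of ?lam' tt 0 = {?N..<a * m + ?N}"
    unfolding tt_def by (rule tabloid_of_cons_tableau)
  note tail = tpos_tail[OF lam(2)[symmetric] tt top]
  have tail_tt: "tail_tableau tt = t" by (simp add: tt_def tail_cons_tableau)
  have col_top: "col (?N + j) = j" if "j < a * m" for j
    using tpos_apply[OF tt, of "(0, j)"] that by (simp add: col_def tt_def cons_tableau_def zero_in_young_Cons)
  have col_old: "col x < hd lam" if "x < ?N" for x
  proof -
    obtain i j where ij: "tpos lam t x = (i, j)" by fastforce
    then have "(i, j) \<in> young lam" using tpos_in_young[OF t, of x] that by (simp add: lam(2))
    then have "i < length lam" "j < lam ! i" by (auto simp: young_def)
    moreover have "lam ! i \<le> lam ! 0"
      using lam(1) \<open>i < length lam\<close> unfolding sorted_wrt_iff_nth_less by (cases "i = 0") auto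
    moreover have "hd lam = lam ! 0" using \<open>i < length lam\<close> by (intro hd_conv_nth) auto
    ultimately show ?thesis using tail[OF that] by (simp add: col_def tail_tt ij)
  qed
  have two_m: "2 * m \<le> a * m" using a by simp
  have col_C: "x = y" if "x \<in> C" "y \<in> C" "col x = col y" for x y
    using inj_onD[OF col] that by (simp add: col_def)
  \<comment> \<open>\<open>P\<close> is the part of \<open>C\<close> below the first row. Its
    elements lie in distinct columns with numbers below \<open>hd lam\<close>, so there are fewer
    than \<open>2 * m\<close> of them.\<close>
  define P where "P = {x \<in> C. x < ?N}"
  have finC: "finite C" using C(1) finite_subset by blast
  then have finP: "finite P" by (simp add: P_def)
  have PC: "P = C - B" using C(1) N'(1) by (auto simp: P_def B_def)
  have "inj_on col P" using col_C by (auto simp: inj_on_def P_def)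
  moreover have "col ` P \<subseteq> {..<hd lam}" using col_old by (auto simp: P_def)
  ultimately have cardP: "card P < 2 * m"
    using card_inj_on_le[of col P "{..<hd lam}"] hd by simp
  show ?thesis
  proof (cases "P = {}")
    case True
    then have "C = B" using PC C(2) by (intro card_subset_eq) (auto simp: B_def)
    then show ?thesis using id_in_wreath id_column_stabilizer[OF tt] by (intro bexI[of _ id]) auto
  next
    case False
    \<comment> \<open>The entries below the first row are those less than \<open>m * n\<close>, a
      multiple of \<open>m\<close>, so no block straddles the boundary.\<close>
    have block_old: "{y. y div m = x div m} \<subseteq> P" if "x \<in> P" for x
    proof
      fix y assume "y \<in> {y. y div m = x div m}"
      moreover have "x div m < n" using that by (simp add: P_def less_mult_imp_div_less mult.commute)
      ultimately have y: "y div m = x div m" "y div m < n" by auto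
      then have "y < ?N" using div_less_iff_less_mult[OF m(1), of y n] by (simp only: mult.commute)
      moreover from this have "y < ?N'" by (simp add: N'(1))
      ultimately show "y \<in> P" using blocks[of x y] that y(1) by (simp add: P_def)
    qed
    obtain x0 where x0: "x0 \<in> P" using False by blast
    define u where "u = x0 div m"
    have card_block: "card {x. x div m = v} = m" for v
      using block_eq[OF m(1), of v] by simp
    have fin_block: "finite {x. x div m = v}" for v
      using block_eq[OF m(1), of v] by simp
    \<comment> \<open>A second block meeting \<open>P\<close> would lie in \<open>P\<close> too and
      bring it to \<open>2 * m\<close> elements.\<close>
    have Pu: "P = {x. x div m = u}"
    proof (rule ccontr)
      assume "P \<noteq> {x. x div m = u}"
      then obtain x1 where x1: "x1 \<in> P" "x1 div m \<noteq> u" using block_old[OF x0] by (auto simp: u_def)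
      have "card ({x. x div m = u} \<union> {x. x div m = x1 div m}) = m + m"
        using x1(2) by (subst card_Un_disjoint) (auto simp: card_block fin_block)
      moreover have "card ({x. x div m = u} \<union> {x. x div m = x1 div m}) \<le> card P"
        using block_old[OF x0] block_old[OF x1(1)] by (intro card_mono finP) (auto simp: u_def)
      ultimately show False using cardP by simp
    qed
    then have cP: "card P = m" by (simp add: card_block)
    \<comment> \<open>\<open>f x\<close> is the entry of the first row in the column of
      \<open>x\<close>. It exists because \<open>hd lam < 2 * m \<le> a * m\<close>, and it is not
      in \<open>C\<close>, which already has \<open>x\<close> in that column.\<close>
    define f where "f x = ?N + col x" for x
    have fB: "f x \<in> B" "col (f x) = col x" if "x \<in> P" for x
    proof -
      have "x < ?N" using that by (simp add: P_def)
      then have "col x < a * m" using col_old[of x] hd two_m by linarith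
      then show "f x \<in> B" "col (f x) = col x" using col_top by (simp_all add: f_def B_def)
    qed
    have fC: "f x \<notin> C" if "x \<in> P" for x
      using col_C[of "f x" x] fB(2)[OF that] that by (auto simp: P_def f_def)
    have injf: "inj_on f P" using \<open>inj_on col P\<close> by (simp add: inj_on_def f_def)
    have finB: "finite B" by (simp add: B_def)
    have "card (B - C) = card (C - B)"
      using C(2) card_Diff_subset_Int[of B C] card_Diff_subset_Int[of C B] finB finC
      by (simp add: Int_commute)
    then have "card (f ` P) = card (B - C)" using card_image[OF injf] PC by metis
    then have F: "f ` P = B - C"
      using fB(1) fC finB by (intro card_subset_eq) auto
    define w where "w = f x0 div m"
    have "f x0 \<in> B - C" using F x0 by blast
    have block_n: "n \<le> y div m \<longleftrightarrow> ?N \<le> y" "y div m < n + a \<longleftrightarrow> y < ?N'" for y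
      unfolding less_eq_div_iff_mult_less_eq[OF m(1)] div_less_iff_less_mult[OF m(1)]
      by (simp_all only: mult.commute)
    have wn: "n \<le> w" "w < n + a"
      using fB(1)[OF x0] unfolding w_def block_n N'(1) by (simp_all add: B_def)
    \<comment> \<open>\<open>C\<close> is a union of blocks, so the block of one element of
      \<open>B - C\<close> avoids \<open>C\<close> altogether; with \<open>m\<close> elements it
      exhausts \<open>B - C\<close>, the image of \<open>f\<close>.\<close>
    have "{y. y div m = w} \<subseteq> B - C"
    proof
      fix y assume "y \<in> {y. y div m = w}"
      then have y: "y div m = w" by simp
      then have "?N \<le> y" "y < ?N'" using wn unfolding block_n[symmetric] by simp_all
      moreover have "y \<notin> C"
        using blocks[of y "f x0"] \<open>f x0 \<in> B - C\<close> y wn(2) unfolding w_def block_n by blast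
      ultimately show "y \<in> B - C" by (simp add: B_def N'(1))
    qed
    moreover have "card (B - C) = m" using card_image[OF injf] cP F by simp
    ultimately have "{y. y div m = w} = B - C"
      using finB card_block[of w] by (intro card_subset_eq) auto
    then have Fw: "f ` P = {y. y div m = w}" using F by simp
    have "f ` P \<inter> P = {}" using F PC by auto
    from matching_involution[OF finP injf this] obtain \<tau> where \<tau>: "\<tau> permutes (P \<union> f ` P)"
      "\<forall>x\<in>P. \<tau> x = f x \<and> \<tau> (f x) = x" "sign \<tau> = (-1) ^ card P"
      by (elim exE conjE)
    have "P \<union> f ` P \<subseteq> {..<?N'}" using C(1) F N'(1) by (auto simp: P_def B_def)
    then have p: "\<tau> permutes {..<?N'}" by (rule permutes_subset[OF \<tau>(1)])
    have \<tau>0: "\<tau> x = x" if "x \<notin> P" "x \<notin> f ` P" for x using permutes_not_in[OF \<tau>(1)] that by blast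
    have cases: "x \<in> P \<or> (\<exists>z\<in>P. x = f z) \<or> (x \<notin> P \<and> x \<notin> f ` P)" for x by blast
    have \<tau>\<tau>: "\<tau> (\<tau> x) = x" for x using cases[of x] \<tau>(2) \<tau>0 by auto
    have col\<tau>: "col (\<tau> x) = col x" for x using cases[of x] \<tau>(2) \<tau>0 fB(2) by auto
    have uw: "u \<noteq> w" using x0 wn(1) less_mult_imp_div_less[of x0 n m]
      by (auto simp: P_def u_def mult.commute)
    \<comment> \<open>The involution interchanges the blocks \<open>u\<close> and \<open>w\<close>
      as wholes and fixes all other points; this puts it into the wreath product.\<close>
    have block\<tau>: "\<tau> x div m = (if x div m = u then w else if x div m = w then u else x div m)" for x
    proof -
      have inP: "x \<in> P \<longleftrightarrow> x div m = u" for x using Pu by blast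
      have inF: "x \<in> f ` P \<longleftrightarrow> x div m = w" for x using Fw by blast
      consider "x \<in> P" | z where "z \<in> P" "x = f z" | "x \<notin> P" "x \<notin> f ` P" using cases[of x] by blast
      then show ?thesis
      proof cases
        case 1
        then have "\<tau> x \<in> f ` P" using \<tau>(2) by simp
        then show ?thesis using 1 inP inF by simp
      next
        case 2
        then have "\<tau> x = z" "x \<in> f ` P" using \<tau>(2) by simp_all
        then show ?thesis using 2(1) inP inF uw by auto
      next
        case 3
        then show ?thesis using \<tau>0 inP inF by simp
      qed
    qed
    have "\<tau> \<in> wreath m (n + a)"
      using p uw by (auto simp: wreath_def symgrp_def block\<tau>)
    moreover have "\<tau> \<in> column_stabilizer ?lam' tt"
      using p col\<tau> unfolding mem_column_stabilizer[OF tt] N'(2) by (simp add: col_def)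
    moreover have "sign \<tau> = 1" using \<tau>(3) cP m(2) by simp
    moreover have "\<tau> ` B = C"
    proof -
      have "B = (B \<inter> C) \<union> f ` P" using F by blast
      then have "\<tau> ` B = \<tau> ` (B \<inter> C) \<union> \<tau> ` f ` P" by (metis image_Un)
      also have "\<tau> ` f ` P = P" using \<tau>(2) by (force simp: image_image)
      also have "\<tau> ` (B \<inter> C) = B \<inter> C"
        using \<tau>0 F PC by (intro image_cong[THEN trans, OF refl _ image_ident]) auto
      also have "B \<inter> C \<union> P = C" using PC by blast
      finally show ?thesis .
    qed
    moreover have "\<tau> \<circ> \<tau> = id" using \<tau>\<tau> by (simp add: fun_eq_iff)
    ultimately show ?thesis by blast
  qed
qed

text \<open>A permutation preserving the set of the last entries also preserves the rest, where it
  still respects blocks.\<close>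

lemma wreath_restrict:
  assumes k: "k \<in> wreath m (n + a)" and B: "k ` {m * n..<a * m + m * n} = {m * n..<a * m + m * n}"
  shows "(\<lambda>x. if x < m * n then k x else x) \<in> wreath m n"
proof -
  let ?k = "\<lambda>x. if x < m * n then k x else x"
  have N': "m * (n + a) = a * m + m * n" by (simp add: algebra_simps)
  have p: "k permutes {..<a * m + m * n}" using wreath_permutes[OF k] by (simp only: N')
  have less: "k x < m * n" if "x < m * n" for x
  proof (rule ccontr)
    assume "\<not> k x < m * n"
    moreover have "k x < a * m + m * n" using that permutes_less_iff[OF p, of x] by simp
    ultimately have "k x \<in> k ` {m * n..<a * m + m * n}" unfolding B by simp
    then have "x \<in> {m * n..<a * m + m * n}" using permutes_inj[OF p] by (simp add: inj_image_mem_iff)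
    then show False using that by simp
  qed
  have inj: "inj_on ?k {..<m * n}" using permutes_inj[OF p] by (auto simp: inj_on_def)
  have sub: "?k ` {..<m * n} \<subseteq> {..<m * n}" using less by auto
  have "bij_betw ?k {..<m * n} {..<m * n}"
    by (rule bij_betw_imageI[OF inj endo_inj_surj[OF finite_lessThan sub inj]])
  then have "?k permutes {..<m * n}" by (rule bij_imp_permutes) simp
  moreover have "x div m = y div m \<longleftrightarrow> ?k x div m = ?k y div m" if "x < m * n" "y < m * n" for x y
    using wreath_same_block[OF k, of x y] that by (simp add: N')
  ultimately show ?thesis by (simp add: wreath_def symgrp_def)
qed

section \<open>Lifting invariant functionals\<close>

context
  fixes m n a :: nat and lam :: "nat list"
  assumes m: "m > 0" "even m" and a: "a \<ge> 2"
    and lam: "sorted_wrt (\<ge>) lam" "sum_list lam = m * n" and hd: "hd lam < 2 * m"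
begin

abbreviation (input) "top_part \<equiv> top_coeff {m * n..<a * m + m * n}"

lemma sum_list_Cons_eq: "sum_list (a * m # lam) = m * (n + a)"
  by (simp add: lam(2) algebra_simps)

lemma tableau_cons_mn: "tableau lam t \<Longrightarrow> tableau (a * m # lam) (cons_tableau (m * n) t)"
  by (rule tableau_cons) (simp_all add: lam(2))

text \<open>The preimage of the first row under \<open>k\<close> satisfies the hypotheses on
  \<open>C\<close> in \<open>exchange_block_with_top\<close>. The exchange \<open>\<tau>\<close>
  found there fixes the polytabloid, so \<open>k\<close> may be replaced by
  \<open>k \<circ> \<tau>\<close>, which preserves the first row and restricts to the first
  \<open>n\<close> blocks.\<close>

lemma top_coeff_wreath_translate:
  assumes t: "tableau lam t" and k: "k \<in> wreath m (n + a)"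
    and nz: "top_part (polytabloid (a * m # lam) (k \<circ> cons_tableau (m * n) t)) \<noteq> 0"
  obtains l where "l \<in> wreath m n"
    "top_part (polytabloid (a * m # lam) (k \<circ> cons_tableau (m * n) t)) = pact l (polytabloid lam t)"
proof -
  let ?lam' = "a * m # lam" and ?tt = "cons_tableau (m * n) t"
  define B where "B = {m * n..<a * m + m * n}"
  have N': "sum_list ?lam' = m * (n + a)" by (rule sum_list_Cons_eq)
  have tt: "tableau ?lam' ?tt" by (rule tableau_cons_mn[OF t])
  have row: "tabloid_of ?lam' ?tt 0 = B" unfolding B_def by (rule tabloid_of_cons_tableau)
  note pk = wreath_permutes[OF k]
  have pk': "k permutes {..<sum_list ?lam'}" using pk by (simp only: N')
  obtain \<pi> where \<pi>: "\<pi> \<in> column_stabilizer ?lam' (k \<circ> ?tt)" "\<pi> ` tabloid_of ?lam' (k \<circ> ?tt) 0 = B"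
    using top_coeff_nonzeroD[OF nz] unfolding B_def .
  \<comment> \<open>Conjugated back by \<open>k\<close>, the column permutation \<open>\<pi>\<close>
    becomes one of the original tableau. It carries \<open>B\<close> to \<open>C\<close>, whence
    \<open>C\<close> has at most one element in each column.\<close>
  define \<rho> where "\<rho> = inv k \<circ> \<pi> \<circ> k"
  define C where "C = inv k ` B"
  have "inv k \<circ> \<pi> \<circ> inv (inv k) \<in> column_stabilizer ?lam' (inv k \<circ> (k \<circ> ?tt))"
    by (rule conj_column_stabilizer[OF tableau_comp[OF tt pk'] permutes_inv[OF pk'] \<pi>(1)])
  then have \<rho>: "\<rho> \<in> column_stabilizer ?lam' ?tt"
    by (simp add: \<rho>_def permutes_inv_inv[OF pk] o_assoc permutes_inv_o[OF pk])
  have "\<pi> ` k ` B = B" using \<pi>(2) by (simp add: tabloid_of_comp row)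
  then have \<rho>B: "\<rho> ` B = C" unfolding \<rho>_def C_def image_comp[symmetric] by simp
  have C_iff: "x \<in> C \<longleftrightarrow> k x \<in> B" for x
    unfolding C_def using permutes_inverses[OF pk] by (metis (no_types, lifting) image_iff)
  have B_N': "x \<in> B \<longleftrightarrow> m * n \<le> x \<and> x < m * (n + a)" for x by (auto simp: B_def algebra_simps)
  have "\<exists>\<tau>\<in>wreath m (n + a). \<tau> \<in> column_stabilizer ?lam' ?tt \<and> sign \<tau> = 1 \<and> \<tau> ` B = C \<and> \<tau> \<circ> \<tau> = id"
    unfolding B_def
  proof (rule exchange_block_with_top[OF m a lam hd t])
    show "C \<subseteq> {..<m * (n + a)}"
      using C_iff B_N' permutes_less_iff[OF pk] by auto
    show "card C = card {m * n..<a * m + m * n}"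
      unfolding C_def B_def by (rule card_image) (rule permutes_inj_on[OF permutes_inv[OF pk]])
    show "inj_on (\<lambda>x. snd (tpos ?lam' ?tt x)) C"
    proof (rule inj_onI)
      fix x y assume xy: "x \<in> C" "y \<in> C" "snd (tpos ?lam' ?tt x) = snd (tpos ?lam' ?tt y)"
      then obtain b b' where b: "b \<in> B" "b' \<in> B" "x = \<rho> b" "y = \<rho> b'" unfolding \<rho>B[symmetric] by blast
      have bl: "b < sum_list ?lam'" "b' < sum_list ?lam'" using b(1,2) B_N' unfolding N' by auto
      have "snd (tpos ?lam' ?tt b) = snd (tpos ?lam' ?tt b')"
        using \<rho> bl xy(3) b(3,4) unfolding mem_column_stabilizer[OF tt] by simp
      moreover have "fst (tpos ?lam' ?tt b) = 0" "fst (tpos ?lam' ?tt b') = 0"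
        using b(1,2) unfolding row[symmetric] mem_tabloid_of[OF tt] by simp_all
      ultimately show "x = y" using tpos_eqI[OF tt bl] b(3,4) by (simp add: prod_eq_iff)
    qed
    fix x y assume xy: "x \<in> C" "y < m * (n + a)" "x div m = y div m"
    have block_n: "m * n \<le> z \<longleftrightarrow> n \<le> z div m" for z
      unfolding less_eq_div_iff_mult_less_eq[OF m(1)] by (simp only: mult.commute)
    have "k x \<in> B" using xy(1) C_iff by simp
    moreover have "k x div m = k y div m"
      using wreath_same_block[OF k, of x y] xy(2,3) \<open>k x \<in> B\<close> B_N' permutes_less_iff[OF pk] by simp
    ultimately have "k y \<in> B" using xy(2) permutes_less_iff[OF pk] unfolding B_N' block_n by simp
    then show "y \<in> C" using C_iff by simp
  qed
  then obtain \<tau> where \<tau>: "\<tau> \<in> wreath m (n + a)" "\<tau> \<in> column_stabilizer ?lam' ?tt" "sign \<tau> = 1"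
    "\<tau> ` B = C" "\<tau> \<circ> \<tau> = id"
    by blast
  define k' where "k' = k \<circ> \<tau>"
  have k': "k' \<in> wreath m (n + a)" unfolding k'_def by (rule wreath_comp[OF k \<tau>(1)])
  have pk'': "k' permutes {..<sum_list ?lam'}" using wreath_permutes[OF k'] by (simp only: N')
  have "k ` C = B" unfolding C_def image_comp permutes_inv_o[OF pk] by simp
  then have k'B: "k' ` B = B" unfolding k'_def image_comp[symmetric] \<tau>(4) .
  have p\<tau>: "\<tau> permutes {..<sum_list ?lam'}" by (rule column_stabilizer_permutes[OF \<tau>(2)])
  have "k = k' \<circ> \<tau>" unfolding k'_def comp_assoc \<tau>(5) by simp
  then have "polytabloid ?lam' (k \<circ> ?tt) = pact (k' \<circ> \<tau>) (polytabloid ?lam' ?tt)"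
    using pact_polytabloid[OF tt pk'] by simp
  also have "\<dots> = pact k' (polytabloid ?lam' (\<tau> \<circ> ?tt))"
    by (simp only: pact_comp[OF pk'' p\<tau>] pact_polytabloid[OF tt p\<tau>])
  also have "\<dots> = polytabloid ?lam' (k' \<circ> ?tt)"
    by (simp only: polytabloid_column_stabilizer[OF tt \<tau>(2)] \<tau>(3) of_int_1 cfun.scale_one
        pact_polytabloid[OF tt pk''])
  finally have eq: "polytabloid ?lam' (k \<circ> ?tt) = polytabloid ?lam' (k' \<circ> ?tt)" .
  have top': "tabloid_of ?lam' (k' \<circ> ?tt) 0 = {m * n..<a * m + m * n}"
    using k'B by (simp add: tabloid_of_comp row B_def)
  have "top_part (polytabloid ?lam' (k \<circ> ?tt)) = polytabloid lam (k' \<circ> t)"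
    unfolding eq top_coeff_polytabloid_top[OF lam(2)[symmetric] tableau_comp[OF tt pk''] top']
    by (simp only: tail_tableau_comp tail_cons_tableau)
  \<comment> \<open>The entries of \<open>t\<close> are less than \<open>m * n\<close>, so on them
    \<open>l\<close> and \<open>k'\<close> agree.\<close>
  also define l where "l = (\<lambda>x. if x < m * n then k' x else x)"
  have l: "l \<in> wreath m n" unfolding l_def by (rule wreath_restrict[OF k' k'B[unfolded B_def]])
  have pl: "l permutes {..<sum_list lam}" using wreath_permutes[OF l] by (simp only: lam(2))
  have "polytabloid lam (k' \<circ> t) = polytabloid lam (l \<circ> t)"
    by (rule tableau_cong) (use tableau_apply_less[OF t] in \<open>simp add: l_def lam(2)\<close>)
  also have "\<dots> = pact l (polytabloid lam t)" using pact_polytabloid[OF t pl] by simp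
  finally show ?thesis using that[OF l] by blast
qed

text \<open>The sum over the group repairs the fact that \<open>top_part\<close> singles out one
  union of \<open>a\<close> blocks. It is left unnormalised, which only rescales the result by a
  positive constant.\<close>

definition lift_functional ::
    "((tabloid \<Rightarrow> complex) \<Rightarrow> complex) \<Rightarrow> (tabloid \<Rightarrow> complex) \<Rightarrow> complex" where
  "lift_functional \<theta> v = \<theta> (top_part (\<Sum>k\<in>wreath m (n + a). pact k v))"

lemma wreath_sum_in_specht:
  assumes "v \<in> vecs (specht (a * m # lam))"
  shows "(\<Sum>k\<in>wreath m (n + a). pact k v) \<in> vecs (specht (a * m # lam))"
proof (rule cfun.subspace_sum[OF subspace_specht])
  fix k assume "k \<in> wreath m (n + a)"
  then have "k \<in> symgrp (sum_list (a * m # lam))" unfolding sum_list_Cons_eq by (simp add: wreath_def)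
  then show "pact k v \<in> vecs (specht (a * m # lam))" by (rule pact_in_specht[OF _ assms])
qed

lemma top_in_specht: "v \<in> vecs (specht (a * m # lam)) \<Longrightarrow> top_part v \<in> vecs (specht lam)"
  using top_coeff_in_specht[of v "a * m" lam] by (simp only: lam(2))

text \<open>Translation by \<open>l\<close> merely reorders the sum over the group; linearity is
  inherited at each stage.\<close>

lemma lift_functional_invariant:
  assumes \<theta>: "invariant_functional lam (wreath m n) \<theta>"
  shows "invariant_functional (a * m # lam) (wreath m (n + a)) (lift_functional \<theta>)"
  unfolding invariant_functional_def
proof (intro conjI ballI allI)
  fix v assume v: "v \<in> vecs (specht (a * m # lam))"
  note v' = top_in_specht[OF wreath_sum_in_specht[OF v]]
  show "lift_functional \<theta> (fscale c v) = c * lift_functional \<theta> v" for c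
    unfolding lift_functional_def pact_scale cfun.scale_sum_right[symmetric] top_coeff_scale
    by (rule invariant_functionalD(2)[OF \<theta> v'])
  show "lift_functional \<theta> (pact l v) = lift_functional \<theta> v" if l: "l \<in> wreath m (n + a)" for l
  proof -
    have "(\<Sum>k\<in>wreath m (n + a). pact k (pact l v)) = (\<Sum>k\<in>wreath m (n + a). pact k v)"
    proof (rule sum.reindex_bij_witness[where j = "\<lambda>k. k \<circ> l" and i = "\<lambda>k. k \<circ> inv l"])
      fix k assume k: "k \<in> wreath m (n + a)"
      note pl = wreath_permutes[OF l]
      show "k \<circ> l \<circ> inv l = k" "k \<circ> inv l \<circ> l = k"
        by (simp_all add: fun_eq_iff permutes_inverses[OF pl])
      show "k \<circ> l \<in> wreath m (n + a)" "k \<circ> inv l \<in> wreath m (n + a)"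
        by (simp_all add: wreath_comp[OF k] wreath_inv l)
      show "pact (k \<circ> l) v = pact k (pact l v)" by (rule pact_comp[OF wreath_permutes[OF k] pl])
    qed
    then show ?thesis by (simp only: lift_functional_def)
  qed
  fix u assume u: "u \<in> vecs (specht (a * m # lam))"
  show "lift_functional \<theta> (v + u) = lift_functional \<theta> v + lift_functional \<theta> u"
    unfolding lift_functional_def pact_add sum.distrib top_coeff_add
    by (rule invariant_functionalD(1)[OF \<theta> v' top_in_specht[OF wreath_sum_in_specht[OF u]]])
qed

text \<open>The constant counts the group elements with a nonzero term. Each of these terms is a
  wreath translate of the polytabloid of \<open>t\<close>, so all have the same value under
  \<open>\<theta>\<close>, and the identity is among them. The constant is chosen before
  \<open>\<theta>\<close>, so linear relations between lifted functionals descend.\<close>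

lemma lift_functional_cons_tableau:
  assumes t: "tableau lam t"
  obtains c :: nat where "c > 0" "\<And>\<theta>. invariant_functional lam (wreath m n) \<theta> \<Longrightarrow>
    lift_functional \<theta> (polytabloid (a * m # lam) (cons_tableau (m * n) t)) = of_nat c * \<theta> (polytabloid lam t)"
proof -
  let ?lam' = "a * m # lam" and ?tt = "cons_tableau (m * n) t" and ?K = "wreath m (n + a)"
  let ?p = "\<lambda>k. top_part (polytabloid ?lam' (k \<circ> ?tt))"
  define Z where "Z = {k \<in> ?K. ?p k \<noteq> 0}"
  have tt: "tableau ?lam' ?tt" by (rule tableau_cons_mn[OF t])
  have e: "polytabloid lam t \<in> vecs (specht lam)" by (rule polytabloid_in_specht[OF t])
  have "?p id = polytabloid lam t"
    using top_coeff_polytabloid_top[OF lam(2)[symmetric] tt tabloid_of_cons_tableau]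
    by (simp add: tail_cons_tableau)
  moreover have "polytabloid lam t \<noteq> 0" using polytabloid_tabloid_of[OF t] by auto
  ultimately have "?p id \<noteq> 0" by (simp only: not_False_eq_True)
  then have "id \<in> Z" unfolding Z_def by (intro CollectI conjI id_in_wreath)
  then have "card Z > 0" by (auto simp: card_gt_0_iff Z_def)
  moreover have "lift_functional \<theta> (polytabloid ?lam' ?tt) = of_nat (card Z) * \<theta> (polytabloid lam t)"
    if \<theta>: "invariant_functional lam (wreath m n) \<theta>" for \<theta>
  proof -
    have pk: "k permutes {..<sum_list ?lam'}" if "k \<in> ?K" for k
      using wreath_permutes[OF that] by (simp only: sum_list_Cons_eq)
    have "(\<Sum>k\<in>?K. pact k (polytabloid ?lam' ?tt)) = (\<Sum>k\<in>?K. polytabloid ?lam' (k \<circ> ?tt))"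
      by (intro sum.cong refl pact_polytabloid[OF tt] pk)
    then have "lift_functional \<theta> (polytabloid ?lam' ?tt) = \<theta> (\<Sum>k\<in>?K. ?p k)"
      by (simp only: lift_functional_def top_coeff_sum)
    also have "\<dots> = (\<Sum>k\<in>?K. \<theta> (?p k))"
      by (rule invariant_functional_sum[OF \<theta>])
        (simp_all only: finite_wreath top_in_specht polytabloid_in_specht tableau_comp[OF tt pk])
    also have "\<dots> = (\<Sum>k\<in>?K. if ?p k \<noteq> 0 then \<theta> (polytabloid lam t) else 0)"
    proof (rule sum.cong[OF refl])
      fix k assume k: "k \<in> ?K"
      show "\<theta> (?p k) = (if ?p k \<noteq> 0 then \<theta> (polytabloid lam t) else 0)"
      proof (cases "?p k = 0")
        case True
        then show ?thesis by (simp only: invariant_functional_zero[OF \<theta>] simp_thms if_False)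
      next
        case False
        then obtain l where "l \<in> wreath m n" "?p k = pact l (polytabloid lam t)"
          by (rule top_coeff_wreath_translate[OF t k])
        then have "\<theta> (?p k) = \<theta> (polytabloid lam t)"
          using invariant_functionalD(3)[OF \<theta> _ e] by (simp only:)
        then show ?thesis using False by (simp only: simp_thms if_True)
      qed
    qed
    also have "\<dots> = (\<Sum>k\<in>Z. \<theta> (polytabloid lam t))"
      unfolding Z_def by (rule sum.inter_filter[symmetric]) simp
    also have "\<dots> = of_nat (card Z) * \<theta> (polytabloid lam t)" by simp
    finally show ?thesis .
  qed
  ultimately show ?thesis using that[of "card Z"] by blast
qed

text \<open>A basis for the small shape is represented by functionals; their lifts give orbit
  functions for the large shape that are again independent, because the lifts remember the values on
  all polytabloids.\<close>

lemma plethysm_coeff_Cons_le: "plethysm_coeff [n] m lam \<le> plethysm_coeff [n + a] m (a * m # lam)"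
proof -
  let ?lam' = "a * m # lam"
  obtain t where t: "tableau lam t" using tableau_exists by blast
  let ?tt = "cons_tableau (m * n) t"
  have tt: "tableau ?lam' ?tt" by (rule tableau_cons_mn[OF t])
  \<comment> \<open>The extended list must be weakly decreasing for its Specht module to be
    simple.\<close>
  have "x \<le> a * m" if "x \<in> set lam" for x
  proof -
    have "x \<le> hd lam" using that lam(1) by (cases lam) auto
    also have "hd lam \<le> 2 * m" using hd by simp
    also have "\<dots> \<le> a * m" using a by simp
    finally show ?thesis .
  qed
  then have lam': "sorted_wrt (\<ge>) ?lam'" using lam(1) by simp
  let ?f = "orbit_function m n (polytabloid lam t)"
  let ?g = "orbit_function m (n + a) (polytabloid ?lam' ?tt)"
  obtain B where B: "finite B" "cfun.independent B"
    "B \<subseteq> {?f \<theta> |\<theta>. invariant_functional lam (wreath m n) \<theta>}"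
    "{?f \<theta> |\<theta>. invariant_functional lam (wreath m n) \<theta>} \<subseteq> cfun.span B"
    "card B = plethysm_coeff [n] m lam"
    by (rule plethysm_coeff_basis[OF m(1) lam t])
  obtain B' where B': "finite B'" "cfun.independent B'"
    "B' \<subseteq> {?g \<theta> |\<theta>. invariant_functional ?lam' (wreath m (n + a)) \<theta>}"
    "{?g \<theta> |\<theta>. invariant_functional ?lam' (wreath m (n + a)) \<theta>} \<subseteq> cfun.span B'"
    "card B' = plethysm_coeff [n + a] m ?lam'"
    by (rule plethysm_coeff_basis[OF m(1) lam' sum_list_Cons_eq tt])
  have "\<forall>b\<in>B. \<exists>\<theta>. b = ?f \<theta> \<and> invariant_functional lam (wreath m n) \<theta>" using B(3) by blast
  from bchoice[OF this] obtain \<Theta>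
    where \<Theta>: "\<forall>b\<in>B. b = ?f (\<Theta> b) \<and> invariant_functional lam (wreath m n) (\<Theta> b)" ..
  define h where "h b = ?g (lift_functional (\<Theta> b))" for b
  have c0: "c b = 0" if c: "(\<Sum>b\<in>B. fscale (c b) (h b)) = 0" and b: "b \<in> B" for c b
  proof -
    have vanish: "(\<Sum>b\<in>B. c b * \<Theta> b (polytabloid lam s)) = 0" if s: "tableau lam s" for s
    proof -
      let ?ss = "cons_tableau (m * n) s"
      \<comment> \<open>Evaluating the orbit functions at this \<open>g\<close> gives the lifts at
        the polytabloid of \<open>?ss\<close>. The factor \<open>d\<close> obtained there may vary
        with \<open>s\<close>, but it is positive and common to all \<open>b\<close>.\<close>
      obtain g where g: "g permutes {..<sum_list ?lam'}" "\<And>x. x \<in> young ?lam' \<Longrightarrow> g (?tt x) = ?ss x"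
        using tableau_transfer[OF tt tableau_cons_mn[OF s]] by blast
      have G: "g \<in> symgrp (m * (n + a))" using g(1) unfolding sum_list_Cons_eq by (simp add: symgrp_def)
      have "pact g (polytabloid ?lam' ?tt) = polytabloid ?lam' (g \<circ> ?tt)"
        by (rule pact_polytabloid[OF tt g(1)])
      also have "\<dots> = polytabloid ?lam' ?ss" by (rule tableau_cong) (simp add: g(2))
      finally have pg: "pact g (polytabloid ?lam' ?tt) = polytabloid ?lam' ?ss" .
      obtain d :: nat where d: "d > 0" "\<And>\<theta>. invariant_functional lam (wreath m n) \<theta> \<Longrightarrow>
          lift_functional \<theta> (polytabloid ?lam' ?ss) = of_nat d * \<theta> (polytabloid lam s)"
        using lift_functional_cons_tableau[OF s] by blast
      have "0 = (\<Sum>b\<in>B. fscale (c b) (h b)) (g, row_tabloid (n + a))" using c by simp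
      also have "\<dots> = (\<Sum>b\<in>B. c b * lift_functional (\<Theta> b) (polytabloid ?lam' ?ss))"
        using G by (simp add: sum_fun_apply fscale_apply h_def orbit_function_def pg)
      also have "\<dots> = (\<Sum>b\<in>B. of_nat d * (c b * \<Theta> b (polytabloid lam s)))"
        using \<Theta> d(2) by (intro sum.cong) auto
      also have "\<dots> = of_nat d * (\<Sum>b\<in>B. c b * \<Theta> b (polytabloid lam s))"
        by (rule sum_distrib_left[symmetric])
      finally show ?thesis using d(1) by simp
    qed
    \<comment> \<open>At a group element \<open>g\<close> and the row tabloid this function takes
      the value considered in \<open>vanish\<close> for the tableau \<open>g \<circ> t\<close>;
      elsewhere all orbit functions are zero.\<close>
    have "(\<Sum>b\<in>B. fscale (c b) b) = 0"
    proof
      fix z :: "(nat \<Rightarrow> nat) \<times> tabloid"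
      obtain g T where z: "z = (g, T)" by fastforce
      have "(\<Sum>b\<in>B. fscale (c b) b) z = (\<Sum>b\<in>B. c b * ?f (\<Theta> b) z)"
        unfolding sum_fun_apply fscale_apply using \<Theta> by (intro sum.cong refl) metis
      also have "\<dots> = 0"
      proof (cases "g \<in> symgrp (m * n) \<and> T = row_tabloid n")
        case True
        then have g: "g permutes {..<sum_list lam}" by (simp add: symgrp_def lam(2))
        show ?thesis
          using vanish[OF tableau_comp[OF t g]] True
          by (simp add: z orbit_function_def pact_polytabloid[OF t g])
      next
        case False
        then show ?thesis unfolding z orbit_function_def by (intro sum.neutral) auto
      qed
      finally show "(\<Sum>b\<in>B. fscale (c b) b) z = 0 z" by simp
    qed
    from cfun.independentD[OF B(2) B(1) subset_refl this b] show ?thesis .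
  qed
  have inj: "inj_on h B" by (rule independent_family(1)[OF B(1)]) (rule c0)
  have ind: "cfun.independent (h ` B)" by (rule independent_family(2)[OF B(1)]) (rule c0)
  have "h b \<in> cfun.span B'" if "b \<in> B" for b
  proof (rule subsetD[OF B'(4)])
    show "h b \<in> {?g \<theta> |\<theta>. invariant_functional ?lam' (wreath m (n + a)) \<theta>}"
      unfolding h_def using \<Theta> that lift_functional_invariant by blast
  qed
  then have "h ` B \<subseteq> cfun.span B'" by blast
  then have "card (h ` B) \<le> card B'" using cfun.independent_span_bound[OF B'(1) ind] by blast
  then show ?thesis using B(5) B'(5) card_image[OF inj] by simp
qed

end

theorem theorem1p2p1:
  fixes m n a :: nat and lam :: "nat list"
  assumes "m > 0" and "n > 0"
    and "is_partition lam (m * n)"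
    and "hd lam < 2 * m"
    and "a \<ge> 2"
    and "even m"
  shows "plethysm_coeff [n] m lam \<le> plethysm_coeff [n + a] m (a * m # lam)"
  using assms by (intro plethysm_coeff_Cons_le) (simp_all add: is_partition_def)

end
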